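(* Let $(B,\|\cdot\|)$ be a real separable Banach space, let $X, X_1, X_2, \ldots$ be i.i.d. $B$-valued random variables and $S_n=\sum_{i=1}^n X_i$. Let $0\le q\le1$ and $h\in\mathcal{H}_q$, let $\Psi(x)=\sqrt{xh(x)}$ for $x\ge0$, and $a_n=\Psi(n)$. Assume $\mathbb{E}X=0$, $\mathbb{E}\,\Psi^{-1}(\|X\|)<\infty$, and $S_n/a_n\to0$ in probability. Then $$(1-q)^{1/2}\lambda\le\limsup_{n\to\infty}\frac{\|S_n\|}{a_n}\le\lambda\quad\text{a.s.},$$ where $$\lambda^2=\limsup_{x\to\infty}\frac{2\Psi^{-1}(xLLx)}{x^2LLx}H(x).$$
   Context: $Lt=\log(t\vee e)$ and $LLt=L(Lt)$ for $t\ge0$. $\mathcal{H}$ denotes the set of all continuous, non-decreasing functions $h:[0,\infty)\to(0,\infty)$ that are slowly varying at infinity. For $0\le\tau\le1$ let $f_\tau(t)=\exp((Lt)^\tau)$. For $0\le q<1$, $\mathcal{H}_q$ is the class of all $h\in\mathcal{H}$ such that $\lim_{t\to\infty}h(tf_\tau(t))/h(t)=1$ for all $0<\tau<1-q$; and $\mathcal{H}_1=\mathcal{H}$. $\Psi^{-1}$ is the inverse function of $\Psi$. $B_1^*$ is the closed unit ball of the dual $B^*$, and $H(t)=\sup_{f\in B_1^*}\mathbb{E} f^2(X)I\{\|X\|\le t\}$ for $t\ge0$. $\lambda\in[0,\infty]$. *)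

theory Defs
  imports "HOL-Probability.Probability"
begin

definition L :: "real \<Rightarrow> real" where
  "L t = ln (max t (exp 1))"

definition LL :: "real \<Rightarrow> real" where
  "LL t = L (L t)"

definition f_tau :: "real \<Rightarrow> real \<Rightarrow> real" where
  "f_tau \<tau> t = exp ((L t) powr \<tau>)"

definition slowly_varying :: "(real \<Rightarrow> real) \<Rightarrow> bool" where
  "slowly_varying h \<longleftrightarrow> (\<forall>c>0. ((\<lambda>t. h (c * t) / h t) \<longlongrightarrow> 1) at_top)"

definition class_H :: "(real \<Rightarrow> real) set" where
  "class_H = {h. continuous_on {0..} h \<and> mono_on {0..} h \<and> (\<forall>t\<ge>0. h t > 0)
               \<and> slowly_varying h}"

definition class_Hq :: "real \<Rightarrow> (real \<Rightarrow> real) set" where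
  "class_Hq q = (if q = 1 then class_H else
     {h \<in> class_H. \<forall>\<tau>. 0 < \<tau> \<and> \<tau> < 1 - q \<longrightarrow>
        ((\<lambda>t. h (t * f_tau \<tau> t) / h t) \<longlongrightarrow> 1) at_top})"

definition Psi :: "(real \<Rightarrow> real) \<Rightarrow> real \<Rightarrow> real" where
  "Psi h x = sqrt (x * h x)"

text \<open>Inverse of Psi on [0,oo) (Psi is a strictly increasing bijection of [0,oo)).\<close>
definition Psi_inv :: "(real \<Rightarrow> real) \<Rightarrow> real \<Rightarrow> real" where
  "Psi_inv h y = (THE x. x \<ge> 0 \<and> Psi h x = y)"

definition dual_ball :: "('b::real_normed_vector \<Rightarrow> real) set" where
  "dual_ball = {f. bounded_linear f \<and> onorm f \<le> 1}"

definition H_fun :: "'a measure \<Rightarrow> ('a \<Rightarrow> 'b::real_normed_vector) \<Rightarrow> real \<Rightarrow> real" where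
  "H_fun M X t = (SUP f\<in>dual_ball.
      integral\<^sup>L M (\<lambda>\<omega>. (f (X \<omega>))\<^sup>2 * indicator {\<omega>. norm (X \<omega>) \<le> t} \<omega>))"

end

theory Submission
  imports Defs
begin

text \<open>
  Upper bound. By the entropy method, the norm of a sum of bounded centered variables obeys a Bernstein inequality
  around its mean in which only the weak variance appears, with the sharp constant. Applied to \<open>X\<close> truncated just
  below \<open>\<Psi> n / LLn\<close> it gives the exponent \<open>LLn\<close> at the level \<open>\<lambda> a_n\<close>; the mean is of smaller order than \<open>a_n\<close> because
  \<open>S_n / a_n\<close> tends to 0 in probability and, by the Efron--Stein inequality, the norm has small variance. The remaining
  large summands are controlled by \<open>\<alpha> n = n E (min (\<parallel>X\<parallel> / a_n) 1)^4\<close>, whose sum over geometrically growing \<open>n\<close> is at most a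
  multiple of \<open>E \<Psi>^{-1}(\<parallel>X\<parallel>)\<close>. Ottaviani's inequality and the Borel--Cantelli lemma conclude.

  Lower bound. Let \<open>n\<close> correspond to a point where the limit superior defining \<open>\<lambda>\<close> is nearly attained, by a functional
  \<open>f\<close>. As \<open>h\<close> is almost constant on \<open>[n, n f_\<tau>(n)]\<close>, this range contains about \<open>(log n)^\<tau>\<close> independent geometric blocks, on
  each of which \<open>f(S_{cm} - S_m)\<close> exceeds nearly \<open>\<theta>^{1/2} \<lambda> a_{cm}\<close> with probability about \<open>(log n)^{-\<theta>}\<close>, by tilting. For
  \<open>\<theta> < \<tau> < 1 - q\<close> some block succeeds with probability close to 1; no summability over different \<open>n\<close> is needed.
\<close>

section \<open>Norming functionals\<close>

text \<open>No second moment of X is assumed, so the truncated weak variance \<open>H\<close> may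
  diverge, and the level at which it is read off shapes both halves. At the x with
  \<open>\<Psi>i (x * LL x)\<close> = n, the definition of lambda makes n H(x) at most about (lambda
  a_n)^2 / (2 LLn), the variance for which a Gaussian tail at lambda a_n has exponent LLn. Summands
  between this level and a_n are neither negligible nor covered by a second moment. They are counted
  instead: two of them below a small multiple of a_n do no harm, and three occur with probability at
  most a multiple of (\<alpha> l^4)^3 = \<alpha> (\<alpha> l^6)^2, where l is about LLn. This is the
  origin of the sixth powers. In the lower bound \<alpha> l^6 <= 1 decides which blocks are usable.
  The sum of \<alpha> along a geometric sequence is bounded wherever the sequence starts, so at most
  a multiple of (LLn)^6 blocks are lost, against about (log n)^\<tau> available ones. A block
  succeeds at level \<theta>^(1/2) lambda with probability about (log n)^(-\<theta>); every \<theta>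
  < 1 - q is within reach, which gives the factor (1 - q)^(1/2).\<close>

definition sublin :: "('b::real_vector \<Rightarrow> real) \<Rightarrow> bool" where
  "sublin p \<longleftrightarrow> (\<forall>x y. p (x + y) \<le> p x + p y) \<and> (\<forall>t\<ge>0. \<forall>x. p (t *\<^sub>R x) = t * p x)"

lemma sublin_add: "sublin p \<Longrightarrow> p (x + y) \<le> p x + p y"
  by (auto simp: sublin_def)

lemma sublin_scale: "sublin p \<Longrightarrow> 0 \<le> t \<Longrightarrow> p (t *\<^sub>R x) = t * p x"
  by (auto simp: sublin_def)

lemma sublin_zero: "sublin p \<Longrightarrow> p 0 = 0"
  using sublin_scale[of p 0 0] by simp

lemma sublin_minus: "sublin p \<Longrightarrow> - p (- x) \<le> p x"
  using sublin_add[of p x "- x"] sublin_zero[of p] by simp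

text \<open>A minimal sublinear functional \<open>p\<close> agrees with \<open>sub_tilt p y\<close> for every \<open>y\<close>, which forces additivity.\<close>

definition sub_tilt :: "('b::real_vector \<Rightarrow> real) \<Rightarrow> 'b \<Rightarrow> 'b \<Rightarrow> real" where
  "sub_tilt p y x = (INF t\<in>{0..}. p (x + t *\<^sub>R y) - t * p y)"

lemma sub_tilt_lower:
  assumes "sublin p" "0 \<le> t"
  shows "- p (- x) \<le> p (x + t *\<^sub>R y) - t * p y"
proof -
  have "p (t *\<^sub>R y) \<le> p (x + t *\<^sub>R y) + p (- x)"
    using sublin_add[OF assms(1), of "x + t *\<^sub>R y" "- x"] by simp
  then show ?thesis using sublin_scale[OF assms] by simp
qed

lemma sub_tilt_bdd: "sublin p \<Longrightarrow> bdd_below ((\<lambda>t. p (x + t *\<^sub>R y) - t * p y) ` {0..})"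
  by (rule bdd_belowI2[where m="- p (- x)"]) (auto intro: sub_tilt_lower)

lemma sub_tilt_le: "sublin p \<Longrightarrow> 0 \<le> t \<Longrightarrow> sub_tilt p y x \<le> p (x + t *\<^sub>R y) - t * p y"
  unfolding sub_tilt_def by (rule cINF_lower[OF sub_tilt_bdd]) auto

lemma sub_tilt_le_self: "sublin p \<Longrightarrow> sub_tilt p y x \<le> p x"
  using sub_tilt_le[of p 0 y x] by simp

lemma sub_tilt_ge: "(\<And>t. 0 \<le> t \<Longrightarrow> c \<le> p (x + t *\<^sub>R y) - t * p y) \<Longrightarrow> c \<le> sub_tilt p y x"
  unfolding sub_tilt_def by (rule cINF_greatest) auto

text \<open>The parameters t and s of two infima combine into t + s, which gives subadditivity; for
  r > 0, replacing t by r t gives homogeneity.\<close>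

lemma sublin_sub_tilt:
  assumes p: "sublin p"
  shows "sublin (sub_tilt p y)"
  unfolding sublin_def
proof (intro conjI allI impI)
  fix x z
  have "sub_tilt p y (x + z) - (p (x + t *\<^sub>R y) - t * p y) \<le> sub_tilt p y z" if t: "0 \<le> t" for t
  proof (rule sub_tilt_ge)
    fix s :: real assume s: "0 \<le> s"
    have "sub_tilt p y (x + z) \<le> p ((x + z) + (t + s) *\<^sub>R y) - (t + s) * p y"
      using sub_tilt_le[OF p] s t by simp
    also have "(x + z) + (t + s) *\<^sub>R y = (x + t *\<^sub>R y) + (z + s *\<^sub>R y)"
      by (simp add: algebra_simps)
    finally show "sub_tilt p y (x + z) - (p (x + t *\<^sub>R y) - t * p y) \<le> p (z + s *\<^sub>R y) - s * p y"
      using sublin_add[OF p, of "x + t *\<^sub>R y" "z + s *\<^sub>R y"] by (simp add: algebra_simps)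
  qed
  then have "sub_tilt p y (x + z) - sub_tilt p y z \<le> p (x + t *\<^sub>R y) - t * p y" if "0 \<le> t" for t
    using that by (simp add: diff_le_eq add.commute)
  then have "sub_tilt p y (x + z) - sub_tilt p y z \<le> sub_tilt p y x"
    by (rule sub_tilt_ge)
  then show "sub_tilt p y (x + z) \<le> sub_tilt p y x + sub_tilt p y z" by simp
next
  fix r :: real and x assume r: "0 \<le> r"
  show "sub_tilt p y (r *\<^sub>R x) = r * sub_tilt p y x"
  proof (cases "r = 0")
    case True
    have "sub_tilt p y 0 \<le> 0" using sub_tilt_le_self[OF p, of y 0] sublin_zero[OF p] by simp
    moreover have "0 \<le> sub_tilt p y 0"
      by (rule sub_tilt_ge) (use sublin_scale[OF p] in simp)
    ultimately show ?thesis using True by simp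
  next
    case False
    then have r: "0 < r" using r by simp
    show ?thesis
    proof (rule antisym)
      have "sub_tilt p y (r *\<^sub>R x) / r \<le> sub_tilt p y x"
      proof (rule sub_tilt_ge)
        fix t :: real assume t: "0 \<le> t"
        have "sub_tilt p y (r *\<^sub>R x) \<le> p (r *\<^sub>R x + (r * t) *\<^sub>R y) - r * t * p y"
          using sub_tilt_le[OF p, of "r * t"] r t by simp
        also have "p (r *\<^sub>R x + (r * t) *\<^sub>R y) = r * p (x + t *\<^sub>R y)"
          using sublin_scale[OF p, of r "x + t *\<^sub>R y"] r by (simp add: scaleR_right_distrib)
        finally show "sub_tilt p y (r *\<^sub>R x) / r \<le> p (x + t *\<^sub>R y) - t * p y"
          using r by (simp add: field_simps)
      qed
      then show "sub_tilt p y (r *\<^sub>R x) \<le> r * sub_tilt p y x" using r by (simp add: field_simps)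
      show "r * sub_tilt p y x \<le> sub_tilt p y (r *\<^sub>R x)"
      proof (rule sub_tilt_ge)
        fix t :: real assume t: "0 \<le> t"
        have "sub_tilt p y x \<le> p (x + (t / r) *\<^sub>R y) - (t / r) * p y"
          using sub_tilt_le[OF p, of "t / r"] r t by simp
        then have "r * sub_tilt p y x \<le> r * p (x + (t / r) *\<^sub>R y) - t * p y"
          using r by (simp add: field_simps)
        also have "r * p (x + (t / r) *\<^sub>R y) = p (r *\<^sub>R x + t *\<^sub>R y)"
          using r sublin_scale[OF p, of r "x + (t / r) *\<^sub>R y"] by (simp add: algebra_simps)
        finally show "r * sub_tilt p y x \<le> p (r *\<^sub>R x + t *\<^sub>R y) - t * p y" .
      qed
    qed
  qed
qed

lemma minimal_sublin_linear:
  fixes p :: "'b::real_vector \<Rightarrow> real"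
  assumes p: "sublin p" and min: "\<And>q. sublin q \<Longrightarrow> (\<And>x. q x \<le> p x) \<Longrightarrow> q = p"
  shows "linear p"
proof -
  have eq: "sub_tilt p y = p" for y
    by (rule min) (auto intro: sublin_sub_tilt p sub_tilt_le_self)
  \<comment> \<open>The parameter t = 1 gives p x = \<open>sub_tilt p y x\<close> <= p (x + y) - p
    y, the half of additivity that sublinearity lacks.\<close>
  have add: "p (x + y) = p x + p y" for x y
    using sub_tilt_le[OF p, of 1 y x] eq[of y] sublin_add[OF p, of x y] by simp
  have neg: "p (- x) = - p x" for x
    using add[of x "- x"] sublin_zero[OF p] by simp
  show ?thesis
  proof (rule linearI)
    show "p (r *\<^sub>R x) = r *\<^sub>R p x" for r x
      using sublin_scale[OF p, of "\<bar>r\<bar>" x] neg[of "\<bar>r\<bar> *\<^sub>R x"] by (cases "r \<ge> 0") auto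
  qed (rule add)
qed

text \<open>Zorn's lemma on the sublinear functionals below \<open>p0\<close>. A chain is bounded by
  its pointwise infimum, which is finite because every member is at least - \<open>p0 (- x)\<close>
  at x.\<close>

lemma minimal_sublin_exists:
  fixes p0 :: "'b::real_vector \<Rightarrow> real"
  assumes p0: "sublin p0"
  obtains p where "linear p" "\<And>x. p x \<le> p0 x"
proof -
  define A where "A = {p::'b \<Rightarrow> real. sublin p \<and> p \<le> p0}"
  \<comment> \<open>The order is reversed, so that a maximal element in Zorn's lemma is a minimal
    functional.\<close>
  define P where "P = (\<lambda>p q::'b \<Rightarrow> real. q \<le> p)"
  have "\<exists>m\<in>A. \<forall>a\<in>A. P m a \<longrightarrow> a = m"
  proof (rule predicate_Zorn)
    show "partial_order_on A (relation_of P A)"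
      by (auto simp: P_def relation_of_def partial_order_on_def preorder_on_def refl_on_def trans_def antisym_def)
    fix C assume C: "C \<in> Chains (relation_of P A)"
    show "\<exists>u\<in>A. \<forall>a\<in>C. P a u"
    proof (cases "C = {}")
      case True then show ?thesis using p0 by (auto simp: A_def)
    next
      case False
      have CA: "C \<subseteq> A" using C by (auto simp: Chains_def relation_of_def)
      have tot: "p \<le> q \<or> q \<le> p" if "p \<in> C" "q \<in> C" for p q
        using C that by (auto simp: Chains_def relation_of_def P_def)
      have sub: "sublin p" "p \<le> p0" if "p \<in> C" for p using CA that by (auto simp: A_def)
      define u where "u = (\<lambda>x. INF p\<in>C. p x)"
      have bdd: "bdd_below ((\<lambda>p. p x) ` C)" for x
      proof (rule bdd_belowI2)
        fix p assume "p \<in> C"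
        then show "- p0 (- x) \<le> p x"
          using sublin_minus[OF sub(1), of p x] le_funD[OF sub(2), of p "- x"] by simp
      qed
      have ule: "u x \<le> p x" if "p \<in> C" for p x
        unfolding u_def by (rule cINF_lower[OF bdd that])
      have uge: "c \<le> u x" if "\<And>p. p \<in> C \<Longrightarrow> c \<le> p x" for c x
        unfolding u_def using False that by (intro cINF_greatest) auto
      have "sublin u" unfolding sublin_def
      proof (intro conjI allI impI)
        fix x y
        have "u (x + y) - p x \<le> u y" if p: "p \<in> C" for p
        proof (rule uge)
          fix q assume q: "q \<in> C"
          \<comment> \<open>The smaller of the two functionals serves at both x and y; this is where
            the chain property enters.\<close>
          from tot[OF p q] show "u (x + y) - p x \<le> q y"
          proof
            assume "p \<le> q"
            then have "p y \<le> q y" by (simp add: le_fun_def)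
            then show ?thesis using ule[OF p, of "x + y"] sublin_add[OF sub(1)[OF p], of x y] by simp
          next
            assume "q \<le> p"
            then have "q x \<le> p x" by (simp add: le_fun_def)
            then show ?thesis using ule[OF q, of "x + y"] sublin_add[OF sub(1)[OF q], of x y] by simp
          qed
        qed
        then have "u (x + y) - u y \<le> p x" if "p \<in> C" for p
          using that by (simp add: diff_le_eq add.commute)
        then have "u (x + y) - u y \<le> u x" by (rule uge)
        then show "u (x + y) \<le> u x + u y" by simp
      next
        fix t :: real and x assume t: "0 \<le> t"
        show "u (t *\<^sub>R x) = t * u x"
        proof (cases "t = 0")
          case True
          have "(\<lambda>p. p (0::'b)) ` C = (\<lambda>p. 0) ` C" using sublin_zero[OF sub(1)] by (intro image_cong) auto
          then have "(\<lambda>p. p (0::'b)) ` C = {0}" using False by (simp add: image_constant_conv)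
          then have "u 0 = 0" by (simp add: u_def)
          then show ?thesis using True by simp
        next
          case False
          then have t: "0 < t" using t by simp
          have "u (t *\<^sub>R x) / t \<le> u x"
          proof (rule uge)
            fix p assume "p \<in> C"
            then show "u (t *\<^sub>R x) / t \<le> p x"
              using ule[of p "t *\<^sub>R x"] sublin_scale[OF sub(1), of p t x] t by (simp add: field_simps)
          qed
          moreover have "t * u x \<le> u (t *\<^sub>R x)"
          proof (rule uge)
            fix p assume "p \<in> C"
            then show "t * u x \<le> p (t *\<^sub>R x)"
              using ule[of p x] sublin_scale[OF sub(1), of p t x] t by simp
          qed
          ultimately show ?thesis using t by (simp add: field_simps)
        qed
      qed
      moreover have "u \<le> p0"
      proof -
        obtain p where "p \<in> C" using False by auto
        then show ?thesis using ule[of p] sub(2)[of p] by (auto simp: le_fun_def intro: order_trans)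
      qed
      ultimately show ?thesis using ule by (auto simp: A_def P_def le_fun_def)
    qed
  qed
  then obtain m where m: "m \<in> A" "\<And>a. a \<in> A \<Longrightarrow> a \<le> m \<Longrightarrow> a = m" by (auto simp: P_def)
  have "linear m"
  proof (rule minimal_sublin_linear)
    fix q assume "sublin q" "\<And>x. q x \<le> m x"
    then show "q = m" using m by (intro m(2)) (auto simp: A_def le_fun_def intro: order_trans)
  qed (use m in \<open>auto simp: A_def\<close>)
  then show thesis using m that by (auto simp: A_def le_fun_def)
qed

lemma dual_ballI:
  assumes "linear f" "\<And>x. f x \<le> norm x"
  shows "f \<in> dual_ball"
proof -
  have "norm (f x) \<le> 1 * norm x" for x
    using assms(2)[of x] assms(2)[of "- x"] linear_neg[OF assms(1), of x] by simp
  then show ?thesis unfolding dual_ball_def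
    using assms(1) by (auto intro!: bounded_linear_intro[where K=1] onorm_bound simp: linear_add linear_scale)
qed

lemma dual_ballD:
  assumes "f \<in> dual_ball"
  shows "bounded_linear f" "\<bar>f x\<bar> \<le> norm x"
proof -
  show bl: "bounded_linear f" using assms by (simp add: dual_ball_def)
  have "norm (f x) \<le> onorm f * norm x" by (rule onorm[OF bl])
  also have "\<dots> \<le> 1 * norm x" using assms by (intro mult_right_mono) (auto simp: dual_ball_def)
  finally show "\<bar>f x\<bar> \<le> norm x" by simp
qed

lemma dual_ball_zero: "(\<lambda>_. 0) \<in> dual_ball"
  by (rule dual_ballI) (auto intro: linear_zero)

text \<open>A form of the Hahn-Banach theorem. A linear functional below
  \<open>sub_tilt norm z\<close> is below the norm, and the parameter t = 1 at - z bounds its value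
  there by norm 0 - norm z, so that it norms z.\<close>

theorem norming_functional:
  fixes z :: "'b::real_normed_vector"
  obtains f where "f \<in> dual_ball" "f z = norm z"
proof -
  have N: "sublin (norm :: 'b \<Rightarrow> real)" by (auto simp: sublin_def norm_triangle_ineq)
  obtain f where f: "linear f" "\<And>x. f x \<le> sub_tilt norm z x"
    using minimal_sublin_exists[OF sublin_sub_tilt[OF N, of z]] by blast
  have le: "f x \<le> norm x" for x using f(2)[of x] sub_tilt_le_self[OF N, of z x] by simp
  have "f (- z) \<le> - norm z" using f(2)[of "- z"] sub_tilt_le[OF N, of 1 z "- z"] by simp
  then have "f z = norm z" using le[of z] linear_neg[OF f(1), of z] by simp
  then show thesis using that dual_ballI[OF f(1) le] by blast
qed

section \<open>Subadditivity of entropy\<close>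

text \<open>Jensen's inequality in two variables, with the supporting plane at the point of means as
  hypothesis: both linear terms are centred and integrate to zero. With \<open>g2\<close> constant
  and r = 0 it is the inequality in one variable.\<close>

lemma integral_supporting_bound:
  fixes G g1 g2 :: "'c \<Rightarrow> real"
  assumes "prob_space N" "integrable N G" "integrable N g1" "integrable N g2"
    and "\<And>y. y \<in> space N \<Longrightarrow> c + p * (g1 y - integral\<^sup>L N g1) + r * (g2 y - integral\<^sup>L N g2) \<le> G y"
  shows "c \<le> integral\<^sup>L N G"
proof -
  interpret prob_space N by fact
  have "integral\<^sup>L N (\<lambda>y. c + p * (g1 y - integral\<^sup>L N g1) + r * (g2 y - integral\<^sup>L N g2)) \<le> integral\<^sup>L N G"
    by (rule integral_mono) (use assms in auto)
  then show ?thesis using assms(3,4) by (simp add: prob_space)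
qed

lemma integral_in_interval:
  fixes g :: "'c \<Rightarrow> real"
  assumes "prob_space N" "g \<in> borel_measurable N" "\<And>y. y \<in> space N \<Longrightarrow> g y \<in> {lo..hi}"
  shows "integrable N g" "integral\<^sup>L N g \<in> {lo..hi}"
proof -
  interpret prob_space N by fact
  show i: "integrable N g"
    using assms(2,3) by (intro integrable_const_bound[where B="max \<bar>lo\<bar> \<bar>hi\<bar>"] AE_I2) force+
  show "integral\<^sup>L N g \<in> {lo..hi}"
    using integral_ge_const[OF i, of lo] integral_le_const[OF i, of hi] assms(3) by (auto intro!: AE_I2)
qed

text \<open>\<open>D w v\<close> stands for the Bregman divergence \<open>\<Phi> w - \<Phi> v - \<Phi>' v * (w - v)\<close>, so that its integral bounds
  the conditional \<open>\<Phi>\<close>-entropy; \<open>supp\<close> is its joint convexity. The cases \<open>\<Phi> w = w * ln w\<close> and \<open>\<Phi> w = w\<^sup>2\<close> give the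
  exponential and the variance bound below.\<close>

lemma entropy_tensorization:
  fixes N :: "'c measure" and W :: "('i \<Rightarrow> 'c) \<Rightarrow> real" and V :: "'i \<Rightarrow> ('i \<Rightarrow> 'c) \<Rightarrow> real"
    and \<Phi> :: "real \<Rightarrow> real" and D :: "real \<Rightarrow> real \<Rightarrow> real"
  assumes N: "prob_space N" and I: "finite I"
    and \<Phi>: "\<Phi> \<in> borel_measurable borel" "\<And>w. w \<in> {lo..hi} \<Longrightarrow> \<bar>\<Phi> w\<bar> \<le> C"
    and D: "case_prod D \<in> borel_measurable borel"
      "\<And>w v. w \<in> {lo..hi} \<Longrightarrow> v \<in> {lo..hi} \<Longrightarrow> \<bar>D w v\<bar> \<le> C"
    and supp: "\<And>w0 v0. w0 \<in> {lo..hi} \<Longrightarrow> v0 \<in> {lo..hi} \<Longrightarrow>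
      \<exists>p r. \<forall>w\<in>{lo..hi}. \<forall>v\<in>{lo..hi}. D w0 v0 + p * (w - w0) + r * (v - v0) \<le> D w v"
    and breg: "\<And>w0 v. w0 \<in> {lo..hi} \<Longrightarrow> v \<in> {lo..hi} \<Longrightarrow>
      \<exists>p. \<forall>w\<in>{lo..hi}. \<Phi> w - \<Phi> w0 \<le> D w v + p * (w - w0)"
    and W: "W \<in> borel_measurable (PiM I (\<lambda>_. N))"
      "\<And>x. x \<in> space (PiM I (\<lambda>_. N)) \<Longrightarrow> W x \<in> {lo..hi}"
    and V: "\<And>i. i \<in> I \<Longrightarrow> V i \<in> borel_measurable (PiM I (\<lambda>_. N))"
      "\<And>i x. i \<in> I \<Longrightarrow> x \<in> space (PiM I (\<lambda>_. N)) \<Longrightarrow> V i x \<in> {lo..hi}"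
      "\<And>i x y. i \<in> I \<Longrightarrow> x \<in> space (PiM I (\<lambda>_. N)) \<Longrightarrow> y \<in> space N \<Longrightarrow> V i (x(i := y)) = V i x"
  shows "(\<integral>x. \<Phi> (W x) \<partial>PiM I (\<lambda>_. N)) - \<Phi> (\<integral>x. W x \<partial>PiM I (\<lambda>_. N))
    \<le> (\<Sum>i\<in>I. \<integral>x. D (W x) (V i x) \<partial>PiM I (\<lambda>_. N))"
  using I W V
proof (induction I arbitrary: W V rule: finite_induct)
  case empty
  then show ?case by (simp add: PiM_empty lebesgue_integral_count_space_finite)
next
  case (insert j I)
  interpret N: prob_space N by fact
  interpret P: product_prob_space "\<lambda>_. N" "insert j I" by unfold_locales
  let ?PI = "PiM I (\<lambda>_. N)" and ?PJ = "PiM (insert j I) (\<lambda>_. N)"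
  have PI: "prob_space ?PI" by (rule prob_space_PiM) (rule N)
  have PJ: "prob_space ?PJ" by (rule prob_space_PiM) (rule N)
  note W = insert.prems(1,2) and V = insert.prems(3,4,5)
  have upd: "x(j := y) \<in> space ?PJ" if "x \<in> space ?PI" "y \<in> space N" for x y
    using that by (auto simp: space_PiM PiE_def extensional_def)
  have meas: "(\<lambda>(x, y). x(j := y)) \<in> measurable (?PI \<Otimes>\<^sub>M N) ?PJ"
    using measurable_add_dim[of j I "\<lambda>_. N"] by simp
  have joint: "(\<lambda>(x, y). G (x(j := y))) \<in> borel_measurable (?PI \<Otimes>\<^sub>M N)"
    if "G \<in> borel_measurable ?PJ" for G :: "_ \<Rightarrow> real"
    using measurable_compose[OF meas that] by (simp add: case_prod_beta')
  have slice: "(\<lambda>y. G (x(j := y))) \<in> borel_measurable N"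
    if "G \<in> borel_measurable ?PJ" "x \<in> space ?PI" for G :: "_ \<Rightarrow> real" and x
    using measurable_compose[OF measurable_Pair1'[OF that(2), of N] joint[OF that(1)]] by simp
  have fub: "integral\<^sup>L ?PJ G = (\<integral>x. (\<integral>y. G (x(j := y)) \<partial>N) \<partial>?PI)"
    and fubm: "(\<lambda>x. \<integral>y. G (x(j := y)) \<partial>N) \<in> borel_measurable ?PI"
    and fubb: "\<And>x. x \<in> space ?PI \<Longrightarrow> integrable N (\<lambda>y. G (x(j := y))) \<and> (\<integral>y. G (x(j := y)) \<partial>N) \<in> {l..h}"
    if G: "G \<in> borel_measurable ?PJ" "\<And>x. x \<in> space ?PJ \<Longrightarrow> G x \<in> {l..h}" for G :: "_ \<Rightarrow> real" and l h
  proof -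
    show "integral\<^sup>L ?PJ G = (\<integral>x. (\<integral>y. G (x(j := y)) \<partial>N) \<partial>?PI)"
      by (rule P.product_integral_insert)
        (use insert.hyps integral_in_interval(1)[OF PJ G] in auto)
    show "(\<lambda>x. \<integral>y. G (x(j := y)) \<partial>N) \<in> borel_measurable ?PI"
      by (rule N.borel_measurable_lebesgue_integral) (rule joint[OF G(1)])
    show "integrable N (\<lambda>y. G (x(j := y))) \<and> (\<integral>y. G (x(j := y)) \<partial>N) \<in> {l..h}" if "x \<in> space ?PI" for x
      using integral_in_interval[OF N slice[OF G(1) that]] G(2)[OF upd[OF that]] by blast
  qed
  \<comment> \<open>The new coordinate j is averaged out, and the induction hypothesis is applied to
    the averages on the remaining coordinates.\<close>
  define W' where "W' = (\<lambda>x. \<integral>y. W (x(j := y)) \<partial>N)"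
  define V' where "V' = (\<lambda>i x. \<integral>y. V i (x(j := y)) \<partial>N)"
  have W'b: "W' x \<in> {lo..hi}" if "x \<in> space ?PI" for x
    unfolding W'_def using fubb[OF W] that by blast
  have V'b: "V' i x \<in> {lo..hi}" if "i \<in> I" "x \<in> space ?PI" for i x
    unfolding V'_def using fubb[OF V(1,2), of i] that by blast
  have W'm: "W' \<in> borel_measurable ?PI" unfolding W'_def by (rule fubm[OF W])
  have V'm: "V' i \<in> borel_measurable ?PI" if "i \<in> I" for i
    unfolding V'_def using fubm[OF V(1,2), of i] that by blast
  have IH: "(\<integral>x. \<Phi> (W' x) \<partial>?PI) - \<Phi> (\<integral>x. W' x \<partial>?PI) \<le> (\<Sum>i\<in>I. \<integral>x. D (W' x) (V' i x) \<partial>?PI)"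
  proof (rule insert.IH)
    fix i x z assume i: "i \<in> I" and x: "x \<in> space ?PI" and z: "z \<in> space N"
    \<comment> \<open>Updates at the distinct coordinates i and j commute, so the average over j
      still ignores coordinate i.\<close>
    have "V i (x(i := z, j := y)) = V i (x(j := y))" if "y \<in> space N" for y
    proof -
      have "x(i := z, j := y) = x(j := y, i := z)" using i insert.hyps by (intro fun_upd_twist) auto
      moreover have "V i (x(j := y, i := z)) = V i (x(j := y))"
        by (rule V(3)[OF _ upd[OF x that] z]) (use i in simp)
      ultimately show ?thesis by (simp only:)
    qed
    then show "V' i (x(i := z)) = V' i x"
      unfolding V'_def by (intro Bochner_Integration.integral_cong) auto
  qed (use W'b V'b W'm V'm in auto)
  have \<Phi>W: "(\<lambda>x. \<Phi> (W x)) \<in> borel_measurable ?PJ" "\<And>x. x \<in> space ?PJ \<Longrightarrow> \<Phi> (W x) \<in> {-C..C}"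
    using measurable_compose[OF W(1) \<Phi>(1)] \<Phi>(2)[OF W(2)] by (auto simp: abs_le_iff minus_le_iff)
  have DW: "(\<lambda>x. D (W x) (V i x)) \<in> borel_measurable ?PJ" "\<And>x. x \<in> space ?PJ \<Longrightarrow> D (W x) (V i x) \<in> {-C..C}"
    if "i \<in> insert j I" for i
    using measurable_compose[OF borel_measurable_Pair[OF W(1) V(1)[OF that]] D(1)] D(2)[OF W(2) V(2)[OF that]]
    by (auto simp: abs_le_iff minus_le_iff)
  have DW': "integrable ?PI (\<lambda>x. D (W' x) (V' i x))" if "i \<in> I" for i
  proof (rule integral_in_interval[where lo="-C" and hi=C])
    show "(\<lambda>x. D (W' x) (V' i x)) \<in> borel_measurable ?PI"
      using measurable_compose[OF borel_measurable_Pair[OF W'm V'm[OF that]] D(1)] by simp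
    show "D (W' x) (V' i x) \<in> {-C..C}" if "x \<in> space ?PI" for x
      using D(2)[OF W'b V'b[OF \<open>i \<in> I\<close>]] that by (auto simp: abs_le_iff minus_le_iff)
  qed (rule PI)
  have \<Phi>W': "integrable ?PI (\<lambda>x. \<Phi> (W' x))"
  proof (rule integral_in_interval[where lo="-C" and hi=C])
    show "(\<lambda>x. \<Phi> (W' x)) \<in> borel_measurable ?PI"
      using measurable_compose[OF W'm \<Phi>(1)] by simp
    show "\<Phi> (W' x) \<in> {-C..C}" if "x \<in> space ?PI" for x
      using \<Phi>(2)[OF W'b] that by (auto simp: abs_le_iff minus_le_iff)
  qed (rule PI)
  have intI: "integrable ?PI (\<lambda>x. \<integral>y. G (x(j := y)) \<partial>N)"
    if G: "G \<in> borel_measurable ?PJ" "\<And>x. x \<in> space ?PJ \<Longrightarrow> G x \<in> {l..h}" for G :: "_ \<Rightarrow> real" and l h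
    by (rule integral_in_interval[where lo=l and hi=h]) (use fubm[OF G] fubb[OF G] PI in auto)
  \<comment> \<open>Joint convexity of \<open>D\<close>, through its supporting plane at the
    averaged point, shows that averaging over j can only decrease the i-th term.\<close>
  have I_part: "(\<integral>x. D (W' x) (V' i x) \<partial>?PI) \<le> (\<integral>x. D (W x) (V i x) \<partial>?PJ)" if i: "i \<in> I" for i
  proof -
    have iJ: "i \<in> insert j I" using i by simp
    have "D (W' x) (V' i x) \<le> (\<integral>y. D (W (x(j := y))) (V i (x(j := y))) \<partial>N)" if x: "x \<in> space ?PI" for x
    proof -
      obtain p r where pr: "\<forall>w\<in>{lo..hi}. \<forall>v\<in>{lo..hi}. D (W' x) (V' i x) + p * (w - W' x) + r * (v - V' i x) \<le> D w v"
        using supp[OF W'b[OF x] V'b[OF i x]] by blast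
      show ?thesis
      proof (rule integral_supporting_bound[OF N, where ?g1.0="\<lambda>y. W (x(j := y))" and ?g2.0="\<lambda>y. V i (x(j := y))" and p=p and r=r])
        show "integrable N (\<lambda>y. D (W (x(j := y))) (V i (x(j := y))))" by (rule conjunct1[OF fubb[OF DW[OF iJ] x]])
        show "integrable N (\<lambda>y. W (x(j := y)))" by (rule conjunct1[OF fubb[OF W x]])
        show "integrable N (\<lambda>y. V i (x(j := y)))" by (rule conjunct1[OF fubb[OF V(1,2)[OF iJ] x]])
        show "D (W' x) (V' i x) + p * (W (x(j := y)) - (\<integral>y. W (x(j := y)) \<partial>N)) +
            r * (V i (x(j := y)) - (\<integral>y. V i (x(j := y)) \<partial>N)) \<le> D (W (x(j := y))) (V i (x(j := y)))"
          if "y \<in> space N" for y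
        proof -
          have "(\<integral>y. W (x(j := y)) \<partial>N) = W' x" "(\<integral>y. V i (x(j := y)) \<partial>N) = V' i x" by (simp_all only: W'_def V'_def)
          then show ?thesis
            by (simp only:) (rule pr[rule_format, OF W(2)[OF upd[OF x that]] V(2)[OF iJ upd[OF x that]]])
        qed
      qed
    qed
    then have "(\<integral>x. D (W' x) (V' i x) \<partial>?PI) \<le> (\<integral>x. (\<integral>y. D (W (x(j := y))) (V i (x(j := y))) \<partial>N) \<partial>?PI)"
      by (intro integral_mono DW'[OF i] intI[OF DW[OF iJ]])
    then show ?thesis using fub[OF DW[OF iJ]] by simp
  qed
  \<comment> \<open>Along coordinate j the function \<open>V j\<close> is constant. With this
    constant as v, \<open>breg\<close> bounds the entropy in the single coordinate j by the mean of
    \<open>D\<close>.\<close>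
  have j_part: "(\<integral>y. \<Phi> (W (x(j := y))) \<partial>N) - \<Phi> (W' x) \<le> (\<integral>y. D (W (x(j := y))) (V j (x(j := y))) \<partial>N)"
    if x: "x \<in> space ?PI" for x
  proof -
    obtain y0 where y0: "y0 \<in> space N" using N.not_empty by blast
    have V0: "V j (x(j := y)) = V j (x(j := y0))" if "y \<in> space N" for y
      by (rule V(3)[OF insertI1 upd[OF x y0] that, unfolded fun_upd_upd])
    have v: "V j (x(j := y0)) \<in> {lo..hi}" by (rule V(2)[OF _ upd[OF x y0]]) simp
    obtain p where p: "\<forall>w\<in>{lo..hi}. \<Phi> w - \<Phi> (W' x) \<le> D w (V j (x(j := y0))) + p * (w - W' x)"
      using breg[OF W'b[OF x] v] by blast
    note i1 = fubb[OF W x] and i2 = fubb[OF \<Phi>W x] and i3 = fubb[OF DW[of j] x]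
    have "0 \<le> (\<integral>y. D (W (x(j := y))) (V j (x(j := y))) - (\<Phi> (W (x(j := y))) - \<Phi> (W' x)) \<partial>N)"
    proof (rule integral_supporting_bound[OF N, where ?g1.0="\<lambda>y. W (x(j := y))" and ?g2.0="\<lambda>y. 0" and p="- p" and r=0])
      show "0 + - p * (W (x(j := y)) - (\<integral>y. W (x(j := y)) \<partial>N)) + 0 * (0 - integral\<^sup>L N (\<lambda>y. 0))
        \<le> D (W (x(j := y))) (V j (x(j := y))) - (\<Phi> (W (x(j := y))) - \<Phi> (W' x))" if "y \<in> space N" for y
        
        proof -
          have "\<Phi> (W (x(j := y))) - \<Phi> (W' x) \<le> D (W (x(j := y))) (V j (x(j := y))) + p * (W (x(j := y)) - W' x)"
            unfolding V0[OF that] by (rule p[rule_format, OF W(2)[OF upd[OF x that]]])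
          moreover have "(\<integral>y. W (x(j := y)) \<partial>N) = W' x" by (simp only: W'_def)
          ultimately show ?thesis by simp
        qed
    qed (rule Bochner_Integration.integrable_diff[OF conjunct1[OF i3] Bochner_Integration.integrable_diff[OF conjunct1[OF i2]]]
        conjunct1[OF i1] | simp)+
    then show ?thesis using i2 i3 by (simp add: N.prob_space)
  qed
  have "(\<integral>x. \<Phi> (W x) \<partial>?PJ) - (\<integral>x. \<Phi> (W' x) \<partial>?PI) = (\<integral>x. (\<integral>y. \<Phi> (W (x(j := y))) \<partial>N) - \<Phi> (W' x) \<partial>?PI)"
    using fub[OF \<Phi>W] intI[OF \<Phi>W] \<Phi>W' by simp
  also have "\<dots> \<le> (\<integral>x. (\<integral>y. D (W (x(j := y))) (V j (x(j := y))) \<partial>N) \<partial>?PI)"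
    by (intro integral_mono Bochner_Integration.integrable_diff intI[OF \<Phi>W] \<Phi>W' intI[OF DW[of j]] j_part) auto
  also have "\<dots> = (\<integral>x. D (W x) (V j x) \<partial>?PJ)" using fub[OF DW[of j]] by simp
  finally have j_total: "(\<integral>x. \<Phi> (W x) \<partial>?PJ) - (\<integral>x. \<Phi> (W' x) \<partial>?PI) \<le> (\<integral>x. D (W x) (V j x) \<partial>?PJ)" .
  have EW: "integral\<^sup>L ?PJ W = integral\<^sup>L ?PI W'" unfolding W'_def by (rule fub[OF W])
  have "(\<Sum>i\<in>I. \<integral>x. D (W' x) (V' i x) \<partial>?PI) \<le> (\<Sum>i\<in>I. \<integral>x. D (W x) (V i x) \<partial>?PJ)"
    by (intro sum_mono I_part)
  then show ?case using IH j_total EW insert.hyps by simp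
qed

section \<open>Concentration of norms of sums\<close>

lemma abs_exp_minus_linear_le:
  fixes a :: real
  assumes "\<bar>a\<bar> \<le> 1"
  shows "\<bar>exp a - 1 - a\<bar> \<le> a\<^sup>2"
proof (cases "a \<ge> 0")
  case True
  then have "exp a \<le> 1 + a + a\<^sup>2" "1 + a \<le> exp a" using exp_bound[of a] assms by auto
  then show ?thesis unfolding abs_le_iff using zero_le_power2[of a] by (intro conjI) linarith+
next
  case False
  define c where "c = - a"
  have c: "0 < c" using False by (simp add: c_def)
  have "(1 + c) * exp (- c) \<le> 1" 
    using exp_ge_add_one_self[of c] mult_right_mono[of "1 + c" "exp c" "exp (- c)"] by (simp add: exp_minus)
  \<comment> \<open>The product equals 1 + c^3.\<close>
  moreover have "1 \<le> (1 + c) * (1 - c + c\<^sup>2)" using c by (simp add: algebra_simps power2_eq_square)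
  ultimately have "(1 + c) * exp (- c) \<le> (1 + c) * (1 - c + c\<^sup>2)" by linarith
  then have "exp (- c) \<le> 1 - c + c\<^sup>2" using c by (subst (asm) mult_le_cancel_left_pos) auto
  then have "exp a \<le> 1 + a + a\<^sup>2" by (simp add: c_def)
  then show ?thesis unfolding abs_le_iff using exp_ge_add_one_self[of a] zero_le_power2[of a] by (intro conjI) linarith+
qed

text \<open>The difference of the two sides has derivative x (exp k - exp x), which has the sign of
  x on [-k, k], so its minimum there is the value 0 at the origin.\<close>

lemma exp_remainder_le:
  fixes t k :: real
  assumes "\<bar>t\<bar> \<le> k"
  shows "1 - exp t + t * exp t \<le> exp k * t\<^sup>2 / 2"
proof -
  define G where "G = (\<lambda>t::real. exp k * t\<^sup>2 / 2 - (1 - exp t + t * exp t))"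
  have der: "(G has_real_derivative (x * (exp k - exp x))) (at x)" for x
    unfolding G_def by (auto intro!: derivative_eq_intros simp: algebra_simps)
  have "G 0 \<le> G t"
  proof (cases "t \<ge> 0")
    case True
    show ?thesis
    proof (rule DERIV_nonneg_imp_nondecreasing[OF True])
      fix x assume "0 \<le> x" "x \<le> t"
      then show "\<exists>y. (G has_real_derivative y) (at x) \<and> 0 \<le> y"
        using der[of x] assms by (intro exI[of _ "x * (exp k - exp x)"]) auto
    qed
  next
    case False
    then have le: "t \<le> 0" by simp
    show ?thesis
    proof (rule DERIV_nonpos_imp_nonincreasing[OF le])
      fix x assume "t \<le> x" "x \<le> 0"
      then show "\<exists>y. (G has_real_derivative y) (at x) \<and> y \<le> 0"
        using der[of x] assms by (intro exI[of _ "x * (exp k - exp x)"]) (auto intro!: mult_nonpos_nonneg)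
    qed
  qed
  then show ?thesis by (simp add: G_def)
qed

text \<open>For bounded Z the remainder of exp (s Z) beyond its linear part is at most s^2 R^2,
  uniformly in the sample point, so the difference quotient converges at an explicit rate.\<close>

lemma mgf_has_derivative:
  fixes Z :: "'c \<Rightarrow> real"
  assumes P: "prob_space P" and Z: "Z \<in> borel_measurable P" "\<And>x. x \<in> space P \<Longrightarrow> \<bar>Z x\<bar> \<le> R"
  shows "((\<lambda>u. \<integral>x. exp (u * Z x) \<partial>P) has_real_derivative (\<integral>x. Z x * exp (u * Z x) \<partial>P)) (at u)"
proof -
  interpret prob_space P by fact
  have R: "0 \<le> R" using Z(2) not_empty by force
  have bd: "exp (v * Z x) \<le> exp (\<bar>v\<bar> * R)" if "x \<in> space P" for v x
  proof -
    have "v * Z x \<le> \<bar>v * Z x\<bar>" by simp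
    also have "\<dots> \<le> \<bar>v\<bar> * R" using Z(2)[OF that] by (simp add: abs_mult mult_left_mono)
    finally show ?thesis by simp
  qed
  have i1: "integrable P (\<lambda>x. exp (v * Z x))" for v
    by (rule integrable_const_bound[where B="exp (\<bar>v\<bar> * R)"]) (use bd Z(1) in \<open>auto intro!: AE_I2\<close>)
  have i2: "integrable P (\<lambda>x. Z x * exp (v * Z x))" for v
  proof (rule integrable_const_bound[where B="R * exp (\<bar>v\<bar> * R)"], rule AE_I2)
    fix x assume "x \<in> space P"
    then show "norm (Z x * exp (v * Z x)) \<le> R * exp (\<bar>v\<bar> * R)"
      using Z(2)[of x] bd[of x v] R by (auto simp: abs_mult intro!: mult_mono)
  qed (use Z(1) in auto)
  let ?F = "\<lambda>u. \<integral>x. exp (u * Z x) \<partial>P" and ?D = "\<integral>x. Z x * exp (u * Z x) \<partial>P"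
  have main: "\<bar>?F (u + s) - ?F u - s * ?D\<bar> \<le> exp (\<bar>u\<bar> * R) * (s\<^sup>2 * R\<^sup>2)" if s: "\<bar>s\<bar> * R \<le> 1" for s
  proof -
    have "?F (u + s) - ?F u - s * ?D = (\<integral>x. exp ((u + s) * Z x) - exp (u * Z x) - s * (Z x * exp (u * Z x)) \<partial>P)"
      using i1 i2[of u] by simp
    also have "\<bar>\<dots>\<bar> \<le> (\<integral>x. exp (\<bar>u\<bar> * R) * (s\<^sup>2 * R\<^sup>2) \<partial>P)"
    proof (rule order_trans[OF integral_abs_bound], rule integral_mono)
      fix x assume x: "x \<in> space P"
      have sz: "\<bar>s * Z x\<bar> \<le> \<bar>s\<bar> * R" using Z(2)[OF x] by (simp add: abs_mult mult_left_mono)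
      have "exp ((u + s) * Z x) - exp (u * Z x) - s * (Z x * exp (u * Z x)) = exp (u * Z x) * (exp (s * Z x) - 1 - s * Z x)"
        by (simp add: algebra_simps exp_add)
      also have "\<bar>\<dots>\<bar> \<le> exp (\<bar>u\<bar> * R) * (s * Z x)\<^sup>2"
        unfolding abs_mult using bd[OF x, of u] abs_exp_minus_linear_le[of "s * Z x"] sz s by (intro mult_mono) auto
      also have "\<dots> \<le> exp (\<bar>u\<bar> * R) * (s\<^sup>2 * R\<^sup>2)"
        using Z(2)[OF x] by (auto simp: power_mult_distrib abs_le_square_iff[symmetric] intro!: mult_left_mono)
      finally show "\<bar>exp ((u + s) * Z x) - exp (u * Z x) - s * (Z x * exp (u * Z x))\<bar> \<le> exp (\<bar>u\<bar> * R) * (s\<^sup>2 * R\<^sup>2)" .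
    qed (use i1 i2[of u] in auto)
    finally show ?thesis by (simp add: prob_space)
  qed
  have "((\<lambda>s. (?F (u + s) - ?F u) / s - ?D) \<longlongrightarrow> 0) (at 0)"
  proof (rule Lim_null_comparison)
    have ev: "eventually (\<lambda>s::real. \<bar>s\<bar> < 1 / (R + 1)) (at 0)"
      using R by (intro order_tendstoD(2)[of _ 0]) (auto intro!: tendsto_eq_intros)
    have ev': "eventually (\<lambda>s::real. s \<noteq> 0) (at 0)" by (simp add: eventually_at_filter)
    show "eventually (\<lambda>s. norm ((?F (u + s) - ?F u) / s - ?D) \<le> exp (\<bar>u\<bar> * R) * R\<^sup>2 * \<bar>s\<bar>) (at 0)"
      using ev ev'
    proof eventually_elim
      case (elim s)
      have "\<bar>s\<bar> * R \<le> 1 / (R + 1) * R" using elim R by (intro mult_right_mono) auto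
      also have "\<dots> \<le> 1" using R by simp
      finally have "\<bar>?F (u + s) - ?F u - s * ?D\<bar> \<le> exp (\<bar>u\<bar> * R) * (s\<^sup>2 * R\<^sup>2)" by (rule main)
      moreover have "(?F (u + s) - ?F u) / s - ?D = (?F (u + s) - ?F u - s * ?D) / s"
        using elim by (simp add: field_simps)
      ultimately show ?case using elim by (simp add: field_simps power2_eq_square abs_mult)
    qed
    show "((\<lambda>s. exp (\<bar>u\<bar> * R) * R\<^sup>2 * \<bar>s\<bar>) \<longlongrightarrow> 0) (at (0::real))"
      by (auto intro!: tendsto_eq_intros)
  qed
  then show ?thesis unfolding DERIV_def by (simp add: Lim_null[symmetric])
qed

lemma borel_measurable_dual_ball [measurable]: "f \<in> dual_ball \<Longrightarrow> f \<in> borel_measurable borel"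
  using dual_ballD(1) by (intro borel_measurable_continuous_onI) (auto intro: linear_continuous_on)

text \<open>Centring and variance are demanded only after a functional is applied:
  \<open>\<sigma>2\<close> bounds the weak variance, which may be far smaller than the mean of the
  squared norm.\<close>

locale bounded_centered = prob_space N for N :: "'c measure" +
  fixes Y :: "'c \<Rightarrow> 'b::{banach, second_countable_topology}" and b \<sigma>2 :: real
  assumes Y_meas [measurable]: "Y \<in> borel_measurable N"
    and Y_bound: "norm (Y y) \<le> b" and b_pos: "0 < b"
    and Y_mean: "f \<in> dual_ball \<Longrightarrow> (\<integral>y. f (Y y) \<partial>N) = 0"
    and Y_var: "f \<in> dual_ball \<Longrightarrow> (\<integral>y. (f (Y y))\<^sup>2 \<partial>N) \<le> \<sigma>2"
begin

lemma sigma2_nonneg: "0 \<le> \<sigma>2"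
  using Y_var[OF dual_ball_zero] by simp

text \<open>A functional norming \<open>s\<close> bounds the increment of the norm from below, and \<open>b\<close> bounds it from above;
  hence only the weak variance enters.\<close>

lemma norm_increment:
  shows "integrable N (\<lambda>y. norm (s + Y y) - norm s)" "0 \<le> (\<integral>y. norm (s + Y y) - norm s \<partial>N)"
    and "integrable N (\<lambda>y. (norm (s + Y y) - norm s)\<^sup>2)"
    and "(\<integral>y. (norm (s + Y y) - norm s)\<^sup>2 \<partial>N) \<le> \<sigma>2 + 2 * b * (\<integral>y. norm (s + Y y) - norm s \<partial>N)"
proof -
  obtain f where f: "f \<in> dual_ball" "f s = norm s" by (rule norming_functional)
  let ?D = "\<lambda>y. norm (s + Y y) - norm s"
  have fm [measurable]: "(\<lambda>y. f (Y y)) \<in> borel_measurable N"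
    using measurable_compose[OF Y_meas borel_measurable_dual_ball[OF f(1)]] .
  have fb: "\<bar>f (Y y)\<bar> \<le> b" for y using dual_ballD(2)[OF f(1), of "Y y"] Y_bound[of y] by linarith
  have Db: "\<bar>?D y\<bar> \<le> b" for y
    using norm_triangle_ineq3[of "s + Y y" s] Y_bound[of y] by simp
  have fD: "f (Y y) \<le> ?D y" for y
    using dual_ballD(2)[OF f(1), of "s + Y y"] f(2) bounded_linear.linear[OF dual_ballD(1)[OF f(1)]]
    by (simp add: linear_add)
  \<comment> \<open>With D the increment of the norm, D^2 - f^2 = (D - f)(D + f), where the first
    factor is nonnegative and the second is at most 2 b.\<close>
  have sq: "(?D y)\<^sup>2 \<le> (f (Y y))\<^sup>2 + 2 * b * (?D y - f (Y y))" for y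
  proof -
    have "(?D y - f (Y y)) * (?D y + f (Y y)) \<le> (?D y - f (Y y)) * (2 * b)"
      using fD[of y] fb[of y] Db[of y] by (intro mult_left_mono) linarith+
    then show ?thesis by (simp add: power2_eq_square algebra_simps)
  qed
  show i1: "integrable N ?D"
    by (rule integrable_const_bound[where B=b]) (use Db in auto)
  have i2: "integrable N (\<lambda>y. f (Y y))"
    by (rule integrable_const_bound[where B=b]) (use fb in auto)
  have i3: "integrable N (\<lambda>y. (f (Y y))\<^sup>2)"
    by (rule integrable_const_bound[where B="b\<^sup>2"]) (use fb b_pos in \<open>auto simp: abs_le_square_iff[symmetric]\<close>)
  show i4: "integrable N (\<lambda>y. (?D y)\<^sup>2)"
    by (rule integrable_const_bound[where B="b\<^sup>2"]) (use Db b_pos in \<open>auto simp: abs_le_square_iff[symmetric]\<close>)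
  show "0 \<le> integral\<^sup>L N ?D"
    using integral_mono[OF i2 i1 fD] Y_mean[OF f(1)] by simp
  have "(\<integral>y. (?D y)\<^sup>2 \<partial>N) \<le> (\<integral>y. (f (Y y))\<^sup>2 + 2 * b * (?D y - f (Y y)) \<partial>N)"
    by (rule integral_mono[OF i4 _ sq]) (use i1 i2 i3 in auto)
  also have "\<dots> = (\<integral>y. (f (Y y))\<^sup>2 \<partial>N) + 2 * b * (\<integral>y. ?D y \<partial>N)"
    using i1 i2 i3 Y_mean[OF f(1)] by simp
  finally show "(\<integral>y. (?D y)\<^sup>2 \<partial>N) \<le> \<sigma>2 + 2 * b * (\<integral>y. ?D y \<partial>N)"
    using Y_var[OF f(1)] by linarith
qed

section \<open>Sums over a finite index set under the product measure\<close>

context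
  fixes I :: "'i set"
  assumes I: "finite I"
begin

abbreviation "P \<equiv> PiM I (\<lambda>_. N)"
abbreviation "Z x \<equiv> norm (\<Sum>i\<in>I. Y (x i))"
abbreviation "Zd i x \<equiv> norm (\<Sum>j\<in>I - {i}. Y (x j))"

lemma prob_P: "prob_space P"
  by (rule prob_space_PiM) unfold_locales

lemma norm_sum_le: "J \<subseteq> I \<Longrightarrow> norm (\<Sum>j\<in>J. Y (x j)) \<le> card I * b"
proof -
  assume "J \<subseteq> I"
  then have "norm (\<Sum>j\<in>J. Y (x j)) \<le> card J * b" using Y_bound by (intro order_trans[OF norm_sum] sum_bounded_above)
  also have "\<dots> \<le> card I * b" using b_pos card_mono[OF I \<open>J \<subseteq> I\<close>] by simp
  finally show ?thesis .
qed

lemma Z_meas: "Z \<in> borel_measurable P" and Zd_meas: "Zd i \<in> borel_measurable P"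
  by measurable

lemma sum_delete: "i \<in> I \<Longrightarrow> (\<Sum>i\<in>I. Y (x i)) = (\<Sum>j\<in>I - {i}. Y (x j)) + Y (x i)"
  using I by (simp add: sum.remove add.commute)

lemma Z_diff_le: "i \<in> I \<Longrightarrow> \<bar>Z x - Zd i x\<bar> \<le> b"
  using sum_delete[of i x] norm_triangle_ineq3[of "\<Sum>i\<in>I. Y (x i)" "\<Sum>j\<in>I - {i}. Y (x j)"] Y_bound[of "x i"]
  by simp

text \<open>Convexity of the norm: the mean of the leave-one-out sums is a multiple of the full sum.\<close>

lemma sum_Z_diff_le: "(\<Sum>i\<in>I. Z x - Zd i x) \<le> Z x"
proof (cases "I = {}")
  case False
  let ?S = "\<Sum>i\<in>I. Y (x i)"
  have n: "1 \<le> card I" using I False by (simp add: Suc_leI card_gt_0_iff)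
  have "(\<Sum>i\<in>I. ?S - Y (x i)) = (real (card I) - 1) *\<^sub>R ?S"
    by (simp add: sum_subtractf sum_constant_scaleR scaleR_diff_left)
  then have "(real (card I) - 1) * norm ?S = norm (\<Sum>i\<in>I. ?S - Y (x i))" using n by simp
  also have "\<dots> \<le> (\<Sum>i\<in>I. Zd i x)"
    using sum_delete by (intro order_trans[OF norm_sum] sum_mono) simp
  finally show ?thesis by (simp add: sum_subtractf algebra_simps)
qed simp

lemma integral_nonneg_by_slices:
  fixes Q :: "('i \<Rightarrow> 'c) \<Rightarrow> real"
  assumes i: "i \<in> I" and Q: "integrable P Q"
    and slice: "\<And>x. x \<in> space (PiM (I - {i}) (\<lambda>_. N)) \<Longrightarrow> 0 \<le> (\<integral>y. Q (x(i := y)) \<partial>N)"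
  shows "0 \<le> (\<integral>x. Q x \<partial>P)"
proof -
  interpret PP: product_prob_space "\<lambda>_. N" I by unfold_locales
  have ins: "insert i (I - {i}) = I" using i by auto
  have "integral\<^sup>L P Q = (\<integral>x. (\<integral>y. Q (x(i := y)) \<partial>N) \<partial>PiM (I - {i}) (\<lambda>_. N))"
    using PP.product_integral_insert[of "I - {i}" i Q] Q I ins by simp
  also have "\<dots> \<ge> 0" by (rule integral_nonneg_AE, rule AE_I2) (rule slice)
  finally show ?thesis .
qed

text \<open>The leave-one-out norm \<open>Zd i\<close> ignores coordinate i. For fixed other
  coordinates the weight is therefore a constant and \<open>norm_increment\<close> applies with s
  the leave-one-out sum. The weight 1 serves the variance bound, an exponential weight the bound on
  the Laplace transform.\<close>

lemma weighted_increment: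
  fixes g :: "real \<Rightarrow> real"
  assumes i: "i \<in> I" and g: "g \<in> borel_measurable borel" "\<And>z. 0 \<le> g z" 
    and gB: "\<And>z. 0 \<le> z \<Longrightarrow> z \<le> card I * b \<Longrightarrow> g z \<le> B"
  shows "integrable P (\<lambda>x. g (Zd i x))" "integrable P (\<lambda>x. g (Zd i x) * (Z x - Zd i x))"
    "integrable P (\<lambda>x. g (Zd i x) * (Z x - Zd i x)\<^sup>2)"
    "0 \<le> (\<integral>x. g (Zd i x) * (Z x - Zd i x) \<partial>P)"
    "(\<integral>x. g (Zd i x) * (Z x - Zd i x)\<^sup>2 \<partial>P) \<le> 
      \<sigma>2 * (\<integral>x. g (Zd i x) \<partial>P) + 2 * b * (\<integral>x. g (Zd i x) * (Z x - Zd i x) \<partial>P)"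
proof -
  interpret P: prob_space P by (rule prob_P)
  note [measurable] = g(1) Z_meas Zd_meas
  have gb: "g (Zd i x) \<le> B" for x by (rule gB) (auto intro: norm_sum_le)
  have B: "0 \<le> B" using gb g(2) order_trans by blast
  show j1: "integrable P (\<lambda>x. g (Zd i x))"
    by (rule P.integrable_const_bound[where B=B]) (use gb g(2) in auto)
  show j2: "integrable P (\<lambda>x. g (Zd i x) * (Z x - Zd i x))"
    by (rule P.integrable_const_bound[where B="B * b"])
      (use gb g(2) B Z_diff_le[OF i] in \<open>auto simp: abs_mult intro!: AE_I2 mult_mono\<close>)
  show j3: "integrable P (\<lambda>x. g (Zd i x) * (Z x - Zd i x)\<^sup>2)"
    by (rule P.integrable_const_bound[where B="B * b\<^sup>2"])
      (use gb g(2) B Z_diff_le[OF i] b_pos in \<open>auto simp: abs_mult abs_le_square_iff[symmetric] intro!: AE_I2 mult_mono\<close>)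
  have zd: "Zd i (x(i := y)) = Zd i x" for x y
    by (intro arg_cong[where f=norm] sum.cong) auto
  have z: "Z (x(i := y)) = norm ((\<Sum>j\<in>I - {i}. Y (x j)) + Y y)" for x y
  proof -
    have "(\<Sum>j\<in>I - {i}. Y ((x(i := y)) j)) = (\<Sum>j\<in>I - {i}. Y (x j))" by (intro sum.cong) auto
    then show ?thesis using sum_delete[OF i, of "x(i := y)"] by simp
  qed
  show "0 \<le> (\<integral>x. g (Zd i x) * (Z x - Zd i x) \<partial>P)"
  proof (rule integral_nonneg_by_slices[OF i j2])
    fix x
    show "0 \<le> (\<integral>y. g (Zd i (x(i := y))) * (Z (x(i := y)) - Zd i (x(i := y))) \<partial>N)"
      unfolding zd z using norm_increment(2) g(2) by simp
  qed
  let ?Q = "\<lambda>x. g (Zd i x) * \<sigma>2 + 2 * b * (g (Zd i x) * (Z x - Zd i x)) - g (Zd i x) * (Z x - Zd i x)\<^sup>2"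
  have "0 \<le> (\<integral>x. ?Q x \<partial>P)"
  proof (rule integral_nonneg_by_slices[OF i])
    show "integrable P ?Q" using j1 j2 j3 by auto
    fix x
    let ?s = "\<Sum>j\<in>I - {i}. Y (x j)" and ?D = "\<lambda>y. norm ((\<Sum>j\<in>I - {i}. Y (x j)) + Y y) - Zd i x"
    have "(\<integral>y. ?Q (x(i := y)) \<partial>N) = (\<integral>y. g (Zd i x) * (\<sigma>2 + 2 * b * ?D y - (?D y)\<^sup>2) \<partial>N)"
      unfolding zd z by (simp add: algebra_simps)
    also have "\<dots> = g (Zd i x) * (\<integral>y. \<sigma>2 + 2 * b * ?D y - (?D y)\<^sup>2 \<partial>N)" by simp
    also have "(\<integral>y. \<sigma>2 + 2 * b * ?D y - (?D y)\<^sup>2 \<partial>N) = \<sigma>2 + 2 * b * (\<integral>y. ?D y \<partial>N) - (\<integral>y. (?D y)\<^sup>2 \<partial>N)"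
      using norm_increment(1,3)[of ?s] by (simp add: prob_space)
    also have "g (Zd i x) * \<dots> \<ge> 0" using norm_increment(4)[of ?s] g(2) by simp
    finally show "0 \<le> (\<integral>y. ?Q (x(i := y)) \<partial>N)" .
  qed
  also have "(\<integral>x. ?Q x \<partial>P) = \<sigma>2 * (\<integral>x. g (Zd i x) \<partial>P) + 2 * b * (\<integral>x. g (Zd i x) * (Z x - Zd i x) \<partial>P)
     - (\<integral>x. g (Zd i x) * (Z x - Zd i x)\<^sup>2 \<partial>P)"
    using j1 j2 j3 by simp
  finally show "(\<integral>x. g (Zd i x) * (Z x - Zd i x)\<^sup>2 \<partial>P) \<le> 
      \<sigma>2 * (\<integral>x. g (Zd i x) \<partial>P) + 2 * b * (\<integral>x. g (Zd i x) * (Z x - Zd i x) \<partial>P)" by simp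
qed

lemma integrable_Z: "integrable P Z"
proof -
  interpret P: prob_space P by (rule prob_P)
  show ?thesis
    by (rule P.integrable_const_bound[where B="card I * b"]) (use norm_sum_le Z_meas in auto)
qed

text \<open>Tensorization with the square and D w v = (w - v)^2. Each coordinate costs
  \<open>\<sigma>2\<close> plus 2 b times its mean increment, and the increments add up to at most
  the norm of the whole sum.\<close>

theorem efron_stein_norm:
  "(\<integral>x. (Z x)\<^sup>2 \<partial>P) - (\<integral>x. Z x \<partial>P)\<^sup>2 \<le> card I * \<sigma>2 + 2 * b * (\<integral>x. Z x \<partial>P)"
proof -
  interpret P: prob_space P by (rule prob_P)
  define R where "R = card I * b"
  have "(\<integral>x. (Z x)\<^sup>2 \<partial>P) - (\<integral>x. Z x \<partial>P)\<^sup>2 \<le> (\<Sum>i\<in>I. \<integral>x. (Z x - Zd i x)\<^sup>2 \<partial>P)"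
  proof (rule entropy_tensorization[where \<Phi>="\<lambda>w. w\<^sup>2" and D="\<lambda>w v. (w - v)\<^sup>2" and lo=0 and hi=R and C="R\<^sup>2"])
    show "case_prod (\<lambda>w v. (w - v)\<^sup>2) \<in> borel_measurable (borel :: (real \<times> real) measure)"
      by (simp add: borel_prod[symmetric] split_beta')
    show "\<bar>(w - v)\<^sup>2\<bar> \<le> R\<^sup>2" if "w \<in> {0..R}" "v \<in> {0..R}" for w v
      using that by (auto simp: abs_le_square_iff[symmetric])
    show "\<bar>w\<^sup>2\<bar> \<le> R\<^sup>2" if "w \<in> {0..R}" for w using that by (auto simp: abs_le_square_iff[symmetric])
    show "\<exists>p r. \<forall>w\<in>{0..R}. \<forall>v\<in>{0..R}. (w0 - v0)\<^sup>2 + p * (w - w0) + r * (v - v0) \<le> (w - v)\<^sup>2" for w0 v0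
    proof (intro exI ballI)
      fix w v
      have "0 \<le> ((w - v) - (w0 - v0))\<^sup>2" by simp
      then show "(w0 - v0)\<^sup>2 + (2 * (w0 - v0)) * (w - w0) + (- (2 * (w0 - v0))) * (v - v0) \<le> (w - v)\<^sup>2"
        by (simp add: power2_eq_square algebra_simps)
    qed
    show "\<exists>p. \<forall>w\<in>{0..R}. w\<^sup>2 - w0\<^sup>2 \<le> (w - v)\<^sup>2 + p * (w - w0)" for w0 v
    proof (intro exI ballI)
      fix w
      have "0 \<le> (w0 - v)\<^sup>2" by simp
      then show "w\<^sup>2 - w0\<^sup>2 \<le> (w - v)\<^sup>2 + (2 * v) * (w - w0)"
        by (simp add: power2_eq_square algebra_simps)
    qed
    show "Zd i (x(i := y)) = Zd i x" for x y i
      by (intro arg_cong[where f=norm] sum.cong) auto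
  qed (use I Z_meas Zd_meas norm_sum_le prob_space_axioms in \<open>auto simp: R_def\<close>)
  also have "\<dots> \<le> (\<Sum>i\<in>I. \<sigma>2 + 2 * b * (\<integral>x. Z x - Zd i x \<partial>P))"
  proof (rule sum_mono)
    fix i assume "i \<in> I"
    then show "(\<integral>x. (Z x - Zd i x)\<^sup>2 \<partial>P) \<le> \<sigma>2 + 2 * b * (\<integral>x. Z x - Zd i x \<partial>P)"
      using weighted_increment(5)[of i "\<lambda>_. 1" 1] by (simp add: P.prob_space)
  qed
  also have "\<dots> = card I * \<sigma>2 + 2 * b * (\<integral>x. (\<Sum>i\<in>I. Z x - Zd i x) \<partial>P)"
    using weighted_increment(2)[of _ "\<lambda>_. 1" 1] by (subst Bochner_Integration.integral_sum) (auto simp: sum.distrib sum_distrib_left)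
  also have "\<dots> \<le> card I * \<sigma>2 + 2 * b * (\<integral>x. Z x \<partial>P)"
    using b_pos weighted_increment(2)[of _ "\<lambda>_. 1" 1]
    by (intro add_left_mono mult_left_mono integral_mono integrable_Z sum_Z_diff_le Bochner_Integration.integrable_sum) auto
  finally show ?thesis .
qed

lemma integrable_exp_Z: "integrable P (\<lambda>x. exp (u * Z x))" "integrable P (\<lambda>x. Z x * exp (u * Z x))"
proof -
  interpret P: prob_space P by (rule prob_P)
  note [measurable] = Z_meas
  have bd: "exp (u * Z x) \<le> exp (\<bar>u\<bar> * (card I * b))" for x
  proof -
    have "u * Z x \<le> \<bar>u\<bar> * Z x" by (intro mult_right_mono) auto
    also have "\<dots> \<le> \<bar>u\<bar> * (card I * b)" by (intro mult_left_mono norm_sum_le) auto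
    finally show ?thesis by simp
  qed
  show "integrable P (\<lambda>x. exp (u * Z x))"
    by (rule P.integrable_const_bound[where B="exp (\<bar>u\<bar> * (card I * b))"]) (use bd in auto)
  show "integrable P (\<lambda>x. Z x * exp (u * Z x))"
    by (rule P.integrable_const_bound[where B="card I * b * exp (\<bar>u\<bar> * (card I * b))"])
      (use bd norm_sum_le b_pos in \<open>auto simp: abs_mult intro!: AE_I2 mult_mono\<close>)
qed

text \<open>Tensorization with w ln w. For t = u (Z - Zd i), the divergence of exp (u Z) from exp (u
  Zd i) is exp (u Zd i) (1 - exp t + t exp t), at most exp (u Zd i) exp (u b) t^2 / 2. The square is
  integrated by \<open>weighted_increment\<close>; then the weight is changed to exp (u Z), for
  which the increments can be summed.\<close>

lemma exp_entropy_bound: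
  assumes u: "0 < u"
  shows "u * (\<integral>x. Z x * exp (u * Z x) \<partial>P) - (\<integral>x. exp (u * Z x) \<partial>P) * ln (\<integral>x. exp (u * Z x) \<partial>P)
    \<le> exp (u * b) * u\<^sup>2 / 2 * (card I * \<sigma>2 * (\<integral>x. exp (u * Z x) \<partial>P) + 2 * b * (\<integral>x. Z x * exp (u * Z x) \<partial>P))"
proof -
  interpret P: prob_space P by (rule prob_P)
  note [measurable] = Z_meas Zd_meas
  define R where "R = u * (card I * b)"
  define hi where "hi = exp R"
  have R: "0 \<le> R" using u b_pos by (simp add: R_def)
  have lnb: "\<bar>ln w\<bar> \<le> R" if "w \<in> {1..hi}" for w
    using that by (auto simp: hi_def) (metis exp_gt_zero ln_exp ln_le_cancel_iff order_less_le_trans zero_less_one)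
  have Wb: "exp (u * Z x) \<in> {1..hi}" "exp (u * Zd i x) \<in> {1..hi}" for x i
    using u norm_sum_le[of I x] norm_sum_le[of "I - {i}" x] by (auto simp: hi_def R_def intro!: mult_left_mono)
  have "(\<integral>x. exp (u * Z x) * ln (exp (u * Z x)) \<partial>P) - (\<integral>x. exp (u * Z x) \<partial>P) * ln (\<integral>x. exp (u * Z x) \<partial>P)
     \<le> (\<Sum>i\<in>I. \<integral>x. exp (u * Z x) * ln (exp (u * Z x) / exp (u * Zd i x)) - exp (u * Z x) + exp (u * Zd i x) \<partial>P)"
  proof (rule entropy_tensorization[where \<Phi>="\<lambda>w. w * ln w" and D="\<lambda>w v. w * ln (w / v) - w + v" and lo=1 and hi=hi
        and C="hi * (2 * R) + 2 * hi"])
    show "case_prod (\<lambda>w v. w * ln (w / v) - w + v) \<in> borel_measurable (borel :: (real \<times> real) measure)"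
      by (simp add: borel_prod[symmetric] split_beta')
    show "\<bar>w * ln w\<bar> \<le> hi * (2 * R) + 2 * hi" if "w \<in> {1..hi}" for w
    proof -
      have "\<bar>w * ln w\<bar> \<le> hi * (2 * R)" unfolding abs_mult using that lnb[OF that] R by (intro mult_mono) auto
      moreover have "0 \<le> hi" by (simp add: hi_def)
      ultimately show ?thesis by linarith
    qed
    show "\<bar>w * ln (w / v) - w + v\<bar> \<le> hi * (2 * R) + 2 * hi" if "w \<in> {1..hi}" "v \<in> {1..hi}" for w v
    proof -
      have "ln (w / v) = ln w - ln v" using that by (simp add: ln_div)
      then have "\<bar>ln (w / v)\<bar> \<le> 2 * R" using lnb[OF that(1)] lnb[OF that(2)] by linarith
      then have "\<bar>w * ln (w / v)\<bar> \<le> hi * (2 * R)" unfolding abs_mult using that R by (intro mult_mono) auto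
      then show ?thesis using that unfolding atLeastAtMost_iff by linarith
    qed
    show "\<exists>p r. \<forall>w\<in>{1..hi}. \<forall>v\<in>{1..hi}. (w0 * ln (w0 / v0) - w0 + v0) + p * (w - w0) + r * (v - v0)
        \<le> w * ln (w / v) - w + v" if "w0 \<in> {1..hi}" "v0 \<in> {1..hi}" for w0 v0
    proof (intro exI ballI)
      fix w v assume wv: "w \<in> {1..hi}" "v \<in> {1..hi}"
      then have pos: "0 < w" "0 < v" "0 < w0" "0 < v0" using that by auto
      \<comment> \<open>Joint convexity of relative entropy is ln z <= z - 1 at this quotient of the
        two density ratios.\<close>
      define z where "z = v * w0 / (w * v0)"
      have "0 < z" using pos by (simp add: z_def)
      then have "ln z \<le> z - 1" by (rule ln_le_minus_one)
      moreover have "ln z = ln (w0 / v0) - ln (w / v)"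
        using pos by (simp add: z_def ln_div ln_mult)
      ultimately have "w * (ln (w0 / v0) - ln (w / v)) \<le> w * (z - 1)" using pos by simp
      also have "w * (z - 1) = v * (w0 / v0) - w" using pos by (simp add: z_def field_simps)
      finally show "(w0 * ln (w0 / v0) - w0 + v0) + ln (w0 / v0) * (w - w0) + (1 - w0 / v0) * (v - v0)
        \<le> w * ln (w / v) - w + v" using pos by (simp add: field_simps)
    qed
    show "\<exists>p. \<forall>w\<in>{1..hi}. w * ln w - w0 * ln w0 \<le> (w * ln (w / v) - w + v) + p * (w - w0)"
      if "w0 \<in> {1..hi}" "v \<in> {1..hi}" for w0 v
    proof (intro exI ballI)
      fix w assume w: "w \<in> {1..hi}"
      then have pos: "0 < w" "0 < v" "0 < w0" using that by auto
      have "ln (v / w0) \<le> v / w0 - 1" using pos by (intro ln_le_minus_one) simp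
      then have "w0 * ln (v / w0) \<le> w0 * (v / w0 - 1)" using pos by simp
      \<comment> \<open>The slope ln v + 1 is the derivative of w ln w at v. What remains is that w
        ln w at w0 lies above its tangent at v.\<close>
      then show "w * ln w - w0 * ln w0 \<le> (w * ln (w / v) - w + v) + (ln v + 1) * (w - w0)"
      proof -
        have "w0 * (v / w0 - 1) = v - w0" using pos by (simp add: field_simps)
        then have "w0 * ln (v / w0) \<le> v - w0" using \<open>w0 * ln (v / w0) \<le> w0 * (v / w0 - 1)\<close> by linarith
        moreover have l: "ln (v / w0) = ln v - ln w0" "ln (w / v) = ln w - ln v" using pos by (simp_all add: ln_div)
        ultimately show ?thesis unfolding l by (simp add: algebra_simps)
      qed
    qed
    show "exp (u * Zd i (x(i := y))) = exp (u * Zd i x)" for x y i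
      by (intro arg_cong[where f="\<lambda>s. exp (u * norm s)"] sum.cong) auto
  qed (use I Wb prob_space_axioms in auto)
  also have "\<dots> \<le> (\<Sum>i\<in>I. exp (u * b) * u\<^sup>2 / 2 * (\<sigma>2 * (\<integral>x. exp (u * Z x) \<partial>P) + 2 * b * (\<integral>x. exp (u * Z x) * (Z x - Zd i x) \<partial>P)))"
  proof (rule sum_mono)
    fix i assume i: "i \<in> I"
    have gB: "exp (u * z) \<le> hi" if "z \<le> card I * b" for z
      using that u by (auto simp: hi_def R_def)
    note wi = weighted_increment[OF i, of "\<lambda>z. exp (u * z)" hi, simplified, OF gB]
    have i5: "integrable P (\<lambda>x. exp (u * Z x) * (Z x - Zd i x))"
      by (rule P.integrable_const_bound[where B="hi * b"])
        (use Wb(1) Z_diff_le[OF i] b_pos in \<open>auto simp: abs_mult hi_def intro!: AE_I2 mult_mono\<close>)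
    have pt: "exp (u * Z x) * ln (exp (u * Z x) / exp (u * Zd i x)) - exp (u * Z x) + exp (u * Zd i x)
       \<le> exp (u * b) * u\<^sup>2 / 2 * (exp (u * Zd i x) * (Z x - Zd i x)\<^sup>2)" for x
    proof -
      define t where "t = u * (Z x - Zd i x)"
      have t: "\<bar>t\<bar> \<le> u * b" using Z_diff_le[OF i, of x] u by (simp add: t_def abs_mult)
      have uZ: "u * Z x = u * Zd i x + t" by (simp add: t_def algebra_simps)
      have "exp (u * Z x) * ln (exp (u * Z x) / exp (u * Zd i x)) - exp (u * Z x) + exp (u * Zd i x)
        = exp (u * Zd i x) * (1 - exp t + t * exp t)"
        unfolding uZ exp_diff[symmetric] by (simp add: exp_add algebra_simps)
      also have "\<dots> \<le> exp (u * Zd i x) * (exp (u * b) * t\<^sup>2 / 2)"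
        using exp_remainder_le[OF t] by simp
      finally show ?thesis by (simp add: t_def power_mult_distrib mult_ac)
    qed
    have "(\<integral>x. exp (u * Z x) * ln (exp (u * Z x) / exp (u * Zd i x)) - exp (u * Z x) + exp (u * Zd i x) \<partial>P)
      \<le> (\<integral>x. exp (u * b) * u\<^sup>2 / 2 * (exp (u * Zd i x) * (Z x - Zd i x)\<^sup>2) \<partial>P)"
    proof (rule integral_mono[OF _ _ pt])
      have "integrable P (\<lambda>x. u * (exp (u * Z x) * (Z x - Zd i x)) - exp (u * Z x) + exp (u * Zd i x))"
        using i5 wi(1) integrable_exp_Z(1)[of u] by auto
      then show "integrable P (\<lambda>x. exp (u * Z x) * ln (exp (u * Z x) / exp (u * Zd i x)) - exp (u * Z x) + exp (u * Zd i x))"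
        unfolding exp_diff[symmetric] by (simp add: algebra_simps)
    qed (use wi(3) in auto)
    also have "\<dots> = exp (u * b) * u\<^sup>2 / 2 * (\<integral>x. exp (u * Zd i x) * (Z x - Zd i x)\<^sup>2 \<partial>P)" by simp
    also have "\<dots> \<le> exp (u * b) * u\<^sup>2 / 2 * (\<sigma>2 * (\<integral>x. exp (u * Zd i x) \<partial>P) + 2 * b * (\<integral>x. exp (u * Zd i x) * (Z x - Zd i x) \<partial>P))"
      using wi(5) by (intro mult_left_mono) auto
    also have "\<dots> \<le> exp (u * b) * u\<^sup>2 / 2 * (\<sigma>2 * (\<integral>x. exp (u * Z x) \<partial>P) + 2 * b * (\<integral>x. exp (u * Z x) * (Z x - Zd i x) \<partial>P))"
    proof (intro mult_left_mono add_mono)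
      \<comment> \<open>The tangent to exp at u \<open>Zd i\<close> bounds exp (u Z) from below, and
        the weighted increment in it has nonnegative mean; hence the leave-one-out transform is the
        smaller one.\<close>
      have "exp (u * Zd i x) + u * (exp (u * Zd i x) * (Z x - Zd i x)) \<le> exp (u * Z x)" for x
      proof -
        have "exp (u * Zd i x) * (1 + u * (Z x - Zd i x)) \<le> exp (u * Zd i x) * exp (u * (Z x - Zd i x))"
          by (intro mult_left_mono exp_ge_add_one_self) auto
        then show ?thesis by (simp add: exp_add[symmetric] algebra_simps)
      qed
      then have "(\<integral>x. exp (u * Zd i x) + u * (exp (u * Zd i x) * (Z x - Zd i x)) \<partial>P) \<le> (\<integral>x. exp (u * Z x) \<partial>P)"
        using wi(1,2) by (intro integral_mono integrable_exp_Z) auto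
      moreover have "0 \<le> u * (\<integral>x. exp (u * Zd i x) * (Z x - Zd i x) \<partial>P)" using wi(4) u by simp
      ultimately show "(\<integral>x. exp (u * Zd i x) \<partial>P) \<le> (\<integral>x. exp (u * Z x) \<partial>P)" using wi(1,2) by simp
      \<comment> \<open>The larger weight falls on the positive increments and the smaller one on
        the negative increments.\<close>
      show "(\<integral>x. exp (u * Zd i x) * (Z x - Zd i x) \<partial>P) \<le> (\<integral>x. exp (u * Z x) * (Z x - Zd i x) \<partial>P)"
      proof (intro integral_mono wi(2) i5)
        fix x
        show "exp (u * Zd i x) * (Z x - Zd i x) \<le> exp (u * Z x) * (Z x - Zd i x)"
        proof (cases "Zd i x \<le> Z x")
          case True
          then show ?thesis using u by (intro mult_right_mono) auto
        next
          case False
          then show ?thesis using u by (intro mult_right_mono_neg) auto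
        qed
      qed
    qed (use b_pos sigma2_nonneg in auto)
    finally show "(\<integral>x. exp (u * Z x) * ln (exp (u * Z x) / exp (u * Zd i x)) - exp (u * Z x) + exp (u * Zd i x) \<partial>P)
      \<le> exp (u * b) * u\<^sup>2 / 2 * (\<sigma>2 * (\<integral>x. exp (u * Z x) \<partial>P) + 2 * b * (\<integral>x. exp (u * Z x) * (Z x - Zd i x) \<partial>P))" .
  qed
  also have "\<dots> = exp (u * b) * u\<^sup>2 / 2 * (card I * \<sigma>2 * (\<integral>x. exp (u * Z x) \<partial>P) + 2 * b * (\<Sum>i\<in>I. \<integral>x. exp (u * Z x) * (Z x - Zd i x) \<partial>P))"
    by (simp only: sum_distrib_left[symmetric] sum.distrib sum_constant mult.assoc mult.left_commute[of \<sigma>2])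
  also have "\<dots> \<le> exp (u * b) * u\<^sup>2 / 2 * (card I * \<sigma>2 * (\<integral>x. exp (u * Z x) \<partial>P) + 2 * b * (\<integral>x. Z x * exp (u * Z x) \<partial>P))"
  proof (intro mult_left_mono add_left_mono)
    have i5: "integrable P (\<lambda>x. exp (u * Z x) * (Z x - Zd i x))" if "i \<in> I" for i
      by (rule P.integrable_const_bound[where B="hi * b"])
        (use Wb(1) Z_diff_le[OF that] b_pos in \<open>auto simp: abs_mult hi_def intro!: AE_I2 mult_mono\<close>)
    have "(\<Sum>i\<in>I. \<integral>x. exp (u * Z x) * (Z x - Zd i x) \<partial>P) = (\<integral>x. exp (u * Z x) * (\<Sum>i\<in>I. Z x - Zd i x) \<partial>P)"
      using i5 by (simp add: sum_distrib_left Bochner_Integration.integral_sum)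
    also have "\<dots> \<le> (\<integral>x. Z x * exp (u * Z x) \<partial>P)"
    proof (intro integral_mono integrable_exp_Z)
      show "integrable P (\<lambda>x. exp (u * Z x) * (\<Sum>i\<in>I. Z x - Zd i x))"
        unfolding sum_distrib_left using i5 by auto
      show "exp (u * Z x) * (\<Sum>i\<in>I. Z x - Zd i x) \<le> Z x * exp (u * Z x)" for x
        using sum_Z_diff_le[of x] by (simp add: mult.commute)
    qed
    finally show "(\<Sum>i\<in>I. \<integral>x. exp (u * Z x) * (Z x - Zd i x) \<partial>P) \<le> (\<integral>x. Z x * exp (u * Z x) \<partial>P)" .
  qed (use b_pos in auto)
  finally show ?thesis by (simp add: mult_ac)
qed

text \<open>Herbst's argument. Divided by s^2 F(s), the entropy bound says that ln F(s) / s grows no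
  faster than \<open>A\<close> (v s + 2 b ln F(s)), so \<open>G\<close> is nonincreasing on (0, u],
  with limit the mean of Z at 0. The factor on the left comes from the term with ln F, which appears
  because the increments are bounded by the norm itself.\<close>

theorem ln_mgf_norm_bound:
  assumes u: "0 < u"
  shows "ln (\<integral>x. exp (u * Z x) \<partial>P) * (1 - exp (u * b) * b * u)
    \<le> u * (\<integral>x. Z x \<partial>P) + exp (u * b) * (card I * \<sigma>2) * u\<^sup>2 / 2"
proof -
  interpret P: prob_space P by (rule prob_P)
  define F where "F = (\<lambda>u. \<integral>x. exp (u * Z x) \<partial>P)"
  define F' where "F' = (\<lambda>u. \<integral>x. Z x * exp (u * Z x) \<partial>P)"
  \<comment> \<open>Half of exp (u b) dominates half of exp (s b) for all s <= u, so one constant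
    serves the whole interval.\<close>
  define A where "A = exp (u * b) / 2"
  define v where "v = card I * \<sigma>2"
  have der: "(F has_real_derivative F' s) (at s)" for s
    unfolding F_def F'_def
    by (rule mgf_has_derivative[OF prob_P Z_meas, of "card I * b"]) (auto intro: norm_sum_le)
  have F1: "1 \<le> F s" if "0 \<le> s" for s
    unfolding F_def using that by (intro P.integral_ge_const integrable_exp_Z AE_I2) auto
  have F'0: "0 \<le> F' s" for s unfolding F'_def by (intro integral_nonneg_AE AE_I2) auto
  have F0: "F 0 = 1" "F' 0 = (\<integral>x. Z x \<partial>P)" by (auto simp: F_def F'_def P.prob_space)
  define G where "G = (\<lambda>s. ln (F s) / s - A * (v * s + 2 * b * ln (F s)))"
  have dG: "(G has_real_derivative ((F' s / F s * s - ln (F s)) / (s * s) - A * (v + 2 * b * (F' s / F s)))) (at s)" if "0 < s" for s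
    unfolding G_def using der[of s] F1[of s] that by (auto intro!: derivative_eq_intros)
  have neg: "(F' s / F s * s - ln (F s)) / (s * s) - A * (v + 2 * b * (F' s / F s)) \<le> 0" if s: "0 < s" "s \<le> u" for s
  proof -
    have Fp: "0 < F s" using F1[of s] s by simp
    have "s * F' s - F s * ln (F s) \<le> exp (s * b) * s\<^sup>2 / 2 * (v * F s + 2 * b * F' s)"
      using exp_entropy_bound[OF s(1)] by (simp add: F_def F'_def v_def)
    also have "\<dots> \<le> A * s\<^sup>2 * (v * F s + 2 * b * F' s)"
      using s b_pos sigma2_nonneg F'0[of s] Fp by (intro mult_right_mono) (auto simp: A_def v_def)
    finally have "(s * F' s - F s * ln (F s)) / (F s * s\<^sup>2) \<le> A * s\<^sup>2 * (v * F s + 2 * b * F' s) / (F s * s\<^sup>2)"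
      using Fp s by (intro divide_right_mono) auto
    moreover have "(F' s / F s * s - ln (F s)) / (s * s) = (s * F' s - F s * ln (F s)) / (F s * s\<^sup>2)"
      using Fp s by (simp add: field_simps power2_eq_square)
    moreover have "A * (v + 2 * b * (F' s / F s)) = A * s\<^sup>2 * (v * F s + 2 * b * F' s) / (F s * s\<^sup>2)"
      using Fp s by (simp add: field_simps power2_eq_square)
    ultimately show ?thesis by simp
  qed
  have mono: "G u \<le> G s" if s: "0 < s" "s \<le> u" for s
  proof (rule DERIV_nonpos_imp_nonincreasing[OF s(2)])
    fix x assume "s \<le> x" "x \<le> u"
    then show "\<exists>y. (G has_real_derivative y) (at x) \<and> y \<le> 0" using dG[of x] neg[of x] s by auto
  qed
  have dl: "((\<lambda>s. ln (F s)) has_real_derivative F' 0) (at 0)"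
    using der[of 0] F0 by (auto intro!: derivative_eq_intros)
  have l1: "((\<lambda>s. ln (F s) / s) \<longlongrightarrow> F' 0) (at_right 0)"
    using dl F0 by (auto simp: DERIV_def intro: filterlim_at_split[THEN iffD1, THEN conjunct2])
  have l2: "((\<lambda>s. ln (F s)) \<longlongrightarrow> 0) (at_right 0)"
    using DERIV_isCont[OF dl] F0 by (auto simp: isCont_def intro: filterlim_at_split[THEN iffD1, THEN conjunct2])
  have "(G \<longlongrightarrow> F' 0 - A * (v * 0 + 2 * b * 0)) (at_right 0)"
    unfolding G_def by (intro tendsto_intros l1 l2)
  then have "G u \<le> F' 0 - A * (v * 0 + 2 * b * 0)"
  proof (rule tendsto_lowerbound)
    show "eventually (\<lambda>s. G u \<le> G s) (at_right 0)"
      using eventually_at_right_less[of 0] eventually_at_right_field[of "\<lambda>s. s < u" 0] u mono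
      by (auto simp: eventually_at_right_field intro!: exI[of _ u])
  qed simp
  then have "ln (F u) / u - A * (v * u + 2 * b * ln (F u)) \<le> F' 0" by (simp add: G_def)
  then have "u * (ln (F u) / u - A * (v * u + 2 * b * ln (F u))) \<le> u * F' 0" using u by simp
  then have "ln (F u) - A * (v * u\<^sup>2 + 2 * b * u * ln (F u)) \<le> u * F' 0"
    using u by (simp add: power2_eq_square algebra_simps)
  then show ?thesis unfolding F0 by (simp add: F_def A_def v_def algebra_simps)
qed

end

end

section \<open>Slowly varying normalization\<close>

lemma L_ge_1: "1 \<le> L t"
proof -
  have "ln (exp 1) \<le> ln (max t (exp 1))" by (intro ln_mono) (auto simp: less_max_iff_disj)
  then show ?thesis by (simp add: L_def)
qed

lemma LL_ge_1: "1 \<le> LL t"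
  unfolding LL_def by (rule L_ge_1)

lemma L_mono: "s \<le> t \<Longrightarrow> L s \<le> L t"
  unfolding L_def by (intro ln_mono) (auto simp: less_max_iff_disj le_max_iff_disj)

lemma LL_mono: "s \<le> t \<Longrightarrow> LL s \<le> LL t"
  unfolding LL_def by (intro L_mono)

lemma L_eq: "exp 1 \<le> t \<Longrightarrow> L t = ln t"
  by (simp add: L_def max_absorb1)

lemma LL_eq: "exp (exp 1) \<le> t \<Longrightarrow> LL t = ln (ln t)"
proof -
  assume t: "exp (exp 1) \<le> t"
  have "(1::real) \<le> exp 1" by simp
  then have "exp 1 \<le> exp (exp (1::real))" by simp
  then have "exp 1 \<le> t" using t by linarith
  moreover have "exp 1 \<le> ln t" using t by (metis exp_gt_zero ln_exp ln_mono)
  ultimately show ?thesis by (simp add: LL_def L_eq)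
qed

lemma filterlim_LL: "filterlim LL at_top at_top"
proof -
  have "filterlim (\<lambda>t::real. ln (ln t)) at_top at_top"
    by (intro filterlim_compose[OF ln_at_top] ln_at_top)
  then show ?thesis
    by (rule filterlim_mono_eventually)
      (auto intro: eventually_mono[OF eventually_ge_at_top[of "exp (exp 1)"]] simp: LL_eq)
qed

lemma eventually_LL_ge: "eventually (\<lambda>t. c \<le> LL t) at_top"
  using filterlim_LL by (simp add: filterlim_at_top)

lemma powr_at_top:
  assumes "0 < (p::real)"
  shows "filterlim (\<lambda>t::real. t powr p) at_top at_top"
proof -
  have "filterlim (\<lambda>t::real. exp (p * ln t)) at_top at_top"
    by (intro filterlim_compose[OF exp_at_top] filterlim_tendsto_pos_mult_at_top[OF tendsto_const assms] ln_at_top)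
  then show ?thesis
    by (rule filterlim_mono_eventually)
      (auto intro: eventually_mono[OF eventually_gt_at_top[of 0]] simp: powr_def)
qed

lemma eventually_powr_ge:
  assumes "0 < (p::real)"
  shows "eventually (\<lambda>t::real. c \<le> t powr p) at_top"
  using powr_at_top[OF assms] by (simp add: filterlim_at_top)

text \<open>For large t, LL (t^(1/4)) = LL t - ln 4. A truncation level known only to exceed t^(1/4)
  thus loses no more than a factor 1 + \<epsilon> in the iterated logarithm.\<close>

lemma eventually_LL_root:
  assumes "0 < (\<epsilon>::real)"
  shows "eventually (\<lambda>t. LL t \<le> (1 + \<epsilon>) * LL (t powr (1/4))) at_top"
  using eventually_powr_ge[of "1/4" "exp (exp 1)", simplified] eventually_ge_at_top[of "exp (exp 1)"]
    eventually_LL_ge[of "(1 + \<epsilon>) * ln 4 / \<epsilon>"]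
proof eventually_elim
  case (elim t)
  have t: "0 < t" using elim(2) exp_gt_zero less_le_trans by blast
  have "1 < t" using elim(2) one_less_exp_iff[of "exp 1"] by (smt (verit) exp_gt_zero)
  then have "0 < ln t" by simp
  then have E: "LL (t powr (1/4)) = LL t - ln 4"
    using elim t by (simp add: LL_eq ln_powr ln_div)
  have "(1 + \<epsilon>) * ln 4 \<le> \<epsilon> * LL t" using elim(3) assms by (simp add: field_simps)
  then show ?case unfolding E by (simp add: algebra_simps)
qed

lemma LL_le_ln: "exp (exp 1) \<le> t \<Longrightarrow> LL t \<le> ln t"
proof -
  assume t: "exp (exp 1) \<le> t"
  have "1 < t" using t one_less_exp_iff[of "exp 1"] by (smt (verit) exp_gt_zero)
  then have "ln (ln t) \<le> ln t - 1" by (intro ln_le_minus_one) simp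
  then show ?thesis unfolding LL_eq[OF t] by linarith
qed

lemma eventually_LL_le_powr:
  assumes "0 < (p::real)" "0 < (c::real)"
  shows "eventually (\<lambda>t. LL t \<le> c * t powr p) at_top"
  using eventually_powr_ge[OF half_gt_zero[OF assms(1)], of "2 / (c * p)"] eventually_ge_at_top[of "exp (exp 1)"]
proof eventually_elim
  case (elim t)
  have t: "1 \<le> t" using elim(2) one_less_exp_iff[of "exp 1"] by (smt (verit) exp_gt_zero)
  have "LL t \<le> ln t" by (rule LL_le_ln[OF elim(2)])
  also have "\<dots> \<le> t powr (p/2) / (p/2)" using t assms by (intro ln_powr_bound) auto
  also have "\<dots> = (2 / p) * t powr (p/2)" by simp
  also have "\<dots> \<le> (c * t powr (p/2)) * t powr (p/2)"
    using elim(1) assms by (intro mult_right_mono) (auto simp: field_simps)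
  also have "\<dots> = c * t powr p" using t by (simp add: powr_add[symmetric])
  finally show ?case .
qed

text \<open>\<open>v / (1 + v)\<close> turns the two-sided geometric sum into a telescoping one.\<close>

lemma sum_min_geometric_le:
  fixes c z :: real
  assumes c: "1 < c" and z: "0 < z"
  shows "(\<Sum>j<n. min (z * c ^ j) (1 / (z * c ^ j))) \<le> 2 * (1 + c) / (c - 1)"
proof -
  define \<phi> :: "real \<Rightarrow> real" where "\<phi> = (\<lambda>v. v / (1 + v))"
  define C where "C = 2 * (1 + c) / (c - 1)"
  have C: "0 < C" using c by (simp add: C_def)
  have step: "min v (1 / v) \<le> C * (\<phi> (c * v) - \<phi> v)" if v: "0 < v" for v
  proof -
    have cv: "0 < 1 + c * v" using v c by (simp add: add_pos_pos)
    have eq: "C * (\<phi> (c * v) - \<phi> v) = 2 * (1 + c) * v / ((1 + v) * (1 + c * v))"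
    proof -
      have "\<phi> (c * v) - \<phi> v = (c - 1) * v / ((1 + v) * (1 + c * v))"
        using v cv by (simp add: \<phi>_def field_simps)
      then show ?thesis using c by (simp add: C_def)
    qed
    \<comment> \<open>The denominator (1 + v)(1 + c v) is at most 2 (1 + c) for v <= 1, and at most
      2 (1 + c) v^2 for v > 1.\<close>
    show ?thesis
    proof (cases "v \<le> 1")
      case True
      have "(1 + v) * (1 + c * v) \<le> 2 * (1 + c)" using True v c cv by (intro mult_mono) auto
      then have "v * ((1 + v) * (1 + c * v)) \<le> v * (2 * (1 + c))" using v by (intro mult_left_mono) auto
      then have "v \<le> 2 * (1 + c) * v / ((1 + v) * (1 + c * v))"
        using v cv by (simp add: le_divide_eq mult_ac)
      then show ?thesis unfolding eq by linarith
    next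
      case False
      have "(1 + v) * (1 + c * v) \<le> (2 * v) * ((1 + c) * v)" using False v c cv by (intro mult_mono) (auto simp: algebra_simps)
      then have "1 / v \<le> 2 * (1 + c) * v / ((1 + v) * (1 + c * v))"
        using v cv by (simp add: divide_le_eq le_divide_eq mult_ac)
      then show ?thesis unfolding eq by linarith
    qed
  qed
  have "(\<Sum>j<n. min (z * c ^ j) (1 / (z * c ^ j))) \<le> (\<Sum>j<n. C * (\<phi> (z * c ^ Suc j) - \<phi> (z * c ^ j)))"
    using step[of "z * c ^ j" for j] z c by (intro sum_mono) (simp add: mult_ac)
  also have "\<dots> = C * (\<phi> (z * c ^ n) - \<phi> z)"
    using sum_lessThan_telescope[of "\<lambda>j. \<phi> (z * c ^ j)" n] by (simp add: sum_distrib_left[symmetric])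
  also have "\<dots> \<le> C * 1"
  proof (intro mult_left_mono)
    have "0 < z * c ^ n" using z c by simp
    then have "\<phi> (z * c ^ n) \<le> 1" unfolding \<phi>_def by (subst divide_le_eq_1_pos) auto
    moreover have "0 \<le> \<phi> z" using z by (simp add: \<phi>_def)
    ultimately show "\<phi> (z * c ^ n) - \<phi> z \<le> 1" by simp
  qed (use C in auto)
  finally show ?thesis by (simp add: C_def)
qed

locale slow_norming =
  fixes h :: "real \<Rightarrow> real"
  assumes h_class: "h \<in> class_H"
begin

section \<open>The norming function and its inverse\<close>

lemma h_pos: "0 \<le> t \<Longrightarrow> 0 < h t"
  and h_mono: "0 \<le> s \<Longrightarrow> s \<le> t \<Longrightarrow> h s \<le> h t"
  and h_cont: "continuous_on {0..} h"
  and h_slow: "0 < c \<Longrightarrow> ((\<lambda>t. h (c * t) / h t) \<longlongrightarrow> 1) at_top"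
  using h_class by (auto simp: class_H_def slowly_varying_def mono_on_def)

abbreviation "\<Psi> \<equiv> Psi h"
abbreviation "\<Psi>i \<equiv> Psi_inv h"

lemma Psi_sq: "0 \<le> x \<Longrightarrow> (\<Psi> x)\<^sup>2 = x * h x"
  using h_pos[of x] by (simp add: Psi_def)

lemma Psi_0 [simp]: "\<Psi> 0 = 0" by (simp add: Psi_def)

lemma Psi_strict_mono: "0 \<le> x \<Longrightarrow> x < y \<Longrightarrow> \<Psi> x < \<Psi> y"
proof -
  assume xy: "0 \<le> x" "x < y"
  have "x * h x < y * h y"
    using xy h_pos[of x] h_pos[of y] h_mono[of x y] by (intro mult_less_le_imp_less) auto
  then show ?thesis by (simp add: Psi_def)
qed

lemma Psi_mono: "0 \<le> x \<Longrightarrow> x \<le> y \<Longrightarrow> \<Psi> x \<le> \<Psi> y"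
  using Psi_strict_mono[of x y] by (cases "x = y") auto

lemma Psi_nonneg: "0 \<le> x \<Longrightarrow> 0 \<le> \<Psi> x"
  using Psi_mono[of 0 x] by simp

lemma Psi_pos: "0 < x \<Longrightarrow> 0 < \<Psi> x"
  using Psi_strict_mono[of 0 x] by simp

lemma Psi_le_iff: "0 \<le> x \<Longrightarrow> 0 \<le> y \<Longrightarrow> \<Psi> x \<le> \<Psi> y \<longleftrightarrow> x \<le> y"
  using Psi_mono[of x y] Psi_strict_mono[of y x] by (meson leD leI)

lemma Psi_scale_ge:
  assumes "1 \<le> k" "0 \<le> x"
  shows "k * \<Psi> x \<le> \<Psi> (k\<^sup>2 * x)" "sqrt k * \<Psi> x \<le> \<Psi> (k * x)"
proof -
  have *: "sqrt k * \<Psi> x \<le> \<Psi> (k * x)" if "1 \<le> k" for k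
  proof -
    have "x \<le> k * x" using that assms(2) by (simp add: mult_le_cancel_right1)
    then have "k * (x * h x) \<le> (k * x) * h (k * x)"
      using that assms(2) h_mono[of x "k * x"] by (simp add: mult_left_mono)
    then show ?thesis by (simp add: Psi_def flip: real_sqrt_mult)
  qed
  show "sqrt k * \<Psi> x \<le> \<Psi> (k * x)" by (rule *) fact
  show "k * \<Psi> x \<le> \<Psi> (k\<^sup>2 * x)" using *[of "k\<^sup>2"] assms by (simp add: one_le_power)
qed

lemma Psi_ge_sqrt: "0 \<le> x \<Longrightarrow> sqrt (h 0) * sqrt x \<le> \<Psi> x"
  using h_mono[of 0 x] by (simp add: Psi_def mult_left_mono mult.commute flip: real_sqrt_mult)

lemma Psi_cont: "continuous_on {0..} \<Psi>"
proof -
  have "continuous_on {0..} (\<lambda>x. sqrt (x * h x))" by (intro continuous_intros h_cont)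
  then show ?thesis by (simp add: Psi_def[abs_def])
qed

lemma Psi_surj:
  assumes "0 \<le> y"
  obtains x where "0 \<le> x" "\<Psi> x = y"
proof -
  \<comment> \<open>Here the lower bound sqrt (h 0) sqrt z equals y, so [0, z] is an interval for
    the intermediate value theorem.\<close>
  define z where "z = y\<^sup>2 / h 0"
  have z: "0 \<le> z" using h_pos[of 0] by (simp add: z_def)
  have "sqrt (h 0) * sqrt z = y" using h_pos[of 0] assms by (simp add: z_def flip: real_sqrt_mult)
  then have "y \<le> \<Psi> z" using Psi_ge_sqrt[OF z] by simp
  then have "\<exists>x\<ge>0. x \<le> z \<and> \<Psi> x = y"
    using z assms by (intro IVT' continuous_on_subset[OF Psi_cont]) auto
  then show thesis using that by auto
qed

lemma Psi_inv_props:
  assumes "0 \<le> y"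
  shows "0 \<le> \<Psi>i y" "\<Psi> (\<Psi>i y) = y"
proof -
  have "\<exists>!x. 0 \<le> x \<and> \<Psi> x = y"
    using Psi_surj[OF assms] Psi_le_iff by (metis antisym order_refl)
  from theI'[OF this] show "0 \<le> \<Psi>i y" "\<Psi> (\<Psi>i y) = y" by (auto simp: Psi_inv_def)
qed

lemma Psi_inv_Psi: "0 \<le> x \<Longrightarrow> \<Psi>i (\<Psi> x) = x"
  using Psi_inv_props[of "\<Psi> x"] Psi_nonneg[of x] Psi_le_iff by (metis antisym order_refl)

lemma Psi_inv_le_iff: "0 \<le> y \<Longrightarrow> 0 \<le> n \<Longrightarrow> \<Psi>i y \<le> n \<longleftrightarrow> y \<le> \<Psi> n"
  using Psi_inv_props[of y] Psi_le_iff[of "\<Psi>i y" n] by simp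

lemma Psi_inv_less_iff: "0 \<le> y \<Longrightarrow> 0 \<le> n \<Longrightarrow> n < \<Psi>i y \<longleftrightarrow> \<Psi> n < y"
  using Psi_inv_le_iff[of y n] by linarith

lemma Psi_inv_pos: "0 < y \<Longrightarrow> 0 < \<Psi>i y"
  using Psi_inv_less_iff[of y 0] by simp

lemma Psi_inv_sq: "0 \<le> y \<Longrightarrow> \<Psi>i y * h (\<Psi>i y) = y\<^sup>2"
  using Psi_inv_props[of y] Psi_sq by metis

text \<open>Slow variation gives h (2 t) <= 2^p h t beyond some \<open>t0\<close>. Iterating it over
  the floor of log2 (w / t) doublings yields (w / t)^p, and one further doubling reaches past w at
  the cost of the factor 2^p.\<close>

lemma potter_bound:
  assumes p: "0 < p"
  obtains t0 where "0 < t0" "\<And>t w. t0 \<le> t \<Longrightarrow> t \<le> w \<Longrightarrow> h w \<le> 2 powr p * (w / t) powr p * h t"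
proof -
  define K :: real where "K = 2 powr p"
  have K: "1 < K" using p by (simp add: K_def)
  have "eventually (\<lambda>t. h (2 * t) / h t < K) at_top"
    using h_slow[of 2] K by (intro order_tendstoD) auto
  then obtain t1 where t1: "\<And>t. t1 \<le> t \<Longrightarrow> h (2 * t) / h t < K" by (auto simp: eventually_at_top_linorder)
  define t0 where "t0 = max t1 1"
  have dbl: "h (2 * t) \<le> K * h t" if "t0 \<le> t" for t
    using t1[of t] h_pos[of t] that by (simp add: t0_def divide_less_eq)
  have pw: "h (2 ^ j * t) \<le> K ^ j * h t" if t: "t0 \<le> t" for j t
  proof (induction j)
    case (Suc j)
    have "t \<le> 2 ^ j * t" using t by (simp add: t0_def mult_le_cancel_right1)
    then have "h (2 * (2 ^ j * t)) \<le> K * h (2 ^ j * t)" using t by (intro dbl) linarith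
    also have "\<dots> \<le> K * (K ^ j * h t)" using Suc K by (intro mult_left_mono) auto
    finally show ?case by (simp add: mult_ac)
  qed simp
  show thesis
  proof (rule that[of t0])
    fix t w assume tw: "t0 \<le> t" "t \<le> w"
    have t: "0 < t" using tw by (simp add: t0_def)
    define r where "r = w / t"
    have r: "1 \<le> r" using tw t by (simp add: r_def)
    define k where "k = nat \<lfloor>log 2 r\<rfloor>"
    have l: "0 \<le> log 2 r" using r by simp
    have k: "real k \<le> log 2 r" "log 2 r < real k + 1" using l by (auto simp: k_def)
    have "2 ^ k = 2 powr real k" by (simp add: powr_realpow)
    also have "\<dots> \<le> 2 powr (log 2 r)" using k by (intro powr_mono) auto
    finally have lo: "2 ^ k \<le> r" using r by simp
    have "r = 2 powr (log 2 r)" using r by simp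
    also have "\<dots> \<le> 2 powr (real (Suc k))" using k by (intro powr_mono) auto
    also have "\<dots> = 2 ^ Suc k" by (rule powr_realpow) simp
    finally have "w \<le> 2 ^ Suc k * t" using t by (simp add: r_def field_simps)
    then have "h w \<le> h (2 ^ Suc k * t)" using t tw by (intro h_mono) auto
    also have "\<dots> \<le> K ^ Suc k * h t" by (rule pw[OF tw(1)])
    also have "\<dots> \<le> K * r powr p * h t"
    proof -
      have "K ^ k = (2 ^ k) powr p" by (simp add: K_def powr_realpow[symmetric] powr_powr mult.commute)
      also have "\<dots> \<le> r powr p" using lo p by (intro powr_mono2) auto
      finally show ?thesis using K h_pos[of t] t by (auto intro!: mult_right_mono)
    qed
    finally show "h w \<le> 2 powr p * (w / t) powr p * h t" by (simp add: K_def r_def)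
  qed (simp add: t0_def)
qed

text \<open>With w = \<open>\<Psi>i y\<close> below N, monotonicity of h gives (y / \<Psi> N)^2 <= w
  / N, hence w^2 / N after squaring. The fourth power is there for this decay in N: the second power
  would only give the bound w.\<close>

lemma fourth_moment_kernel:
  assumes y: "0 \<le> y" and N: "0 < N"
  shows "N * (min (y / \<Psi> N) 1) ^ 4 \<le> min N ((\<Psi>i y)\<^sup>2 / N)"
proof -
  define w where "w = \<Psi>i y"
  have a: "0 < \<Psi> N" by (rule Psi_pos[OF N])
  have w: "0 \<le> w" using Psi_inv_props[OF y] by (simp add: w_def)
  have m: "0 \<le> min (y / \<Psi> N) 1" using y a by simp
  have le1: "N * (min (y / \<Psi> N) 1) ^ 4 \<le> N" 
    using N m power_le_one[of "min (y / \<Psi> N) 1" 4] by (simp add: mult_le_cancel_left1)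
  have "N * (min (y / \<Psi> N) 1) ^ 4 \<le> w\<^sup>2 / N"
  proof (cases "N \<le> w")
    case True
    then have "N * N \<le> w * w" using N by (intro mult_mono) auto
    then have "N \<le> w\<^sup>2 / N" using N by (simp add: field_simps power2_eq_square)
    then show ?thesis using le1 by linarith
  next
    case False
    have "y\<^sup>2 = w * h w" using Psi_inv_sq[OF y] by (simp add: w_def)
    also have "\<dots> \<le> w * h N" using False w h_mono[of w N] by (intro mult_left_mono) auto
    finally have "(y / \<Psi> N)\<^sup>2 \<le> w * h N / (N * h N)" 
      unfolding power_divide Psi_sq[OF less_imp_le[OF N]] using N h_pos[of N] by (intro divide_right_mono) auto
    also have "\<dots> = w / N" using h_pos[of N] N by simp
    finally have "(y / \<Psi> N)\<^sup>2 \<le> w / N" .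
    then have "((y / \<Psi> N)\<^sup>2)\<^sup>2 \<le> (w / N)\<^sup>2" by (intro power_mono) auto
    moreover have "(min (y / \<Psi> N) 1) ^ 4 \<le> (y / \<Psi> N) ^ 4" using m by (intro power_mono) auto
    ultimately have "(min (y / \<Psi> N) 1) ^ 4 \<le> (w / N)\<^sup>2" by (simp flip: power_mult)
    then have "N * (min (y / \<Psi> N) 1) ^ 4 \<le> N * (w / N)\<^sup>2" using N by simp
    also have "\<dots> = w\<^sup>2 / N" using N by (simp add: field_simps power2_eq_square)
    finally show ?thesis .
  qed
  then show ?thesis using le1 by (simp add: w_def)
qed

text \<open>After division by w = \<open>\<Psi>i y\<close> the kernel becomes the two-sided
  geometric sum with starting value s / w, so the bound depends neither on s nor on n. The slack
  factor 2 in the hypothesis leaves room for rounding N j to an integer.\<close>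

lemma sum_fourth_moment_kernel:
  fixes s c y :: real and N :: "nat \<Rightarrow> real"
  assumes c: "1 < c" and s: "0 < s" and y: "0 \<le> y"
    and N: "\<And>j. s * c ^ j \<le> N j" "\<And>j. N j \<le> 2 * (s * c ^ j)"
  shows "(\<Sum>j<n. N j * (min (y / \<Psi> (N j)) 1) ^ 4) \<le> 4 * (1 + c) / (c - 1) * \<Psi>i y"
proof (cases "y = 0")
  case True
  then show ?thesis using Psi_inv_Psi[of 0] by simp
next
  case False
  define w where "w = \<Psi>i y"
  have w: "0 < w" using False y Psi_inv_pos[of y] by (simp add: w_def)
  have sc: "0 < s * c ^ j" for j using s c by simp
  have Np: "0 < N j" for j using N(1)[of j] sc[of j] by linarith
  have "N j * (min (y / \<Psi> (N j)) 1) ^ 4 \<le> 2 * w * min (s / w * c ^ j) (1 / (s / w * c ^ j))" for j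
  proof -
    have "min (N j) (w\<^sup>2 / N j) \<le> 2 * w * (s / w * c ^ j)"
      using N(2)[of j] w by (simp add: min_le_iff_disj)
    moreover have "min (N j) (w\<^sup>2 / N j) \<le> 2 * w * (1 / (s / w * c ^ j))"
    proof -
      have "w\<^sup>2 / N j \<le> w\<^sup>2 / (s * c ^ j)" using N(1)[of j] sc[of j] by (intro divide_left_mono) auto
      also have "\<dots> \<le> 2 * w * (1 / (s / w * c ^ j))" using w sc[of j] by (simp add: power2_eq_square field_simps)
      finally show ?thesis by (simp add: min_le_iff_disj)
    qed
    ultimately have "min (N j) (w\<^sup>2 / N j) \<le> 2 * w * min (s / w * c ^ j) (1 / (s / w * c ^ j))"
      by (cases "s / w * c ^ j \<le> 1 / (s / w * c ^ j)") (simp_all only: min_def if_True if_False)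
    then show ?thesis using fourth_moment_kernel[OF y Np[of j]] unfolding w_def[symmetric] by linarith
  qed
  then have "(\<Sum>j<n. N j * (min (y / \<Psi> (N j)) 1) ^ 4) \<le> (\<Sum>j<n. 2 * w * min (s / w * c ^ j) (1 / (s / w * c ^ j)))"
    by (intro sum_mono) auto
  also have "\<dots> = 2 * w * (\<Sum>j<n. min (s / w * c ^ j) (1 / (s / w * c ^ j)))" by (simp add: sum_distrib_left)
  also have "\<dots> \<le> 2 * w * (2 * (1 + c) / (c - 1))"
    using sum_min_geometric_le[OF c, of "s / w" n] s w by (intro mult_left_mono) auto
  finally show ?thesis by (simp add: w_def mult_ac)
qed

text \<open>Above \<open>\<Psi> N\<close> the bound of Potter type with exponent 1 gives h w <= 2 (w
  / N) h N for w = \<open>\<Psi>i y\<close>, so (y / \<Psi> N)^2 <= 2 (w / N)^2.\<close>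

lemma first_moment_kernel:
  obtains N0 where "0 < N0" "\<And>N y. N0 \<le> N \<Longrightarrow> \<Psi> N < y \<Longrightarrow> N * (y / \<Psi> N) \<le> 2 * \<Psi>i y"
proof -
  obtain t0 where t0: "0 < t0" "\<And>t w. t0 \<le> t \<Longrightarrow> t \<le> w \<Longrightarrow> h w \<le> 2 powr 1 * (w / t) powr 1 * h t"
    using potter_bound[of 1] by auto
  show thesis
  proof (rule that[OF t0(1)])
    fix N y assume N: "t0 \<le> N" and y: "\<Psi> N < y"
    have N0: "0 < N" using N t0(1) by linarith
    have a: "0 < \<Psi> N" by (rule Psi_pos[OF N0])
    define w where "w = \<Psi>i y"
    have w: "N < w" using Psi_inv_less_iff[of y N] y a N0 by (simp add: w_def)
    have "y\<^sup>2 = w * h w" using Psi_inv_sq[of y] y a by (simp add: w_def)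
    also have "\<dots> \<le> w * (2 * (w / N) * h N)" using t0(2)[OF N, of w] w N0 by (intro mult_left_mono) auto
    finally have "(y / \<Psi> N)\<^sup>2 \<le> w * (2 * (w / N) * h N) / (N * h N)" 
      unfolding power_divide Psi_sq[OF less_imp_le[OF N0]] using N0 h_pos[of N] by (intro divide_right_mono) auto
    also have "\<dots> = 2 * (w / N)\<^sup>2" using h_pos[of N] N0 by (simp add: power2_eq_square)
    also have "\<dots> \<le> (2 * (w / N))\<^sup>2" unfolding power_mult_distrib by simp
    finally have "y / \<Psi> N \<le> 2 * (w / N)" by (rule power2_le_imp_le) (use w N0 in auto)
    then show "N * (y / \<Psi> N) \<le> 2 * \<Psi>i y" using N0 by (simp add: w_def field_simps)
  qed
qed

lemma eventually_Psi_le: "eventually (\<lambda>t. \<Psi> t \<le> t) at_top"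
proof -
  obtain t0 where t0: "0 < t0" "\<And>t w. t0 \<le> t \<Longrightarrow> t \<le> w \<Longrightarrow> h w \<le> 2 powr (1/2) * (w / t) powr (1/2) * h t"
    using potter_bound[of "1/2"] by auto
  define K where "K = 2 powr (1/2) * (1 / t0) powr (1/2) * h t0"
  have "eventually (\<lambda>t. K \<le> t powr (1/2)) at_top" by (rule eventually_powr_ge) simp
  then show ?thesis using eventually_ge_at_top[of t0]
  proof eventually_elim
    case (elim t)
    have t: "0 < t" using elim t0 by linarith
    have "h t \<le> K * t powr (1/2)" using t0(2)[of t0 t] elim t0(1) t
      by (simp add: K_def powr_divide mult_ac)
    also have "\<dots> \<le> t powr (1/2) * t powr (1/2)" using elim by (intro mult_right_mono) auto
    also have "\<dots> = t" using t by (simp flip: powr_add)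
    finally have "t * h t \<le> t * t" using t by simp
    then show ?case using t by (simp add: Psi_def real_le_lsqrt power2_eq_square)
  qed
qed

lemma Psi_at_top: "filterlim \<Psi> at_top at_top"
proof -
  have "filterlim (\<lambda>x. sqrt (h 0) * sqrt x) at_top at_top"
    using h_pos[of 0] by (intro filterlim_tendsto_pos_mult_at_top[OF tendsto_const] sqrt_at_top) auto
  then show ?thesis
    by (rule filterlim_at_top_mono) (auto intro: eventually_mono[OF eventually_ge_at_top[of 0]] Psi_ge_sqrt)
qed

lemma eventually_Psi_div_LL_ge:
  assumes "0 < (\<delta>::real)"
  shows "eventually (\<lambda>t. t powr (1/4) \<le> \<delta> * \<Psi> t / LL t) at_top"
proof -
  have c: "0 < \<delta> * sqrt (h 0)" using assms h_pos[of 0] by simp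
  show ?thesis
    using eventually_LL_le_powr[of "1/4" "\<delta> * sqrt (h 0)", OF _ c, simplified] eventually_gt_at_top[of 0]
  proof eventually_elim
    case (elim t)
    have "t powr (1/4) * LL t \<le> t powr (1/4) * (\<delta> * sqrt (h 0) * t powr (1/4))"
      using elim by (intro mult_left_mono) auto
    also have "\<dots> = \<delta> * (sqrt (h 0) * sqrt t)"
      using elim powr_add[of t "1/4" "1/4"] powr_half_sqrt[of t] by (simp add: mult_ac)
    also have "\<dots> \<le> \<delta> * \<Psi> t" using assms elim by (intro mult_left_mono Psi_ge_sqrt) auto
    finally show ?case using LL_ge_1[of t] by (simp add: le_divide_eq)
  qed
qed

section \<open>Growth of the weak variance along the normalization\<close>

context
  fixes H :: "real \<Rightarrow> real" and \<Lambda> :: real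
  assumes H_mono: "\<And>s t. 0 \<le> s \<Longrightarrow> s \<le> t \<Longrightarrow> H s \<le> H t"
    and H_lim: "eventually (\<lambda>x. 2 * \<Psi>i (x * LL x) / (x\<^sup>2 * LL x) * H x \<le> \<Lambda>) at_top"
begin

text \<open>For m = \<open>\<Psi>i (x * LL x)\<close> the identity m h m = (x LL x)^2 turns x^2 LL x
  / m into h m / LL x; the hypothesis is the same inequality read through \<Psi>.\<close>

lemma eventually_H_le:
  "eventually (\<lambda>x. H x \<le> \<Lambda> * h (\<Psi>i (x * LL x)) / (2 * LL x)) at_top"
  using H_lim eventually_gt_at_top[of 0]
proof eventually_elim
  case (elim x)
  define m where "m = \<Psi>i (x * LL x)"
  have LLp: "0 < LL x" using LL_ge_1[of x] by linarith
  have m: "0 < m" using elim LLp by (simp add: m_def Psi_inv_pos)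
  have "m * h m = (x * LL x)\<^sup>2" using Psi_inv_sq[of "x * LL x"] elim LLp by (simp add: m_def)
  then have "x\<^sup>2 * LL x / m = h m / LL x" using m LLp by (simp add: field_simps power2_eq_square)
  moreover have "H x \<le> \<Lambda> * (x\<^sup>2 * LL x / m) / 2"
    using elim LLp m unfolding m_def[symmetric] by (simp add: field_simps)
  ultimately show ?case by (simp add: m_def)
qed

text \<open>For b = \<delta> \<Psi> t / LL t one has b LL b <= \<Psi> t, so the index belonging to b
  is at most t and its h at most h t. As b >= t^(1/4), LL b agrees with LL t up to 1 + \<epsilon>.
  The constant is therefore sharp whatever \<delta> is.\<close>

lemma weak_variance_sharp:
  assumes \<delta>: "0 < \<delta>" "\<delta> \<le> 1" and \<epsilon>: "0 < \<epsilon>" and \<Lambda>: "0 \<le> \<Lambda>"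
  shows "eventually (\<lambda>t. t * H (\<delta> * \<Psi> t / LL t) \<le> (1 + \<epsilon>) * \<Lambda> * (\<Psi> t)\<^sup>2 / (2 * LL t)) at_top"
proof -
  have lim: "filterlim (\<lambda>t. \<delta> * \<Psi> t / LL t) at_top at_top"
    by (rule filterlim_at_top_mono[OF powr_at_top[of "1/4"] eventually_Psi_div_LL_ge[OF \<delta>(1)]]) simp
  have ev: "eventually (\<lambda>t. H (\<delta> * \<Psi> t / LL t) \<le> \<Lambda> * h (\<Psi>i (\<delta> * \<Psi> t / LL t * LL (\<delta> * \<Psi> t / LL t))) / (2 * LL (\<delta> * \<Psi> t / LL t))) at_top"
    using eventually_compose_filterlim[OF eventually_H_le lim] .
  show ?thesis
    using ev eventually_LL_root[OF \<epsilon>] eventually_Psi_div_LL_ge[OF \<delta>(1)] eventually_Psi_le eventually_gt_at_top[of 0]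
  proof eventually_elim
    case (elim t)
    define b where "b = \<delta> * \<Psi> t / LL t"
    define m where "m = \<Psi>i (b * LL b)"
    have a: "0 < \<Psi> t" using elim by (simp add: Psi_pos)
    have LLp: "0 < LL t" "0 < LL b" using LL_ge_1[of t] LL_ge_1[of b] by linarith+
    have b: "0 < b" using a \<delta> LLp by (simp add: b_def)
    have "\<delta> * \<Psi> t \<le> 1 * \<Psi> t" using \<delta> a by (intro mult_right_mono) auto
    then have "b \<le> \<Psi> t / LL t" unfolding b_def using LLp by (intro divide_right_mono) auto
    moreover have "\<Psi> t / LL t \<le> \<Psi> t" using a LL_ge_1[of t] by (simp add: divide_le_eq mult_le_cancel_left1)
    ultimately have "b \<le> t" using elim by linarith
    then have LLb: "LL b \<le> LL t" by (rule LL_mono)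
    have "b * LL b \<le> \<Psi> t / LL t * LL t" using LLb LLp b \<open>b \<le> \<Psi> t / LL t\<close> a by (intro mult_mono) auto
    then have "m \<le> t" using b LLp elim by (simp add: m_def Psi_inv_le_iff)
    moreover have "0 \<le> m" using b LLp by (simp add: m_def Psi_inv_props)
    ultimately have hm: "h m \<le> h t" by (intro h_mono)
    have "LL t \<le> (1 + \<epsilon>) * LL b"
      using elim(2) LL_mono[OF elim(3)] \<epsilon> unfolding b_def by (meson add_nonneg_nonneg dual_order.trans less_imp_le mult_left_mono zero_le_one)
    then have inv: "1 / LL b \<le> (1 + \<epsilon>) / LL t" using LLp by (simp add: field_simps)
    have "t * H b \<le> t * (\<Lambda> * h m / (2 * LL b))"
      using elim by (intro mult_left_mono) (auto simp: b_def m_def)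
    also have "\<dots> \<le> t * (\<Lambda> * h t / (2 * LL b))"
      using elim hm \<Lambda> LLp by (intro mult_left_mono divide_right_mono) auto
    also have "\<dots> = \<Lambda> * (\<Psi> t)\<^sup>2 / 2 * (1 / LL b)" using elim by (simp add: Psi_sq)
    also have "\<dots> \<le> \<Lambda> * (\<Psi> t)\<^sup>2 / 2 * ((1 + \<epsilon>) / LL t)" using inv \<Lambda> by (intro mult_left_mono) auto
    finally show ?case by (simp add: b_def mult_ac)
  qed
qed

text \<open>At the full level a = \<Psi> t the index rises to at most (LL a)^2 t. Exponent 1/4 in
  the bound of Potter type makes this cost only sqrt (LL a), which leaves the square root of LL t in
  the denominator.\<close>

lemma weak_variance_crude:
  assumes \<Lambda>: "0 \<le> \<Lambda>"
  shows "eventually (\<lambda>t. t * H (\<Psi> t) \<le> 2 * \<Lambda> * (\<Psi> t)\<^sup>2 / sqrt (LL t)) at_top"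
proof -
  obtain t0 where t0: "0 < t0" "\<And>t w. t0 \<le> t \<Longrightarrow> t \<le> w \<Longrightarrow> h w \<le> 2 powr (1/4) * (w / t) powr (1/4) * h t"
    using potter_bound[of "1/4"] by auto
  show ?thesis
    using eventually_compose_filterlim[OF eventually_H_le Psi_at_top] eventually_LL_root[of 1, simplified]
      eventually_Psi_div_LL_ge[of 1, simplified] eventually_ge_at_top[of t0]
  proof eventually_elim
    case (elim t)
    define a where "a = \<Psi> t"
    define m where "m = \<Psi>i (a * LL a)"
    have t: "0 < t" using elim t0 by linarith
    have a: "0 < a" using t by (simp add: a_def Psi_pos)
    have LLp: "0 < LL t" "1 \<le> LL a" using LL_ge_1[of t] LL_ge_1[of a] by linarith+
    have m0: "0 \<le> m" using a LLp by (simp add: m_def Psi_inv_props)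
    have "a * LL a \<le> \<Psi> ((LL a)\<^sup>2 * t)" using Psi_scale_ge(1)[of "LL a" t] LLp t by (simp add: a_def mult.commute)
    then have mle: "m \<le> (LL a)\<^sup>2 * t" using a LLp t by (simp add: m_def Psi_inv_le_iff)
    have "t \<le> (LL a)\<^sup>2 * t" using LLp t by (simp add: mult_le_cancel_right1 one_le_power)
    have "h m \<le> h ((LL a)\<^sup>2 * t)" by (rule h_mono[OF m0 mle])
    also have "\<dots> \<le> 2 powr (1/4) * ((LL a)\<^sup>2 * t / t) powr (1/4) * h t"
      by (rule t0(2)[OF elim(4)]) fact
    also have "((LL a)\<^sup>2 * t / t) powr (1/4) = sqrt (LL a)"
    proof -
      have "(LL a)\<^sup>2 = LL a powr 2" using LLp by simp
      then have "((LL a)\<^sup>2) powr (1/4) = LL a powr (1/2)" by (simp only: powr_powr) simp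
      then show ?thesis using t LLp by (simp add: powr_half_sqrt)
    qed
    also have "2 powr (1/4) * sqrt (LL a) * h t \<le> 2 powr (1/2) * sqrt (LL a) * h t"
      using LLp h_pos[of t] t by (intro mult_right_mono powr_mono) auto
    finally have hm: "h m \<le> sqrt 2 * sqrt (LL a) * h t" by (simp add: powr_half_sqrt)
    have "t powr (1/4) \<le> a"
    proof -
      have "\<Psi> t / LL t \<le> \<Psi> t" using a LL_ge_1[of t] by (simp add: divide_le_eq mult_le_cancel_left1 a_def)
      then show ?thesis using elim(3) by (simp add: a_def)
    qed
    then have "LL t \<le> 2 * LL a" using elim(2) LL_mono[of "t powr (1/4)" a] by simp
    then have sq: "sqrt (LL t) \<le> sqrt 2 * sqrt (LL a)" by (simp flip: real_sqrt_mult)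
    have "t * H a \<le> t * (\<Lambda> * h m / (2 * LL a))"
      using elim t by (intro mult_left_mono) (auto simp: a_def m_def)
    also have "\<dots> \<le> t * (\<Lambda> * (sqrt 2 * sqrt (LL a) * h t) / (2 * LL a))"
      using t hm \<Lambda> LLp by (intro mult_left_mono divide_right_mono) auto
    also have "\<dots> = \<Lambda> * (\<Psi> t)\<^sup>2 * (sqrt 2 * (sqrt (LL a) / LL a) / 2)" using t LLp by (simp add: Psi_sq field_simps)
    also have "sqrt (LL a) / LL a = 1 / sqrt (LL a)" using LLp by (simp add: field_simps)
    also have "\<Lambda> * (\<Psi> t)\<^sup>2 * (sqrt 2 * (1 / sqrt (LL a)) / 2) \<le> \<Lambda> * (\<Psi> t)\<^sup>2 * (2 / sqrt (LL t))"
    proof (intro mult_left_mono)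
      have "sqrt 2 * sqrt (LL t) \<le> sqrt 2 * (sqrt 2 * sqrt (LL a))" using sq by simp
      also have "\<dots> = 2 * sqrt (LL a)" by simp
      finally have "sqrt 2 * sqrt (LL t) \<le> 2 * sqrt (LL a)" .
      moreover have "0 \<le> sqrt (LL a)" using LLp by simp
      ultimately have "sqrt 2 * sqrt (LL t) \<le> 4 * sqrt (LL a)" by linarith
      then show "sqrt 2 * (1 / sqrt (LL a)) / 2 \<le> 2 / sqrt (LL t)"
        using LLp by (simp add: field_simps)
    qed (use \<Lambda> in auto)
    finally show ?case by (simp add: a_def mult_ac)
  qed
qed

end

end

section \<open>Truncation and moments\<close>

locale banach_iid = prob_space M + slow_norming h
  for M :: "'a measure" and h :: "real \<Rightarrow> real" +
  fixes X :: "'a \<Rightarrow> 'b::{banach, second_countable_topology}" and Xs :: "nat \<Rightarrow> 'a \<Rightarrow> 'b"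
  assumes X_meas [measurable]: "X \<in> borel_measurable M"
    and Xs_meas: "\<And>i. i \<ge> 1 \<Longrightarrow> Xs i \<in> borel_measurable M"
    and Xs_indep: "indep_vars (\<lambda>_. borel) Xs {1..}"
    and Xs_distr: "\<And>i. i \<ge> 1 \<Longrightarrow> distr M borel (Xs i) = distr M borel X"
    and X_int: "integrable M X" and X_mean: "integral\<^sup>L M X = 0"
    and Psi_inv_int: "integrable M (\<lambda>\<omega>. Psi_inv h (norm (X \<omega>)))"
begin

abbreviation "S n \<omega> \<equiv> (\<Sum>i\<in>{1..n}. Xs i \<omega>)"
abbreviation "H \<equiv> H_fun M X"
abbreviation "\<nu> \<equiv> distr M borel X"

definition \<alpha> :: "real \<Rightarrow> real" where
  "\<alpha> N = expectation (\<lambda>\<omega>. N * (min (norm (X \<omega>) / \<Psi> N) 1) ^ 4)"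

definition first_tail :: "real \<Rightarrow> real" where
  "first_tail b = expectation (\<lambda>\<omega>. norm (X \<omega>) * indicator {\<omega>. b < norm (X \<omega>)} \<omega>)"

text \<open>As X has mean zero, this bounds, in units of \<Psi> N, the drift of N summands truncated
  at \<Psi> N.\<close>

definition tail_mean :: "real \<Rightarrow> real" where
  "tail_mean N = N * first_tail (\<Psi> N) / \<Psi> N"

lemma expectation_Xs:
  fixes g :: "'b \<Rightarrow> real"
  assumes "i \<ge> 1" "g \<in> borel_measurable borel"
  shows "expectation (\<lambda>\<omega>. g (Xs i \<omega>)) = expectation (\<lambda>\<omega>. g (X \<omega>))"
  using integral_distr[OF Xs_meas[OF assms(1)] assms(2)] integral_distr[OF X_meas assms(2)] Xs_distr[OF assms(1)]
  by simp

lemma prob_Xs: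
  assumes "i \<ge> 1" "A \<in> sets borel"
  shows "prob {\<omega> \<in> space M. Xs i \<omega> \<in> A} = prob {\<omega> \<in> space M. X \<omega> \<in> A}"
proof -
  have "measure (distr M borel (Xs i)) A = measure (distr M borel X) A" using Xs_distr[OF assms(1)] by simp
  then show ?thesis
    using assms Xs_meas by (simp add: measure_distr vimage_def Int_def conj_commute)
qed

lemma S_meas [measurable]: "(\<lambda>\<omega>. \<Sum>i\<in>{m..n}. Xs i \<omega>) \<in> borel_measurable M" if "1 \<le> m"
  using Xs_meas that by (intro borel_measurable_sum) auto

lemma dual_meas [measurable]: "f \<in> dual_ball \<Longrightarrow> (\<lambda>\<omega>. f (X \<omega>)) \<in> borel_measurable M"
  using measurable_compose[OF X_meas borel_measurable_dual_ball] .

lemma H_integrand: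
  assumes f: "f \<in> dual_ball"
  shows "integrable M (\<lambda>\<omega>. (f (X \<omega>))\<^sup>2 * indicator {\<omega>. norm (X \<omega>) \<le> t} \<omega>)"
    "0 \<le> expectation (\<lambda>\<omega>. (f (X \<omega>))\<^sup>2 * indicator {\<omega>. norm (X \<omega>) \<le> t} \<omega>)"
    "expectation (\<lambda>\<omega>. (f (X \<omega>))\<^sup>2 * indicator {\<omega>. norm (X \<omega>) \<le> t} \<omega>) \<le> t\<^sup>2"
proof -
  note [measurable] = dual_meas[OF f]
  have b: "(f (X \<omega>))\<^sup>2 * indicator {\<omega>. norm (X \<omega>) \<le> t} \<omega> \<le> t\<^sup>2" for \<omega>
    using dual_ballD(2)[OF f, of "X \<omega>"] by (auto simp: indicator_def abs_le_square_iff[symmetric])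
  show i: "integrable M (\<lambda>\<omega>. (f (X \<omega>))\<^sup>2 * indicator {\<omega>. norm (X \<omega>) \<le> t} \<omega>)"
    by (rule integrable_const_bound[where B="t\<^sup>2"]) (use b in \<open>auto simp: abs_mult\<close>)
  show "0 \<le> expectation (\<lambda>\<omega>. (f (X \<omega>))\<^sup>2 * indicator {\<omega>. norm (X \<omega>) \<le> t} \<omega>)"
    by (intro integral_nonneg_AE AE_I2) simp
  show "expectation (\<lambda>\<omega>. (f (X \<omega>))\<^sup>2 * indicator {\<omega>. norm (X \<omega>) \<le> t} \<omega>) \<le> t\<^sup>2"
    using integral_le_const[OF i AE_I2[OF b]] .
qed

lemma H_bdd: "bdd_above ((\<lambda>f. expectation (\<lambda>\<omega>. (f (X \<omega>))\<^sup>2 * indicator {\<omega>. norm (X \<omega>) \<le> t} \<omega>)) ` dual_ball)"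
  by (rule bdd_aboveI2[where M="t\<^sup>2"]) (rule H_integrand)

lemma le_H: "f \<in> dual_ball \<Longrightarrow> expectation (\<lambda>\<omega>. (f (X \<omega>))\<^sup>2 * indicator {\<omega>. norm (X \<omega>) \<le> t} \<omega>) \<le> H t"
  unfolding H_fun_def by (rule cSUP_upper[OF _ H_bdd])

lemma H_nonneg: "0 \<le> H t"
  using H_integrand(2)[OF dual_ball_zero, of t] le_H[OF dual_ball_zero, of t] by linarith

lemma H_attained:
  assumes "c < H t"
  obtains f where "f \<in> dual_ball" "c < expectation (\<lambda>\<omega>. (f (X \<omega>))\<^sup>2 * indicator {\<omega>. norm (X \<omega>) \<le> t} \<omega>)"
  using assms dual_ball_zero unfolding H_fun_def by (subst (asm) less_cSUP_iff[OF _ H_bdd]) auto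

lemma truncated_square_mono:
  assumes f: "f \<in> dual_ball" and st: "s \<le> t"
  shows "expectation (\<lambda>\<omega>. (f (X \<omega>))\<^sup>2 * indicator {\<omega>. norm (X \<omega>) \<le> s} \<omega>) 
    \<le> expectation (\<lambda>\<omega>. (f (X \<omega>))\<^sup>2 * indicator {\<omega>. norm (X \<omega>) \<le> t} \<omega>)"
  using st by (intro integral_mono H_integrand[OF f] mult_left_mono) (auto simp: indicator_def)

lemma H_mono: "s \<le> t \<Longrightarrow> H s \<le> H t"
  unfolding H_fun_def[of M X s] using dual_ball_zero
  by (intro cSUP_least order_trans[OF truncated_square_mono le_H]) auto

lemma fourth_moment_integrable:
  assumes "0 < N"
  shows "integrable M (\<lambda>\<omega>. N * (min (norm (X \<omega>) / \<Psi> N) 1) ^ 4)"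
proof (rule integrable_const_bound[where B=N])
  have "0 \<le> min (norm (X \<omega>) / \<Psi> N) 1" for \<omega> using Psi_pos[OF assms] by simp
  then have "\<bar>min (norm (X \<omega>) / \<Psi> N) 1\<bar> ^ 4 \<le> 1" for \<omega> by (intro power_le_one) auto
  then show "AE \<omega> in M. norm (N * (min (norm (X \<omega>) / \<Psi> N) 1) ^ 4) \<le> N"
    using assms by (intro AE_I2) (simp add: abs_mult power_abs mult_le_cancel_left1)
qed simp

lemma alpha_nonneg: "0 \<le> N \<Longrightarrow> 0 \<le> \<alpha> N"
  unfolding \<alpha>_def by (intro integral_nonneg_AE AE_I2) simp

text \<open>The kernel bound is integrated term by term. That it does not depend on s matters: s = 1
  yields the Borel-Cantelli series, and large s bounds the number of unusable blocks in the lower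
  bound.\<close>

lemma sum_alpha_le:
  fixes s c :: real and N :: "nat \<Rightarrow> real"
  assumes c: "1 < c" and s: "0 < s" and N: "\<And>j. s * c ^ j \<le> N j" "\<And>j. N j \<le> 2 * (s * c ^ j)"
  shows "(\<Sum>j<n. \<alpha> (N j)) \<le> 4 * (1 + c) / (c - 1) * expectation (\<lambda>\<omega>. \<Psi>i (norm (X \<omega>)))"
proof -
  have "0 < s * c ^ j" for j using s c by simp
  then have Np: "0 < N j" for j using N(1)[of j] less_le_trans by blast
  have "(\<Sum>j<n. \<alpha> (N j)) = expectation (\<lambda>\<omega>. \<Sum>j<n. N j * (min (norm (X \<omega>) / \<Psi> (N j)) 1) ^ 4)"
    unfolding \<alpha>_def using fourth_moment_integrable[OF Np] by (subst Bochner_Integration.integral_sum) auto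
  also have "\<dots> \<le> expectation (\<lambda>\<omega>. 4 * (1 + c) / (c - 1) * \<Psi>i (norm (X \<omega>)))"
    by (intro integral_mono Bochner_Integration.integrable_sum fourth_moment_integrable Np
        sum_fourth_moment_kernel[OF c s _ N] integrable_mult_right Psi_inv_int) auto
  finally show ?thesis by simp
qed

text \<open>Dominated convergence: with w = \<open>\<Psi>i (norm (X \<omega>))\<close>, the
  integrand is at most min N (w^2 / N), which is at most w and tends to 0.\<close>

lemma alpha_tendsto_0: "(\<alpha> \<longlongrightarrow> 0) at_top"
proof -
  have "((\<lambda>N. expectation (\<lambda>\<omega>. N * (min (norm (X \<omega>) / \<Psi> N) 1) ^ 4)) \<longlongrightarrow> expectation (\<lambda>\<omega>. 0)) at_top"
  proof (rule integral_dominated_convergence_at_top[where w="\<lambda>\<omega>. \<Psi>i (norm (X \<omega>))"])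
    show "AE \<omega> in M. ((\<lambda>N. N * (min (norm (X \<omega>) / \<Psi> N) 1) ^ 4) \<longlongrightarrow> 0) at_top"
    proof (rule AE_I2, rule tendsto_sandwich[OF _ _ tendsto_const])
      fix \<omega>
      show "((\<lambda>N. (\<Psi>i (norm (X \<omega>)))\<^sup>2 / N) \<longlongrightarrow> 0) at_top"
        by (rule real_tendsto_divide_at_top[OF tendsto_const filterlim_ident])
      show "\<forall>\<^sub>F N in at_top. 0 \<le> N * (min (norm (X \<omega>) / \<Psi> N) 1) ^ 4"
        using eventually_gt_at_top[of 0] by eventually_elim simp
      show "\<forall>\<^sub>F N in at_top. N * (min (norm (X \<omega>) / \<Psi> N) 1) ^ 4 \<le> (\<Psi>i (norm (X \<omega>)))\<^sup>2 / N"
        using eventually_gt_at_top[of 0]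
      proof eventually_elim
        case (elim N)
        show ?case using fourth_moment_kernel[OF norm_ge_zero elim, of "X \<omega>"] by simp
      qed
    qed
    show "\<forall>\<^sub>F N in at_top. AE \<omega> in M. norm (N * (min (norm (X \<omega>) / \<Psi> N) 1) ^ 4) \<le> \<Psi>i (norm (X \<omega>))"
      using eventually_gt_at_top[of 0]
    proof (eventually_elim, intro AE_I2)
      fix N :: real and \<omega> assume N: "0 < N"
      let ?w = "\<Psi>i (norm (X \<omega>))"
      have w: "0 \<le> ?w" by (rule Psi_inv_props) simp
      have "min N (?w\<^sup>2 / N) \<le> ?w"
      proof (cases "N \<le> ?w")
        case False
        then have "?w * ?w \<le> N * ?w" using w by (intro mult_right_mono) auto
        then have "?w\<^sup>2 / N \<le> ?w" using N by (simp add: power2_eq_square divide_le_eq mult.commute)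
        then show ?thesis by simp
      qed simp
      then have "N * (min (norm (X \<omega>) / \<Psi> N) 1) ^ 4 \<le> ?w"
        using fourth_moment_kernel[OF norm_ge_zero N, of "X \<omega>"] by linarith
      moreover have "0 \<le> N * (min (norm (X \<omega>) / \<Psi> N) 1) ^ 4" using N by simp
      ultimately show "norm (N * (min (norm (X \<omega>) / \<Psi> N) 1) ^ 4) \<le> ?w"
        by (simp only: real_norm_def abs_of_nonneg)
    qed
  qed (use Psi_inv_int in auto)
  then show ?thesis by (simp add: \<alpha>_def[abs_def])
qed

lemma first_tail_integrable: "integrable M (\<lambda>\<omega>. norm (X \<omega>) * indicator {\<omega>. b < norm (X \<omega>)} \<omega>)"
  by (rule Bochner_Integration.integrable_bound[OF integrable_norm[OF X_int]]) (auto simp: indicator_def)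

lemma first_tail_nonneg: "0 \<le> first_tail b"
  unfolding first_tail_def by (intro integral_nonneg_AE AE_I2) simp

text \<open>For each sample point the integrand vanishes as soon as \<Psi> N exceeds the norm, and
  \<open>first_moment_kernel\<close> supplies the integrable majorant.\<close>

lemma tail_mean_tendsto_0: "(tail_mean \<longlongrightarrow> 0) at_top"
proof -
  obtain N0 where N0: "0 < N0" "\<And>N y. N0 \<le> N \<Longrightarrow> \<Psi> N < y \<Longrightarrow> N * (y / \<Psi> N) \<le> 2 * \<Psi>i y"
    using first_moment_kernel by blast
  let ?s = "\<lambda>N \<omega>. N * (norm (X \<omega>) / \<Psi> N) * indicator {\<omega>. \<Psi> N < norm (X \<omega>)} \<omega>"
  have "((\<lambda>N. expectation (?s N)) \<longlongrightarrow> expectation (\<lambda>\<omega>. 0)) at_top"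
  proof (rule integral_dominated_convergence_at_top[where w="\<lambda>\<omega>. 2 * \<Psi>i (norm (X \<omega>))"])
    show "AE \<omega> in M. ((\<lambda>N. ?s N \<omega>) \<longlongrightarrow> 0) at_top"
    proof (rule AE_I2, rule tendsto_eventually)
      fix \<omega>
      have "eventually (\<lambda>N. norm (X \<omega>) \<le> \<Psi> N) at_top" using Psi_at_top by (simp add: filterlim_at_top)
      then show "eventually (\<lambda>N. ?s N \<omega> = 0) at_top" by eventually_elim (simp add: indicator_def)
    qed
    show "\<forall>\<^sub>F N in at_top. AE \<omega> in M. norm (?s N \<omega>) \<le> 2 * \<Psi>i (norm (X \<omega>))"
      using eventually_ge_at_top[of N0]
    proof (eventually_elim, intro AE_I2)
      fix N \<omega> assume N: "N0 \<le> N"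
      have "0 < N" using N N0(1) by linarith
      then have "0 \<le> N * (norm (X \<omega>) / \<Psi> N)" using Psi_pos[of N] by simp
      moreover have "0 \<le> \<Psi>i (norm (X \<omega>))" by (rule Psi_inv_props) simp
      ultimately show "norm (?s N \<omega>) \<le> 2 * \<Psi>i (norm (X \<omega>))"
        using N0(2)[OF N, of "norm (X \<omega>)"] by (cases "\<Psi> N < norm (X \<omega>)") auto
    qed
  qed (use Psi_inv_int in auto)
  moreover have "expectation (?s N) = tail_mean N" for N
  proof -
    have "expectation (?s N) = expectation (\<lambda>\<omega>. (N / \<Psi> N) * (norm (X \<omega>) * indicator {\<omega>. \<Psi> N < norm (X \<omega>)} \<omega>))"
      by (intro Bochner_Integration.integral_cong) auto
    then show ?thesis by (simp add: tail_mean_def first_tail_def)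
  qed
  ultimately show ?thesis by simp
qed

lemma tail_prob_le_alpha:
  assumes N: "0 < N" and k: "0 < \<kappa>" "\<kappa> \<le> 1"
  shows "N * prob {\<omega> \<in> space M. \<kappa> * \<Psi> N < norm (X \<omega>)} \<le> \<alpha> N / \<kappa> ^ 4"
proof -
  have a: "0 < \<Psi> N" by (rule Psi_pos[OF N])
  let ?A = "{\<omega> \<in> space M. \<kappa> * \<Psi> N < norm (X \<omega>)}"
  have [measurable]: "?A \<in> events" by measurable
  have "N * prob ?A = expectation (\<lambda>\<omega>. N * indicator ?A \<omega>)" by simp
  also have "\<dots> \<le> expectation (\<lambda>\<omega>. N * (min (norm (X \<omega>) / \<Psi> N) 1) ^ 4 / \<kappa> ^ 4)"
  proof (rule integral_mono)
    fix \<omega>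
    show "N * indicator ?A \<omega> \<le> N * (min (norm (X \<omega>) / \<Psi> N) 1) ^ 4 / \<kappa> ^ 4"
    proof (cases "\<omega> \<in> ?A")
      case True
      then have "\<kappa> \<le> min (norm (X \<omega>) / \<Psi> N) 1" using a k by (simp add: field_simps)
      then have "\<kappa> ^ 4 \<le> (min (norm (X \<omega>) / \<Psi> N) 1) ^ 4" using k by (intro power_mono) auto
      then show ?thesis using True N k by (simp add: field_simps)
    next
      case False
      then show ?thesis using N k by simp
    qed
  next
    show "integrable M (\<lambda>\<omega>. N * indicator ?A \<omega>)" by (intro integrable_mult_right integrable_real_indicator) (auto simp: emeasure_eq_measure)
    show "integrable M (\<lambda>\<omega>. N * (min (norm (X \<omega>) / \<Psi> N) 1) ^ 4 / \<kappa> ^ 4)"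
      by (intro integrable_divide fourth_moment_integrable[OF N])
  qed
  finally show ?thesis by (simp add: \<alpha>_def)
qed

text \<open>For r = norm / \<Psi> N between \<kappa> and 1, r <= r^4 / \<kappa>^3 brings in the
  fourth-moment quantity; the part r > 1 is left to \<open>tail_mean\<close>.\<close>

lemma first_tail_le:
  assumes N: "0 < N" and k: "0 < \<kappa>" "\<kappa> \<le> 1"
  shows "N * first_tail (\<kappa> * \<Psi> N) \<le> \<Psi> N * (\<alpha> N / \<kappa> ^ 3 + tail_mean N)"
proof -
  have a: "0 < \<Psi> N" by (rule Psi_pos[OF N])
  have i1: "integrable M (\<lambda>\<omega>. \<Psi> N / (N * \<kappa> ^ 3) * (N * (min (norm (X \<omega>) / \<Psi> N) 1) ^ 4))"
    using fourth_moment_integrable[OF N] by (rule integrable_mult_right)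
  have "first_tail (\<kappa> * \<Psi> N) \<le> expectation (\<lambda>\<omega>. \<Psi> N / (N * \<kappa> ^ 3) * (N * (min (norm (X \<omega>) / \<Psi> N) 1) ^ 4) 
      + norm (X \<omega>) * indicator {\<omega>. \<Psi> N < norm (X \<omega>)} \<omega>)"
    unfolding first_tail_def
  proof (rule integral_mono[OF first_tail_integrable Bochner_Integration.integrable_add[OF i1 first_tail_integrable]])
    fix \<omega>
    define r where "r = norm (X \<omega>) / \<Psi> N"
    have r0: "0 \<le> r" using a by (simp add: r_def)
    have nx: "norm (X \<omega>) = r * \<Psi> N" using a by (simp add: r_def)
    have nn: "0 \<le> \<Psi> N / (N * \<kappa> ^ 3) * (N * (min r 1) ^ 4)" using a N k by simp
    show "norm (X \<omega>) * indicator {\<omega>. \<kappa> * \<Psi> N < norm (X \<omega>)} \<omega>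
      \<le> \<Psi> N / (N * \<kappa> ^ 3) * (N * (min (norm (X \<omega>) / \<Psi> N) 1) ^ 4) + norm (X \<omega>) * indicator {\<omega>. \<Psi> N < norm (X \<omega>)} \<omega>"
    proof (cases "\<Psi> N < norm (X \<omega>)")
      case True
      then have I1: "indicator {\<omega>. \<Psi> N < norm (X \<omega>)} \<omega> = (1::real)" by simp
      have "norm (X \<omega>) * indicator {\<omega>. \<kappa> * \<Psi> N < norm (X \<omega>)} \<omega> \<le> norm (X \<omega>)"
        by (simp add: indicator_def)
      then show ?thesis using nn unfolding r_def[symmetric] I1 mult_1_right by linarith
    next
      case False
      then have r1: "r \<le> 1" using a by (simp add: r_def)
      show ?thesis
      proof (cases "\<kappa> * \<Psi> N < norm (X \<omega>)")
        case True
        then have "\<kappa> \<le> r" using a by (simp add: nx)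
        then have "\<kappa> ^ 3 \<le> r ^ 3" using k by (intro power_mono) auto
        then have "\<kappa> ^ 3 * r \<le> r ^ 3 * r" using r0 by (rule mult_right_mono)
        also have "r ^ 3 * r = r ^ 4" by (simp add: eval_nat_numeral)
        finally have "r \<le> r ^ 4 / \<kappa> ^ 3" using k by (simp add: le_divide_eq mult.commute)
        then have "r * \<Psi> N \<le> r ^ 4 / \<kappa> ^ 3 * \<Psi> N" using a by (intro mult_right_mono) auto
        also have "\<dots> = \<Psi> N / (N * \<kappa> ^ 3) * (N * (min r 1) ^ 4)" using N r1 by (simp add: min_absorb1)
        finally show ?thesis using True False by (simp add: nx[symmetric] r_def[symmetric])
      next
        case False
        then show ?thesis using nn \<open>\<not> \<Psi> N < norm (X \<omega>)\<close> by (simp add: r_def)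
      qed
    qed
  qed
  also have "\<dots> = \<Psi> N / (N * \<kappa> ^ 3) * \<alpha> N + first_tail (\<Psi> N)"
    unfolding \<alpha>_def first_tail_def using i1 first_tail_integrable fourth_moment_integrable[OF N] by simp
  finally have "N * first_tail (\<kappa> * \<Psi> N) \<le> N * (\<Psi> N / (N * \<kappa> ^ 3) * \<alpha> N + first_tail (\<Psi> N))"
    using N by (intro mult_left_mono) auto
  also have "\<dots> = \<Psi> N * (\<alpha> N / \<kappa> ^ 3 + tail_mean N)"
    using N a by (simp add: tail_mean_def algebra_simps)
  finally show ?thesis .
qed

section \<open>Centred truncation and its exponential inequality\<close>

definition trunc :: "real \<Rightarrow> 'b \<Rightarrow> 'b" where
  "trunc b x = (if norm x \<le> b then x else 0)"

definition trunc_mean :: "real \<Rightarrow> 'b" where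
  "trunc_mean b = integral\<^sup>L M (\<lambda>\<omega>. trunc b (X \<omega>))"

definition ctrunc :: "real \<Rightarrow> 'b \<Rightarrow> 'b" where
  "ctrunc b x = trunc b x - trunc_mean b"

lemma trunc_meas [measurable]: "trunc b \<in> borel_measurable borel"
  unfolding trunc_def[abs_def] by measurable

lemma ctrunc_meas [measurable]: "ctrunc b \<in> borel_measurable borel"
  unfolding ctrunc_def[abs_def] by measurable

lemma norm_trunc_le: "0 \<le> b \<Longrightarrow> norm (trunc b x) \<le> b"
  by (simp add: trunc_def)

lemma trunc_integrable: "0 \<le> b \<Longrightarrow> integrable M (\<lambda>\<omega>. trunc b (X \<omega>))"
  by (rule integrable_const_bound[where B=b]) (auto simp: norm_trunc_le)

lemma norm_trunc_mean_le: "0 \<le> b \<Longrightarrow> norm (trunc_mean b) \<le> first_tail b"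
proof -
  assume b: "0 \<le> b"
  have i: "integrable M (\<lambda>\<omega>. X \<omega> - trunc b (X \<omega>))" using X_int trunc_integrable[OF b] by auto
  have "trunc_mean b = - integral\<^sup>L M (\<lambda>\<omega>. X \<omega> - trunc b (X \<omega>))"
    using X_int trunc_integrable[OF b] X_mean by (simp add: trunc_mean_def)
  then have "norm (trunc_mean b) \<le> expectation (\<lambda>\<omega>. norm (X \<omega> - trunc b (X \<omega>)))"
    using integral_norm_bound[of M "\<lambda>\<omega>. X \<omega> - trunc b (X \<omega>)"] by simp
  also have "\<dots> = first_tail b"
    unfolding first_tail_def by (intro Bochner_Integration.integral_cong) (auto simp: trunc_def indicator_def)
  finally show ?thesis .
qed

text \<open>The truncated vector and its mean both have norm at most b, hence the bound 2 b.
  Centring can only lower the second moment of a functional, hence the weak variance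
  \<open>H b\<close>.\<close>

lemma ctrunc_centered:
  assumes b: "0 < b"
  shows "bounded_centered \<nu> (ctrunc b) (2 * b) (H b)"
proof -
  interpret \<nu>: prob_space \<nu> by (rule prob_space_distr) simp
  have tm: "norm (trunc_mean b) \<le> b"
  proof -
    have "norm (trunc_mean b) \<le> expectation (\<lambda>\<omega>. norm (trunc b (X \<omega>)))"
      unfolding trunc_mean_def by (rule integral_norm_bound)
    also have "\<dots> \<le> b" using trunc_integrable[of b] b
      by (intro integral_le_const AE_I2 integrable_norm) (auto simp: norm_trunc_le)
    finally show ?thesis .
  qed
  have fmean: "expectation (\<lambda>\<omega>. f (trunc b (X \<omega>))) = f (trunc_mean b)" if f: "f \<in> dual_ball" for f
    unfolding trunc_mean_def using integral_bounded_linear[OF dual_ballD(1)[OF f] trunc_integrable, of b] b by simp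
  have fint: "integrable M (\<lambda>\<omega>. f (trunc b (X \<omega>)))" if f: "f \<in> dual_ball" for f
    using integrable_bounded_linear[OF dual_ballD(1)[OF f] trunc_integrable, of b] b by simp
  have fsub: "f (ctrunc b x) = f (trunc b x) - f (trunc_mean b)" if f: "f \<in> dual_ball" for f x
    unfolding ctrunc_def using bounded_linear.linear[OF dual_ballD(1)[OF f]] by (simp add: linear_diff)
  have fm: "(\<lambda>x. f (ctrunc b x)) \<in> borel_measurable borel" if f: "f \<in> dual_ball" for f
    using measurable_compose[OF ctrunc_meas borel_measurable_dual_ball[OF f]] .
  show ?thesis
  proof
    show "ctrunc b \<in> borel_measurable \<nu>" by simp
    show "norm (ctrunc b y) \<le> 2 * b" for y
      unfolding ctrunc_def using norm_triangle_ineq4[of "trunc b y" "trunc_mean b"] norm_trunc_le[of b y] tm b by simp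
    show "0 < 2 * b" using b by simp
    fix f :: "'b \<Rightarrow> real" assume f: "f \<in> dual_ball"
    show "(\<integral>y. f (ctrunc b y) \<partial>\<nu>) = 0"
      using integral_distr[OF X_meas fm[OF f]] fint[OF f] fmean[OF f] by (simp add: fsub[OF f] prob_space)
    have sq: "(f (trunc b (X \<omega>)))\<^sup>2 = (f (X \<omega>))\<^sup>2 * indicator {\<omega>. norm (X \<omega>) \<le> b} \<omega>" for \<omega>
      using linear_0[OF bounded_linear.linear[OF dual_ballD(1)[OF f]]] by (simp add: trunc_def)
    have isq: "integrable M (\<lambda>\<omega>. (f (trunc b (X \<omega>)))\<^sup>2)" unfolding sq by (rule H_integrand[OF f])
    have fm2: "(\<lambda>x. (f (ctrunc b x))\<^sup>2) \<in> borel_measurable borel" using fm[OF f] by simp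
    have "(\<integral>y. (f (ctrunc b y))\<^sup>2 \<partial>\<nu>) = expectation (\<lambda>\<omega>. (f (ctrunc b (X \<omega>)))\<^sup>2)"
      by (rule integral_distr[OF X_meas fm2])
    also have "\<dots> = expectation (\<lambda>\<omega>. (f (trunc b (X \<omega>)))\<^sup>2 - 2 * f (trunc_mean b) * f (trunc b (X \<omega>)) + (f (trunc_mean b))\<^sup>2)"
      by (intro Bochner_Integration.integral_cong) (simp_all add: fsub[OF f] power2_diff)
    also have "\<dots> = expectation (\<lambda>\<omega>. (f (trunc b (X \<omega>)))\<^sup>2) - (f (trunc_mean b))\<^sup>2"
      using isq fint[OF f] fmean[OF f] by (simp add: prob_space power2_eq_square)
    also have "\<dots> \<le> H b" using le_H[OF f, of b] unfolding sq[symmetric] by (smt (verit) zero_le_power2)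
    finally show "(\<integral>y. (f (ctrunc b y))\<^sup>2 \<partial>\<nu>) \<le> H b" .
  qed
qed

text \<open>Independence and equal laws make the joint law of the summands a product measure, the
  setting in which the concentration inequalities are proved.\<close>

lemma integral_joint:
  fixes G :: "(nat \<Rightarrow> 'b) \<Rightarrow> real"
  assumes J: "J \<noteq> {}" "J \<subseteq> {1..}" and G: "G \<in> borel_measurable (PiM J (\<lambda>_. borel))"
  shows "(\<integral>x. G x \<partial>PiM J (\<lambda>_. \<nu>)) = expectation (\<lambda>\<omega>. G (\<lambda>i\<in>J. Xs i \<omega>))"
proof -
  have rv: "i \<in> J \<Longrightarrow> Xs i \<in> borel_measurable M" for i using J Xs_meas by auto
  have "distr M (PiM J (\<lambda>_. borel)) (\<lambda>\<omega>. \<lambda>i\<in>J. Xs i \<omega>) = PiM J (\<lambda>i. distr M borel (Xs i))"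
    using indep_vars_iff_distr_eq_PiM'[of J Xs "\<lambda>_. borel", OF J(1) rv] indep_vars_subset[OF Xs_indep J(2)] by simp
  also have "\<dots> = PiM J (\<lambda>_. \<nu>)" using J(2) Xs_distr by (intro PiM_cong) auto
  finally have "(\<integral>x. G x \<partial>PiM J (\<lambda>_. \<nu>)) = (\<integral>x. G x \<partial>distr M (PiM J (\<lambda>_. borel)) (\<lambda>\<omega>. \<lambda>i\<in>J. Xs i \<omega>))" by simp
  also have "\<dots> = expectation (\<lambda>\<omega>. G (\<lambda>i\<in>J. Xs i \<omega>))"
    using G by (intro integral_distr measurable_restrict rv) auto
  finally show ?thesis .
qed

definition Zc :: "real \<Rightarrow> nat \<Rightarrow> 'a \<Rightarrow> real" where
  "Zc b n \<omega> = norm (\<Sum>i\<in>{1..n}. ctrunc b (Xs i \<omega>))"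

lemma Zc_nonneg [simp]: "0 \<le> Zc b n \<omega>"
  by (simp add: Zc_def)

lemma Zc_meas [measurable]: "Zc b n \<in> borel_measurable M"
proof -
  have "(\<lambda>\<omega>. ctrunc b (Xs i \<omega>)) \<in> borel_measurable M" if "i \<in> {1..n}" for i
    using measurable_compose[OF Xs_meas ctrunc_meas, of i] that by simp
  then show ?thesis unfolding Zc_def[abs_def] by (intro measurable_compose[OF _ borel_measurable_norm] borel_measurable_sum) auto
qed

lemma integral_Zc:
  fixes g :: "real \<Rightarrow> real"
  assumes n: "1 \<le> n" and g: "g \<in> borel_measurable borel"
  shows "(\<integral>x. g (norm (\<Sum>i\<in>{1..n}. ctrunc b (x i))) \<partial>PiM {1..n} (\<lambda>_. \<nu>)) = expectation (\<lambda>\<omega>. g (Zc b n \<omega>))"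
proof -
  note [measurable] = g
  have "(\<lambda>x. g (norm (\<Sum>i\<in>{1..n}. ctrunc b (x i)))) \<in> borel_measurable (PiM {1..n} (\<lambda>_. borel))"
    by measurable
  from integral_joint[OF _ _ this] n show ?thesis
    by (auto simp: Zc_def intro!: Bochner_Integration.integral_cong)
qed

lemma Zc_integrable:
  assumes "1 \<le> n" "0 < b"
  shows "integrable M (Zc b n)" "integrable M (\<lambda>\<omega>. (Zc b n \<omega>)\<^sup>2)" "integrable M (\<lambda>\<omega>. exp (u * Zc b n \<omega>))"
proof -
  interpret B: bounded_centered \<nu> "ctrunc b" "2 * b" "H b" by (rule ctrunc_centered[OF assms(2)])
  have bd: "Zc b n \<omega> \<le> n * (2 * b)" for \<omega>
    using sum_bounded_above[of "{1..n}" "\<lambda>i. norm (ctrunc b (Xs i \<omega>))" "2 * b"] B.Y_bound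
    unfolding Zc_def by (intro order_trans[OF norm_sum]) auto
  show "integrable M (Zc b n)"
    by (rule integrable_const_bound[where B="n * (2 * b)"]) (use bd in auto)
  show "integrable M (\<lambda>\<omega>. (Zc b n \<omega>)\<^sup>2)"
    by (rule integrable_const_bound[where B="(n * (2 * b))\<^sup>2"]) (use bd in \<open>auto intro!: AE_I2 power_mono\<close>)
  show "integrable M (\<lambda>\<omega>. exp (u * Zc b n \<omega>))"
  proof (rule integrable_const_bound[where B="exp (\<bar>u\<bar> * (n * (2 * b)))"], rule AE_I2)
    fix \<omega>
    have "u * Zc b n \<omega> \<le> \<bar>u\<bar> * Zc b n \<omega>" by (intro mult_right_mono) auto
    also have "\<dots> \<le> \<bar>u\<bar> * (n * (2 * b))" by (intro mult_left_mono bd) auto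
    finally show "norm (exp (u * Zc b n \<omega>)) \<le> exp (\<bar>u\<bar> * (n * (2 * b)))" by simp
  qed simp
qed

lemma Zc_variance:
  assumes n: "1 \<le> n" and b: "0 < b"
  shows "expectation (\<lambda>\<omega>. (Zc b n \<omega>)\<^sup>2) - (expectation (Zc b n))\<^sup>2 \<le> n * H b + 4 * b * expectation (Zc b n)"
proof -
  interpret B: bounded_centered \<nu> "ctrunc b" "2 * b" "H b" by (rule ctrunc_centered[OF b])
  have "expectation (\<lambda>\<omega>. (Zc b n \<omega>)\<^sup>2) = (\<integral>x. (norm (\<Sum>i\<in>{1..n}. ctrunc b (x i)))\<^sup>2 \<partial>PiM {1..n} (\<lambda>_. \<nu>))"
    using integral_Zc[OF n, of "\<lambda>z. z\<^sup>2" b] by simp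
  moreover have "expectation (Zc b n) = (\<integral>x. norm (\<Sum>i\<in>{1..n}. ctrunc b (x i)) \<partial>PiM {1..n} (\<lambda>_. \<nu>))"
    using integral_Zc[OF n, of "\<lambda>z. z" b] by simp
  ultimately show ?thesis using B.efron_stein_norm[of "{1..n}"] by simp
qed

text \<open>Chernoff's bound with the Laplace transform of the norm, where 2 b is the bound on the
  summands. The number \<kappa> dominates the correction to 1 in the factor of ln F in
  \<open>ln_mgf_norm_bound\<close>.\<close>

lemma Zc_tail:
  assumes n: "1 \<le> n" and b: "0 < b" and u: "0 < u" and k: "exp (2 * u * b) * (2 * u * b) \<le> \<kappa>" "\<kappa> < 1"
  shows "prob {\<omega> \<in> space M. t < Zc b n \<omega>} \<le> 
    exp ((u * expectation (Zc b n) + exp (2 * u * b) * (n * H b) * u\<^sup>2 / 2) / (1 - \<kappa>) - u * t)"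
proof -
  interpret B: bounded_centered \<nu> "ctrunc b" "2 * b" "H b" by (rule ctrunc_centered[OF b])
  let ?F = "expectation (\<lambda>\<omega>. exp (u * Zc b n \<omega>))"
  let ?E = "u * expectation (Zc b n) + exp (2 * u * b) * (n * H b) * u\<^sup>2 / 2"
  have F: "?F = (\<integral>x. exp (u * norm (\<Sum>i\<in>{1..n}. ctrunc b (x i))) \<partial>PiM {1..n} (\<lambda>_. \<nu>))"
    using integral_Zc[OF n, of "\<lambda>z. exp (u * z)" b] by simp
  have E: "expectation (Zc b n) = (\<integral>x. norm (\<Sum>i\<in>{1..n}. ctrunc b (x i)) \<partial>PiM {1..n} (\<lambda>_. \<nu>))"
    using integral_Zc[OF n, of "\<lambda>z. z" b] by simp
  have F1: "1 \<le> ?F"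
    by (rule integral_ge_const[OF Zc_integrable(3)[OF n b]]) (use u in auto)
  have "ln ?F * (1 - \<kappa>) \<le> ln ?F * (1 - exp (2 * u * b) * (2 * u * b))"
    using F1 k by (intro mult_left_mono) auto
  also have "\<dots> \<le> ?E" using B.ln_mgf_norm_bound[of "{1..n}" u] u unfolding F E by (simp add: mult_ac)
  finally have "ln ?F \<le> ?E / (1 - \<kappa>)" using k by (simp add: le_divide_eq)
  then have lnF: "?F \<le> exp (?E / (1 - \<kappa>))"
  proof -
    have "?F = exp (ln ?F)" by (rule exp_ln[symmetric]) (use F1 in linarith)
    also have "\<dots> \<le> exp (?E / (1 - \<kappa>))" using \<open>ln ?F \<le> ?E / (1 - \<kappa>)\<close> by (simp only: exp_le_cancel_iff)
    finally show ?thesis .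
  qed
  let ?A = "{\<omega> \<in> space M. t < Zc b n \<omega>}"
  have [measurable]: "?A \<in> events" by measurable
  have "exp (u * t) * prob ?A = expectation (\<lambda>\<omega>. exp (u * t) * indicator ?A \<omega>)" by simp
  also have "\<dots> \<le> ?F"
  proof (rule integral_mono[OF _ Zc_integrable(3)[OF n b]])
    show "integrable M (\<lambda>\<omega>. exp (u * t) * indicator ?A \<omega>)"
      by (intro integrable_mult_right integrable_real_indicator) (auto simp: emeasure_eq_measure)
  qed (use u in \<open>auto simp: indicator_def\<close>)
  finally have "prob ?A \<le> ?F / exp (u * t)" by (simp add: le_divide_eq mult.commute)
  also have "\<dots> \<le> exp (?E / (1 - \<kappa>)) / exp (u * t)" using lnF by (intro divide_right_mono) auto
  finally show ?thesis by (simp add: exp_diff)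
qed

text \<open>A union bound over triples of indices, each contributing a cube by independence. Three
  exceedances are so unlikely that a truncation level well below \<Psi> can be afforded.\<close>

lemma exceedance_count:
  fixes n :: nat
  assumes A: "A \<in> sets borel"
  shows "prob {\<omega> \<in> space M. 3 \<le> card {i\<in>{1..n}. Xs i \<omega> \<in> A}} \<le> (n * prob {\<omega> \<in> space M. X \<omega> \<in> A}) ^ 3"
proof -
  define p where "p = prob {\<omega> \<in> space M. X \<omega> \<in> A}"
  have p: "0 \<le> p" by (simp add: p_def)
  have pXs: "prob {\<omega> \<in> space M. Xs i \<omega> \<in> A} = p" if "1 \<le> i" for i
    unfolding p_def by (rule prob_Xs[OF that A])
  define T where "T = {I. I \<subseteq> {1..n} \<and> card I = 3}"
  have finT: "finite T" unfolding T_def by (rule finite_subset[of _ "Pow {1..n}"]) (auto simp del: One_nat_def)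
  define B where "B = (\<lambda>I. {\<omega> \<in> space M. \<forall>i\<in>I. Xs i \<omega> \<in> A})"
  have Bm: "B I \<in> events" if "I \<in> T" for I
  proof -
    have "finite I" using that by (auto simp: T_def intro: finite_subset)
    moreover have "Xs i -` A \<inter> space M \<in> events" if "i \<in> I" for i
      using \<open>I \<in> T\<close> that A by (intro measurable_sets[OF Xs_meas]) (auto simp: T_def)
    moreover have "I \<noteq> {}" using that by (auto simp: T_def)
    moreover have "B I = (\<Inter>i\<in>I. Xs i -` A \<inter> space M)" using \<open>I \<noteq> {}\<close> by (auto simp: B_def)
    ultimately show ?thesis by (metis sets.finite_INT)
  qed
  have PB: "prob (B I) = p ^ 3" if I: "I \<in> T" for I
  proof -
    have f: "finite I" "I \<noteq> {}" "I \<subseteq> {1..}" using I by (auto simp: T_def intro: finite_subset)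
    have "B I = (\<Inter>i\<in>I. Xs i -` A \<inter> space M)" using f by (auto simp: B_def)
    also have "prob \<dots> = (\<Prod>i\<in>I. prob (Xs i -` A \<inter> space M))"
      by (rule indep_varsD[OF Xs_indep]) (use f A in auto)
    also have "\<dots> = (\<Prod>i\<in>I. p)"
      using pXs f by (intro prod.cong) (auto simp: vimage_def Int_def conj_commute)
    also have "\<dots> = p ^ 3" using I by (simp add: T_def)
    finally show ?thesis .
  qed
  have "{\<omega> \<in> space M. 3 \<le> card {i\<in>{1..n}. Xs i \<omega> \<in> A}} \<subseteq> (\<Union>I\<in>T. B I)"
  proof
    fix \<omega> assume "\<omega> \<in> {\<omega> \<in> space M. 3 \<le> card {i\<in>{1..n}. Xs i \<omega> \<in> A}}"
    then have w: "\<omega> \<in> space M" "3 \<le> card {i\<in>{1..n}. Xs i \<omega> \<in> A}" by auto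
    obtain I where I: "I \<subseteq> {i\<in>{1..n}. Xs i \<omega> \<in> A}" "card I = 3" by (rule obtain_subset_with_card_n[OF w(2)]) (rule that; assumption)
    have "I \<subseteq> {1..n}" by (rule subset_trans[OF I(1) Collect_restrict])
    then have IT: "I \<in> T" using I(2) unfolding T_def mem_Collect_eq by (rule conjI)
    have "\<omega> \<in> B I" using I w(1) by (auto simp: B_def)
    then show "\<omega> \<in> (\<Union>I\<in>T. B I)" by (rule UN_I[OF IT])
  qed
  then have "prob {\<omega> \<in> space M. 3 \<le> card {i\<in>{1..n}. Xs i \<omega> \<in> A}} \<le> prob (\<Union>I\<in>T. B I)"
    using finT Bm by (intro finite_measure_mono) auto
  also have "\<dots> \<le> (\<Sum>I\<in>T. prob (B I))" using finT Bm by (intro finite_measure_subadditive_finite) auto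
  also have "\<dots> = (n choose 3) * p ^ 3" using PB by (simp add: T_def n_subsets)
  also have "\<dots> \<le> real n ^ 3 * p ^ 3"
  proof (rule mult_right_mono)
    have "(n choose 3) * 1 \<le> (n choose 3) * fact 3" by (rule mult_le_mono2) (rule fact_ge_1)
    also have "\<dots> \<le> n ^ 3" by (rule binomial_fact_pow)
    finally have "real (n choose 3) \<le> real (n ^ 3)" by (subst of_nat_le_iff) simp
    then show "real (n choose 3) \<le> real n ^ 3" by simp
  qed (use p in simp)
  finally show ?thesis by (simp add: p_def power_mult_distrib)
qed

lemma exceedance_union:
  assumes A: "A \<in> sets borel"
  shows "prob {\<omega> \<in> space M. \<exists>i\<in>{1..n}. Xs i \<omega> \<in> A} \<le> n * prob {\<omega> \<in> space M. X \<omega> \<in> A}"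
proof -
  have ev: "{\<omega> \<in> space M. Xs i \<omega> \<in> A} \<in> events" if "1 \<le> i" for i
    using measurable_sets[OF Xs_meas[OF that] A] by (simp add: vimage_def Int_def conj_commute)
  have "{\<omega> \<in> space M. \<exists>i\<in>{1..n}. Xs i \<omega> \<in> A} = (\<Union>i\<in>{1..n}. {\<omega> \<in> space M. Xs i \<omega> \<in> A})" by auto
  also have "prob \<dots> \<le> (\<Sum>i\<in>{1..n}. prob {\<omega> \<in> space M. Xs i \<omega> \<in> A})"
    using ev by (intro finite_measure_subadditive_finite) auto
  also have "\<dots> = n * prob {\<omega> \<in> space M. X \<omega> \<in> A}" using prob_Xs[OF _ A] by simp
  finally show ?thesis .
qed

end

section \<open>Upper tail of a single sum\<close>

lemma eventually_ln_power_le: "eventually (\<lambda>x::real. (ln x) ^ 6 \<le> x) at_top"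
  using eventually_powr_ge[of "1/12" 12, simplified] eventually_ge_at_top[of 1]
proof eventually_elim
  case (elim x)
  have "ln x \<le> x powr (1/12) / (1/12)" using elim by (intro ln_powr_bound) auto
  also have "\<dots> = 12 * x powr (1/12)" by simp
  also have "\<dots> \<le> x powr (1/12) * x powr (1/12)" using elim by (intro mult_right_mono) auto
  also have "\<dots> = x powr (1/6)" by (simp flip: powr_add)
  finally have "(ln x) ^ 6 \<le> (x powr (1/6)) ^ 6" using elim by (intro power_mono) auto
  also have "\<dots> = x" using elim by (simp add: powr_powr flip: powr_realpow)
  finally show ?case .
qed

lemma eventually_ln_le_sqrt: "eventually (\<lambda>x::real. 24 * ln x \<le> sqrt x) at_top"
  using eventually_powr_ge[of "1/4" 96, simplified] eventually_ge_at_top[of 1]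
proof eventually_elim
  case (elim x)
  have "ln x \<le> x powr (1/4) / (1/4)" using elim by (intro ln_powr_bound) auto
  then have "24 * ln x \<le> 96 * x powr (1/4)" by simp
  also have "\<dots> \<le> x powr (1/4) * x powr (1/4)" using elim by (intro mult_right_mono) auto
  also have "\<dots> = sqrt x" using elim by (simp add: powr_half_sqrt flip: powr_add)
  finally show ?case .
qed

lemma (in prob_space) prob_subset_union:
  assumes "A \<subseteq> B \<union> C" "B \<in> events" "C \<in> events"
  shows "prob A \<le> prob B + prob C"
  using finite_measure_mono[OF assms(1) sets.Un[OF assms(2,3)]] measure_Un_le[OF assms(2,3)]
  by (rule order_trans)

lemma (in prob_space) prob_subset_union3:
  assumes "A \<subseteq> B \<union> (C \<union> D)" "B \<in> events" "C \<in> events" "D \<in> events"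
  shows "prob A \<le> prob B + (prob C + prob D)"
  using prob_subset_union[OF assms(1,2) sets.Un[OF assms(3,4)]]
    measure_Un_le[OF assms(3,4)] by linarith

text \<open>On an event of probability at least 1/2, Z is at most c and hence at distance at least
  EZ - c from its mean. A bound in probability thereby becomes a bound on the mean.\<close>

lemma (in prob_space) mean_le_by_variance:
  fixes Z :: "'a \<Rightarrow> real"
  assumes Z: "integrable M Z" "integrable M (\<lambda>\<omega>. (Z \<omega>)\<^sup>2)" and c: "c \<le> expectation Z"
    and p: "prob {\<omega> \<in> space M. c < Z \<omega>} \<le> 1/2"
  shows "(expectation Z - c)\<^sup>2 \<le> 2 * (expectation (\<lambda>\<omega>. (Z \<omega>)\<^sup>2) - (expectation Z)\<^sup>2)"
proof -
  let ?E = "expectation Z"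
  note [measurable] = borel_measurable_integrable[OF Z(1)]
  let ?A = "{\<omega> \<in> space M. c < Z \<omega>}" and ?B = "{\<omega> \<in> space M. \<not> c < Z \<omega>}"
  have "prob ?B = 1 - prob ?A" by (rule prob_neg) measurable
  then have "(?E - c)\<^sup>2 * (1/2) \<le> (?E - c)\<^sup>2 * prob ?B" using p by (intro mult_left_mono) auto
  also have "\<dots> = expectation (\<lambda>\<omega>. (?E - c)\<^sup>2 * indicator ?B \<omega>)" by simp
  also have "\<dots> \<le> expectation (\<lambda>\<omega>. (Z \<omega>)\<^sup>2 - 2 * ?E * Z \<omega> + ?E\<^sup>2)"
  proof (rule integral_mono)
    show "integrable M (\<lambda>\<omega>. (?E - c)\<^sup>2 * indicator ?B \<omega>)"
      by (intro integrable_mult_right integrable_real_indicator) (auto simp: emeasure_eq_measure)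
    show "integrable M (\<lambda>\<omega>. (Z \<omega>)\<^sup>2 - 2 * ?E * Z \<omega> + ?E\<^sup>2)" using Z by auto
    fix \<omega>
    have eq: "(Z \<omega>)\<^sup>2 - 2 * ?E * Z \<omega> + ?E\<^sup>2 = (?E - Z \<omega>)\<^sup>2" by (simp add: power2_diff)
    show "(?E - c)\<^sup>2 * indicator ?B \<omega> \<le> (Z \<omega>)\<^sup>2 - 2 * ?E * Z \<omega> + ?E\<^sup>2"
    proof (cases "\<omega> \<in> ?B")
      case True
      then have "(?E - c)\<^sup>2 \<le> (?E - Z \<omega>)\<^sup>2" using c by (intro power_mono) auto
      then show ?thesis unfolding eq using True by simp
    next
      case False
      then show ?thesis unfolding eq by simp
    qed
  qed
  also have "\<dots> = expectation (\<lambda>\<omega>. (Z \<omega>)\<^sup>2) - ?E\<^sup>2" using Z by (simp add: prob_space power2_eq_square)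
  finally show ?thesis by simp
qed

context banach_iid
begin

text \<open>The truncation level is \<open>\<Psi> t / ell t\<close> up to a constant. It is \<open>\<Psi> t / LL t\<close> unless the tail quantity
  \<open>\<alpha> t\<close> is so large that a bound of order \<open>\<alpha> t\<close> for the deviation probability suffices, in which case a higher level
  still gives an exponential bound of that order.\<close>

definition ell :: "real \<Rightarrow> real" where
  "ell t = (if \<alpha> t * (LL t) ^ 6 \<le> 1 then LL t else ln (1 / \<alpha> t))"

definition lev :: "real \<Rightarrow> real \<Rightarrow> real" where
  "lev \<delta> t = \<delta> * \<Psi> t / ell t"

lemma large_alpha_pos: "\<not> \<alpha> t * (LL t) ^ 6 \<le> 1 \<Longrightarrow> 0 < \<alpha> t"
  using LL_ge_1[of t] by (smt (verit) mult_nonpos_nonneg zero_le_power)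

lemma eventually_alpha_less: "0 < c \<Longrightarrow> eventually (\<lambda>t. \<alpha> t < c) at_top"
  using alpha_tendsto_0 by (rule order_tendstoD)

lemma eventually_ell_ge: "eventually (\<lambda>t. c \<le> ell t) at_top"
  using eventually_LL_ge[of c] eventually_alpha_less[of "exp (- c)", simplified]
proof eventually_elim
  case (elim t)
  show ?case
  proof (cases "\<alpha> t * (LL t) ^ 6 \<le> 1")
    case False
    have "ln (exp c) \<le> ln (1 / \<alpha> t)"
      using elim(2) large_alpha_pos[OF False] by (intro ln_mono) (auto simp: exp_minus field_simps)
    then show ?thesis using False by (simp add: ell_def)
  qed (use elim in \<open>simp add: ell_def\<close>)
qed

text \<open>In the second case of \<open>ell\<close> this is (ln x)^6 <= x at x = 1 / \<alpha> t,
  which is large because \<alpha> t tends to 0.\<close>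

lemma eventually_alpha_ell: "eventually (\<lambda>t. \<alpha> t * (ell t) ^ 6 \<le> 1) at_top"
proof -
  obtain x0 where x0: "\<And>x. x0 \<le> x \<Longrightarrow> (ln x) ^ 6 \<le> (x::real)"
    using eventually_ln_power_le by (auto simp: eventually_at_top_linorder)
  have "eventually (\<lambda>t. \<alpha> t < 1 / max x0 1) at_top" by (rule eventually_alpha_less) simp
  then show ?thesis
  proof eventually_elim
    case (elim t)
    show ?case
    proof (cases "\<alpha> t * (LL t) ^ 6 \<le> 1")
      case False
      have a: "0 < \<alpha> t" by (rule large_alpha_pos[OF False])
      have "0 < max x0 1" by simp
      then have "\<alpha> t * max x0 1 < 1" using elim by (simp only: pos_less_divide_eq)
      moreover have "\<alpha> t * x0 \<le> \<alpha> t * max x0 1" using a by (intro mult_left_mono) auto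
      ultimately have "\<alpha> t * x0 \<le> 1" by linarith
      then have "x0 \<le> 1 / \<alpha> t" using a by (simp add: le_divide_eq mult.commute)
      then have "(ln (1 / \<alpha> t)) ^ 6 \<le> 1 / \<alpha> t" by (rule x0)
      then have "\<alpha> t * (ln (1 / \<alpha> t)) ^ 6 \<le> \<alpha> t * (1 / \<alpha> t)" using a by (intro mult_left_mono) auto
      then show ?thesis using a False by (simp add: ell_def)
    qed (simp add: ell_def)
  qed
qed

text \<open>In the second case of \<open>ell\<close>, exp (- ell t) equals \<alpha> t, so the
  exponential bound turns into the other summable term.\<close>

lemma exp_ell_le: 
  assumes "0 \<le> \<eta>" "0 \<le> t" "\<alpha> t \<le> 1"
  shows "exp (- (1 + \<eta>) * ell t) \<le> exp (- (1 + \<eta>) * LL t) + \<alpha> t"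
proof (cases "\<alpha> t * (LL t) ^ 6 \<le> 1")
  case True
  then show ?thesis using alpha_nonneg[OF assms(2)] by (simp add: ell_def)
next
  case False
  have a: "0 < \<alpha> t" by (rule large_alpha_pos[OF False])
  have l: "0 \<le> ln (1 / \<alpha> t)" using a assms by simp
  have "ln (1 / \<alpha> t) \<le> (1 + \<eta>) * ln (1 / \<alpha> t)" using l assms by (simp add: mult_le_cancel_right1)
  then have "exp (- (1 + \<eta>) * ell t) \<le> exp (- ln (1 / \<alpha> t))" using False by (simp add: ell_def algebra_simps)
  also have "\<dots> = \<alpha> t" using a by (simp add: ln_div)
  finally show ?thesis by (smt (verit) exp_gt_zero)
qed

lemma eventually_lev_pos:
  assumes "0 < \<delta>" "\<delta> \<le> 1"
  shows "eventually (\<lambda>t. 0 < t \<and> 1 \<le> ell t \<and> 0 < lev \<delta> t \<and> lev \<delta> t \<le> \<Psi> t \<and> lev \<delta> t \<le> \<Psi> t / ell t) at_top"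
  using eventually_ell_ge[of 1] eventually_gt_at_top[of 0]
proof eventually_elim
  case (elim t)
  have a: "0 < \<Psi> t" using elim by (simp add: Psi_pos)
  have "lev \<delta> t \<le> \<Psi> t / ell t"
    unfolding lev_def using assms elim a by (intro divide_right_mono) (auto simp: mult_le_cancel_right1)
  moreover have "\<Psi> t / ell t \<le> \<Psi> t" using elim a by (simp add: divide_le_eq mult_le_cancel_left1)
  ultimately show ?case using elim assms a by (auto simp: lev_def)
qed

lemma eventually_tail_lev:
  assumes \<delta>: "0 < \<delta>" "\<delta> \<le> 1"
  shows "eventually (\<lambda>t. t * prob {\<omega> \<in> space M. lev \<delta> t < norm (X \<omega>)} \<le> \<alpha> t * (ell t) ^ 4 / \<delta> ^ 4
     \<and> t * first_tail (lev \<delta> t) \<le> \<Psi> t * (\<alpha> t * (ell t) ^ 3 / \<delta> ^ 3 + tail_mean t)) at_top"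
  using eventually_ell_ge[of 1] eventually_gt_at_top[of 0]
proof eventually_elim
  case (elim t)
  have k: "0 < \<delta> / ell t" "\<delta> / ell t \<le> 1" using \<delta> elim by (auto simp: divide_le_eq)
  have lev: "lev \<delta> t = \<delta> / ell t * \<Psi> t" by (simp add: lev_def)
  show ?case unfolding lev
    using tail_prob_le_alpha[OF elim(2) k] first_tail_le[OF elim(2) k] elim(1) by (simp add: power_divide)
qed

lemma eventually_alpha_ell_small:
  assumes "0 < c"
  shows "eventually (\<lambda>t. \<alpha> t * (ell t) ^ 3 \<le> c \<and> \<alpha> t * (ell t) ^ 4 \<le> c) at_top"
  using eventually_alpha_ell eventually_ell_ge[of "max 1 (1 / c)"] eventually_ge_at_top[of 0]
proof eventually_elim
  case (elim t)
  define l where "l = ell t"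
  have l: "1 \<le> l" "1 / c \<le> l" using elim by (auto simp: l_def)
  have a: "0 \<le> \<alpha> t" using elim by (simp add: alpha_nonneg)
  have cl: "1 \<le> c * l" using l assms by (simp add: field_simps)
  have "\<alpha> t * l ^ 4 * 1 \<le> \<alpha> t * l ^ 4 * (c * l ^ 2)"
  proof (rule mult_left_mono)
    have "c * l * 1 \<le> c * l * l" using l assms by (intro mult_left_mono) auto
    then show "1 \<le> c * l ^ 2" using cl by (simp add: power2_eq_square)
  qed (use a l in auto)
  also have "\<dots> = c * (\<alpha> t * l ^ 6)" by (simp add: eval_nat_numeral)
  also have "\<dots> \<le> c" using elim(1) assms by (simp add: l_def mult_left_le)
  finally have 4: "\<alpha> t * l ^ 4 \<le> c" by simp
  have "\<alpha> t * l ^ 3 \<le> \<alpha> t * l ^ 4" using a l by (intro mult_left_mono power_increasing) auto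
  then show ?case using 4 by (simp add: l_def)
qed

end

locale banach_iid_wlln = banach_iid +
  assumes wlln: "\<And>\<epsilon>. \<epsilon> > 0 \<Longrightarrow>
    ((\<lambda>n. measure M {\<omega> \<in> space M. norm ((\<Sum>i\<in>{1..n}. Xs i \<omega>) /\<^sub>R Psi h (real n)) > \<epsilon>}) \<longlonglongrightarrow> 0)"
begin

lemma wlln':
  assumes "0 < \<epsilon>" "0 < \<eta>"
  shows "eventually (\<lambda>n. prob {\<omega> \<in> space M. \<epsilon> * \<Psi> (real n) < norm (S n \<omega>)} < \<eta>) sequentially"
  using order_tendstoD(2)[OF wlln[OF assms(1)] assms(2)] eventually_gt_at_top[of 0]
proof eventually_elim
  case (elim n)
  then have "0 < \<Psi> (real n)" by (simp add: Psi_pos)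
  then have "\<epsilon> * \<Psi> (real n) < norm (S n \<omega>) \<longleftrightarrow> norm (S n \<omega> /\<^sub>R \<Psi> (real n)) > \<epsilon>" for \<omega>
    by (simp add: field_simps)
  then show ?case using elim(1) by (simp only:)
qed

lemma trunc_exceed: "x = trunc b x + (if b < norm x then x else 0)"
  by (simp add: trunc_def)

lemma S_decomp: "S n \<omega> = (\<Sum>i\<in>{1..n}. ctrunc b (Xs i \<omega>)) + real n *\<^sub>R trunc_mean b
    + (\<Sum>i\<in>{1..n}. if b < norm (Xs i \<omega>) then Xs i \<omega> else 0)"
proof -
  have "S n \<omega> = (\<Sum>i\<in>{1..n}. ctrunc b (Xs i \<omega>) + trunc_mean b + (if b < norm (Xs i \<omega>) then Xs i \<omega> else 0))"
    by (intro sum.cong refl) (simp add: ctrunc_def flip: trunc_exceed)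
  then show ?thesis by (simp add: sum.distrib sum_constant_scaleR)
qed

lemma norm_sum_exceed_le:
  fixes n :: nat
  assumes "\<forall>i\<in>{1..n}. norm (Xs i \<omega>) \<le> r" "card {i\<in>{1..n}. Xs i \<omega> \<in> {x. b < norm x}} < 3" "0 \<le> r"
  shows "norm (\<Sum>i\<in>{1..n}. if b < norm (Xs i \<omega>) then Xs i \<omega> else 0) \<le> 2 * r"
proof -
  let ?T = "{i\<in>{1..n}. Xs i \<omega> \<in> {x. b < norm x}}"
  have "(\<Sum>i\<in>{1..n}. if b < norm (Xs i \<omega>) then Xs i \<omega> else 0) = (\<Sum>i\<in>?T. Xs i \<omega>)"
    by (rule sum.mono_neutral_cong_right) auto
  also have "norm \<dots> \<le> (\<Sum>i\<in>?T. r)" using assms(1) by (intro order_trans[OF norm_sum] sum_mono) auto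
  also have "\<dots> = card ?T * r" by simp
  also have "\<dots> \<le> 2 * r"
  proof (rule mult_right_mono)
    have "card ?T \<le> 2" using assms(2) by linarith
    then show "real (card ?T) \<le> 2" by simp
  qed (rule assms(3))
  finally show ?thesis .
qed

context
  fixes \<Lambda> :: real
  assumes \<Lambda>: "0 < \<Lambda>"
    and H_lim: "eventually (\<lambda>x. 2 * \<Psi>i (x * LL x) / (x\<^sup>2 * LL x) * H x \<le> \<Lambda>\<^sup>2) at_top"
begin

text \<open>If \<open>ell\<close> is LL the sharp bound applies. Otherwise \<alpha> t > (LL t)^(-6),
  so \<open>ell\<close> is at most 6 ln (LL t), far below sqrt (LL t), and the crude bound at the
  level \<Psi> t is enough.\<close>

lemma eventually_weak_variance:
  assumes \<delta>: "0 < \<delta>" "\<delta> \<le> 1" and \<eta>: "0 < \<eta>"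
  shows "eventually (\<lambda>t. t * H (lev \<delta> t) \<le> (1 + \<eta>) * \<Lambda>\<^sup>2 * (\<Psi> t)\<^sup>2 / (2 * ell t)) at_top"
proof -
  have sharp: "eventually (\<lambda>t. t * H (\<delta> * \<Psi> t / LL t) \<le> (1 + \<eta>) * \<Lambda>\<^sup>2 * (\<Psi> t)\<^sup>2 / (2 * LL t)) at_top"
    by (rule weak_variance_sharp[OF H_mono H_lim \<delta> \<eta>]) auto
  have crude: "eventually (\<lambda>t. t * H (\<Psi> t) \<le> 2 * \<Lambda>\<^sup>2 * (\<Psi> t)\<^sup>2 / sqrt (LL t)) at_top"
    by (rule weak_variance_crude[OF H_mono H_lim]) auto
  show ?thesis
    using sharp crude eventually_lev_pos[OF \<delta>] eventually_compose_filterlim[OF eventually_ln_le_sqrt filterlim_LL]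
  proof eventually_elim
    case (elim t)
    show ?case
    proof (cases "\<alpha> t * (LL t) ^ 6 \<le> 1")
      case True
      then show ?thesis using elim(1) by (simp add: ell_def lev_def)
    next
      case False
      have a: "0 < \<alpha> t" by (rule large_alpha_pos[OF False])
      have L1: "1 \<le> LL t" by (rule LL_ge_1)
      have "1 / \<alpha> t \<le> (LL t) ^ 6" using False a by (simp add: field_simps)
      then have "ln (1 / \<alpha> t) \<le> ln ((LL t) ^ 6)" using a by (intro ln_mono) auto
      also have "\<dots> = 6 * ln (LL t)" using L1 by (simp add: ln_realpow)
      finally have "4 * ell t \<le> sqrt (LL t)" using elim(4) False by (simp add: ell_def)
      then have "1 / sqrt (LL t) \<le> 1 / (4 * ell t)" using elim(3) L1 by (intro divide_left_mono) auto
      then have "2 * \<Lambda>\<^sup>2 * (\<Psi> t)\<^sup>2 * (1 / sqrt (LL t)) \<le> 2 * \<Lambda>\<^sup>2 * (\<Psi> t)\<^sup>2 * (1 / (4 * ell t))"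
        by (rule mult_left_mono) simp
      then have "t * H (\<Psi> t) \<le> 1 * \<Lambda>\<^sup>2 * (\<Psi> t)\<^sup>2 / (2 * ell t)" using elim(2) by simp
      also have "\<dots> \<le> (1 + \<eta>) * \<Lambda>\<^sup>2 * (\<Psi> t)\<^sup>2 / (2 * ell t)"
        using \<eta> elim(3) by (intro divide_right_mono mult_right_mono) auto
      finally have "t * H (\<Psi> t) \<le> (1 + \<eta>) * \<Lambda>\<^sup>2 * (\<Psi> t)\<^sup>2 / (2 * ell t)" .
      moreover have "t * H (lev \<delta> t) \<le> t * H (\<Psi> t)" using elim(3) by (intro mult_left_mono H_mono) auto
      ultimately show ?thesis by linarith
    qed
  qed
qed

text \<open>With probability at least 1/2 the full sum is below (\<epsilon>/2) \<Psi> n and no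
  summand exceeds the truncation level; as the drift is at most (\<epsilon>/2) \<Psi> n, the
  truncated centred norm is then at most \<epsilon> \<Psi> n. Its variance is of order (\<Psi> n)^2
  / \<open>ell\<close>, plus a multiple of the mean times \<Psi> n / \<open>ell\<close>, too small
  for a mean above 2 \<epsilon> \<Psi> n.\<close>

lemma eventually_mean_small:
  assumes \<delta>: "0 < \<delta>" "\<delta> \<le> 1" and \<epsilon>: "0 < \<epsilon>"
  shows "eventually (\<lambda>n. expectation (Zc (lev \<delta> (real n)) n) \<le> 2 * \<epsilon> * \<Psi> (real n)) sequentially"
proof -
  have drift: "eventually (\<lambda>t. \<alpha> t * (ell t) ^ 3 / \<delta> ^ 3 + tail_mean t \<le> \<epsilon> / 2 \<and> \<alpha> t * (ell t) ^ 4 / \<delta> ^ 4 \<le> 1/4) at_top"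
  proof -
    have e4: "0 < \<epsilon> / 4" using \<epsilon> by simp
    have "0 < min (\<epsilon> / 4 * \<delta> ^ 3) (1/4 * \<delta> ^ 4)" using \<delta> \<epsilon> by simp
    from eventually_alpha_ell_small[OF this] order_tendstoD(2)[OF tail_mean_tendsto_0 e4]
    show ?thesis
    proof (eventually_elim)
      case (elim t)
      then have 1: "\<alpha> t * (ell t) ^ 3 \<le> \<epsilon> / 4 * \<delta> ^ 3" "\<alpha> t * (ell t) ^ 4 \<le> 1/4 * \<delta> ^ 4" by auto
      then have "\<alpha> t * (ell t) ^ 3 / \<delta> ^ 3 \<le> \<epsilon> / 4" "\<alpha> t * (ell t) ^ 4 / \<delta> ^ 4 \<le> 1/4"
        using \<delta> by (simp_all add: pos_divide_le_eq)
      then show ?case using elim(2) by linarith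
    qed
  qed
  \<comment> \<open>For E > 2 \<epsilon> a these thresholds make each of the terms 32 a E and 8
    \<Lambda>^2 a^2, arising at the end, at most l E^2 / 4.\<close>
  have ellbig: "eventually (\<lambda>t. 64 / \<epsilon> \<le> ell t \<and> 8 * \<Lambda>\<^sup>2 / \<epsilon>\<^sup>2 \<le> ell t) at_top"
    by (intro eventually_conj eventually_ell_ge)
  have ev: "eventually (\<lambda>t. (\<alpha> t * (ell t) ^ 3 / \<delta> ^ 3 + tail_mean t \<le> \<epsilon> / 2 \<and> \<alpha> t * (ell t) ^ 4 / \<delta> ^ 4 \<le> 1/4)
    \<and> (64 / \<epsilon> \<le> ell t \<and> 8 * \<Lambda>\<^sup>2 / \<epsilon>\<^sup>2 \<le> ell t) \<and> t * H (lev \<delta> t) \<le> (1 + 1) * \<Lambda>\<^sup>2 * (\<Psi> t)\<^sup>2 / (2 * ell t)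
    \<and> (0 < t \<and> 1 \<le> ell t \<and> 0 < lev \<delta> t \<and> lev \<delta> t \<le> \<Psi> t \<and> lev \<delta> t \<le> \<Psi> t / ell t)
    \<and> (t * prob {\<omega> \<in> space M. lev \<delta> t < norm (X \<omega>)} \<le> \<alpha> t * (ell t) ^ 4 / \<delta> ^ 4
     \<and> t * first_tail (lev \<delta> t) \<le> \<Psi> t * (\<alpha> t * (ell t) ^ 3 / \<delta> ^ 3 + tail_mean t))) at_top"
    by (intro eventually_conj[OF drift] eventually_conj[OF ellbig] eventually_conj[OF eventually_weak_variance[OF \<delta> zero_less_one]]
        eventually_conj[OF eventually_lev_pos[OF \<delta>] eventually_tail_lev[OF \<delta>]])
  have e2: "0 < \<epsilon> / 2" and q: "(0::real) < 1/4" using \<epsilon> by auto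
  show ?thesis
    using eventually_compose_filterlim[OF ev filterlim_real_sequentially] wlln'[OF e2 q] eventually_ge_at_top[of 1]
  proof (eventually_elim)
    case (elim n)
    define a b l where "a = \<Psi> (real n)" "b = lev \<delta> (real n)" "l = ell (real n)"
    note [simp] = this[symmetric]
    have n: "1 \<le> n" using elim by simp
    have a: "0 < a" using n Psi_pos[of "real n"] by simp
    have b: "0 < b" "b \<le> a / l" and l: "1 \<le> l" "64 / \<epsilon> \<le> l" "8 * \<Lambda>\<^sup>2 / \<epsilon>\<^sup>2 \<le> l" using elim(1) by simp_all
    have m: "real n * norm (trunc_mean b) \<le> \<epsilon> / 2 * a"
    proof -
      have "real n * norm (trunc_mean b) \<le> real n * first_tail b"
        using b by (intro mult_left_mono norm_trunc_mean_le) auto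
      also have "\<dots> \<le> a * (\<epsilon> / 2)"
        using elim(1) a by (intro order_trans[OF _ mult_left_mono[of _ "\<epsilon>/2" a]]) auto
      finally show ?thesis by (simp add: mult.commute)
    qed
    have pb: "real n * prob {\<omega> \<in> space M. b < norm (X \<omega>)} \<le> 1/4"
      by (rule order_trans[of _ "\<alpha> (real n) * (ell (real n)) ^ 4 / \<delta> ^ 4"]) (use elim(1) in simp_all)
    let ?A = "{\<omega> \<in> space M. \<epsilon> / 2 * a < norm (S n \<omega>)}" 
    let ?B = "{\<omega> \<in> space M. \<exists>i\<in>{1..n}. Xs i \<omega> \<in> {x. b < norm x}}"
    have Aev: "?A \<in> events" by measurable
    have Bev: "?B \<in> events"
    proof -
      have "{\<omega> \<in> space M. Xs i \<omega> \<in> {x. b < norm x}} \<in> events" if "i \<in> {1..n}" for i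
        using measurable_sets[OF Xs_meas, of i "{x. b < norm x}"] that by (simp add: vimage_def Int_def conj_commute)
      then show ?thesis by (intro sets.sets_Collect_finite_Ex) auto
    qed
    have "{\<omega> \<in> space M. \<epsilon> * a < Zc b n \<omega>} \<subseteq> ?A \<union> ?B"
    proof (rule subsetI, rule ccontr)
      fix \<omega> assume w: "\<omega> \<in> {\<omega> \<in> space M. \<epsilon> * a < Zc b n \<omega>}" "\<omega> \<notin> ?A \<union> ?B"
      then have "(\<Sum>i\<in>{1..n}. if b < norm (Xs i \<omega>) then Xs i \<omega> else 0) = 0" by (intro sum.neutral) auto
      then have "(\<Sum>i\<in>{1..n}. ctrunc b (Xs i \<omega>)) = S n \<omega> - real n *\<^sub>R trunc_mean b"
        using S_decomp[where n=n and \<omega>=\<omega> and b=b] by simp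
      then have "Zc b n \<omega> \<le> norm (S n \<omega>) + real n * norm (trunc_mean b)"
        using norm_triangle_ineq4[of "S n \<omega>" "real n *\<^sub>R trunc_mean b"] by (simp add: Zc_def)
      also have "\<dots> \<le> \<epsilon> / 2 * a + \<epsilon> / 2 * a" using w m by (intro add_mono) auto
      finally show False using w by simp
    qed
    then have "prob {\<omega> \<in> space M. \<epsilon> * a < Zc b n \<omega>} \<le> prob ?A + prob ?B"
      using Aev Bev by (rule prob_subset_union)
    also have "\<dots> \<le> 1/4 + 1/4"
    proof (rule add_mono)
      show "prob ?A \<le> 1/4" using elim(2) \<epsilon> by simp
      show "prob ?B \<le> 1/4"
        using exceedance_union[of "{x. b < norm x}" n] pb by simp
    qed
    finally have half: "prob {\<omega> \<in> space M. \<epsilon> * a < Zc b n \<omega>} \<le> 1/2" by simp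
    define E where "E = expectation (Zc b n)"
    show ?case
    proof (rule ccontr)
      assume "\<not> ?thesis"
      then have E: "2 * \<epsilon> * a < E" by (simp add: E_def)
      have ea: "0 < \<epsilon> * a" using \<epsilon> a by simp
      have Epos: "0 < E" using E ea by linarith
      \<comment> \<open>E > 2 \<epsilon> a makes E - \<epsilon> a at least E / 2, so the variance
        would have to be of order E^2.\<close>
      have "(E / 2)\<^sup>2 \<le> (E - \<epsilon> * a)\<^sup>2" using E ea by (intro power_mono) auto
      also have "\<dots> \<le> 2 * (expectation (\<lambda>\<omega>. (Zc b n \<omega>)\<^sup>2) - E\<^sup>2)"
        unfolding E_def by (rule mean_le_by_variance[OF Zc_integrable(1,2)[OF n b(1)] _ half]) (use E ea in \<open>simp add: E_def\<close>)
      also have "\<dots> \<le> 2 * (n * H b + 4 * b * E)" using Zc_variance[OF n b(1)] by (simp add: E_def)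
      also have "\<dots> \<le> 2 * (\<Lambda>\<^sup>2 * a\<^sup>2 / l + 4 * (a / l) * E)"
        using elim(1) b Epos by (intro mult_left_mono add_mono mult_right_mono) auto
      finally have main: "E\<^sup>2 * l \<le> 8 * \<Lambda>\<^sup>2 * a\<^sup>2 + 32 * a * E" using l by (simp add: field_simps)
      have "8 * \<Lambda>\<^sup>2 * a\<^sup>2 \<le> (l * \<epsilon>\<^sup>2) * a\<^sup>2" using l \<epsilon> by (intro mult_right_mono) (auto simp: field_simps)
      also have "\<dots> = l * (\<epsilon> * a)\<^sup>2" by (simp add: power_mult_distrib)
      also have "\<dots> \<le> l * (E / 2)\<^sup>2" using E ea l by (intro mult_left_mono power_mono) auto
      finally have 1: "8 * \<Lambda>\<^sup>2 * a\<^sup>2 \<le> l * E\<^sup>2 / 4" by (simp add: power_divide)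
      have "32 * a \<le> l * \<epsilon> / 2 * a" using l \<epsilon> a by (intro mult_right_mono) (auto simp: field_simps)
      also have "\<dots> = l * (2 * \<epsilon> * a) / 4" by simp
      also have "\<dots> \<le> l * E / 4" using E l by (intro divide_right_mono mult_left_mono) auto
      finally have "32 * a * E \<le> l * E / 4 * E" using Epos by (intro mult_right_mono) auto
      then have 2: "32 * a * E \<le> l * E\<^sup>2 / 4" by (simp add: power2_eq_square)
      have "0 < l * E\<^sup>2" using l Epos by simp
      moreover have "l * E\<^sup>2 \<le> 8 * \<Lambda>\<^sup>2 * a\<^sup>2 + 32 * a * E" using main by (simp only: mult.commute[of l])
      ultimately show False using 1 2 by linarith
    qed
  qed
qed

text \<open>A large norm needs a large truncated centred sum, three summands above
  \<open>lev\<close>, or one above r \<Psi> n. The first event has an exponential bound in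
  \<open>ell\<close>, the other two have probabilities of order \<alpha>; the drift is absorbed in
  \<epsilon>.\<close>

theorem tail_of_norm_sum:
  assumes \<epsilon>: "0 < \<epsilon>"
  obtains \<eta> C where "0 < \<eta>" "0 < C"
    "eventually (\<lambda>n. prob {\<omega> \<in> space M. (\<Lambda> + \<epsilon>) * \<Psi> (real n) < norm (S n \<omega>)} 
      \<le> exp (- (1 + \<eta>) * LL (real n)) + C * \<alpha> (real n)) sequentially"
proof -
  \<comment> \<open>The relative surplus of the level over \<Lambda>. With \<eta> = \<rho> / 16 all
    multiplicative losses amount to at most 8 \<eta> = \<rho> / 2, half of the gain \<rho> in the
    exponent.\<close>
  define \<rho> where "\<rho> = min (\<epsilon> / \<Lambda>) 1"
  define \<eta> where "\<eta> = \<rho> / 16"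
  have \<rho>: "0 < \<rho>" "\<rho> \<le> 1" "\<rho> * \<Lambda> \<le> \<epsilon>" using \<epsilon> \<Lambda> by (auto simp: \<rho>_def min_def field_simps)
  have \<eta>: "0 < \<eta>" "\<eta> \<le> 1/16" using \<rho> by (auto simp: \<eta>_def)
  define k where "k = \<eta> / 2"
  \<comment> \<open>Below, 2 u b = 4 \<delta> / \<Lambda>; this \<delta> keeps the exponential
    factor below 1 + \<eta> and the correction in the Chernoff bound below \<eta>.\<close>
  define \<delta> where "\<delta> = min 1 (\<Lambda> * k / 4)"
  have \<delta>: "0 < \<delta>" "\<delta> \<le> 1" using \<Lambda> \<eta> by (auto simp: \<delta>_def k_def)
  have \<delta>k: "4 * \<delta> / \<Lambda> \<le> k" using \<Lambda> by (simp add: \<delta>_def field_simps min_def)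
  have expk: "exp (4 * \<delta> / \<Lambda>) \<le> 1 + \<eta>"
  proof -
    have "exp (4 * \<delta> / \<Lambda>) \<le> exp k" using \<delta>k by simp
    also have "\<dots> \<le> 1 + k + k\<^sup>2" using \<eta> by (intro exp_bound) (auto simp: k_def)
    also have "\<dots> \<le> 1 + \<eta>" using \<eta> by (simp add: k_def power2_eq_square field_simps)
    finally show ?thesis .
  qed
  have expk2: "exp (4 * \<delta> / \<Lambda>) * (4 * \<delta> / \<Lambda>) \<le> \<eta>"
  proof -
    have "exp (4 * \<delta> / \<Lambda>) * (4 * \<delta> / \<Lambda>) \<le> 2 * k"
      using expk \<delta>k \<eta> \<delta> \<Lambda> by (intro mult_mono) auto
    then show ?thesis by (simp add: k_def)
  qed
  \<comment> \<open>Two summands of norm at most r a contribute no more than (\<epsilon>/4)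
    a.\<close>
  define r where "r = min (\<epsilon> / 8) 1"
  have r: "0 < r" "r \<le> 1" "2 * r \<le> \<epsilon> / 4" using \<epsilon> by (auto simp: r_def)
  define C where "C = 1 + 1 / \<delta> ^ 12 + 1 / r ^ 4"
  have C: "0 < C" using \<delta> r by (simp add: C_def add_pos_pos)
  have drift: "eventually (\<lambda>t. \<alpha> t * (ell t) ^ 3 / \<delta> ^ 3 + tail_mean t \<le> \<epsilon> / 4) at_top"
  proof -
    have e8: "0 < \<epsilon> / 8" using \<epsilon> by simp
    have "0 < \<epsilon> / 8 * \<delta> ^ 3" using \<delta> \<epsilon> by simp
    from eventually_alpha_ell_small[OF this] order_tendstoD(2)[OF tail_mean_tendsto_0 e8]
    show ?thesis
    proof (eventually_elim)
      case (elim t)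
      then have "\<alpha> t * (ell t) ^ 3 / \<delta> ^ 3 \<le> \<epsilon> / 8" using \<delta> by (simp add: pos_divide_le_eq)
      then show ?case using elim(2) by linarith
    qed
  qed
  have ev: "eventually (\<lambda>t. (\<alpha> t * (ell t) ^ 3 / \<delta> ^ 3 + tail_mean t \<le> \<epsilon> / 4)
    \<and> \<alpha> t * (ell t) ^ 6 \<le> 1 \<and> \<alpha> t < 1 \<and> t * H (lev \<delta> t) \<le> (1 + \<eta>) * \<Lambda>\<^sup>2 * (\<Psi> t)\<^sup>2 / (2 * ell t)
    \<and> (0 < t \<and> 1 \<le> ell t \<and> 0 < lev \<delta> t \<and> lev \<delta> t \<le> \<Psi> t \<and> lev \<delta> t \<le> \<Psi> t / ell t)
    \<and> (t * prob {\<omega> \<in> space M. lev \<delta> t < norm (X \<omega>)} \<le> \<alpha> t * (ell t) ^ 4 / \<delta> ^ 4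
     \<and> t * first_tail (lev \<delta> t) \<le> \<Psi> t * (\<alpha> t * (ell t) ^ 3 / \<delta> ^ 3 + tail_mean t))) at_top"
    by (intro eventually_conj[OF drift] eventually_conj[OF eventually_alpha_ell] eventually_conj[OF eventually_alpha_less[OF zero_less_one]]
        eventually_conj[OF eventually_weak_variance[OF \<delta> \<eta>(1)]]
        eventually_conj[OF eventually_lev_pos[OF \<delta>] eventually_tail_lev[OF \<delta>]])
  have ep: "0 < \<Lambda> * \<eta> / 4" using \<Lambda> \<eta> by simp
  show thesis
  proof (rule that[of "\<rho> / 2" C])
    show "eventually (\<lambda>n. prob {\<omega> \<in> space M. (\<Lambda> + \<epsilon>) * \<Psi> (real n) < norm (S n \<omega>)} 
      \<le> exp (- (1 + \<rho> / 2) * LL (real n)) + C * \<alpha> (real n)) sequentially"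
      using eventually_compose_filterlim[OF ev filterlim_real_sequentially] eventually_mean_small[OF \<delta> ep] eventually_ge_at_top[of 1]
    proof (eventually_elim)
      case (elim n)
      define a b l A where "a = \<Psi> (real n)" "b = lev \<delta> (real n)" "l = ell (real n)" "A = \<alpha> (real n)"
      note [simp] = this[symmetric]
      have n: "1 \<le> n" using elim by simp
      have a: "0 < a" using n Psi_pos[of "real n"] by simp
      have b: "0 < b" and l: "1 \<le> l" using elim(1) by simp_all
      have A: "0 \<le> A" "A \<le> 1" "A * l ^ 6 \<le> 1" using elim(1) alpha_nonneg[of "real n"] by simp_all
      have m: "real n * norm (trunc_mean b) \<le> \<epsilon> / 4 * a"
      proof -
        have "real n * norm (trunc_mean b) \<le> real n * first_tail b"
          using b by (intro mult_left_mono norm_trunc_mean_le) auto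
        also have "\<dots> \<le> a * (\<epsilon> / 4)"
          using elim(1) a by (intro order_trans[OF _ mult_left_mono[of _ "\<epsilon>/4" a]]) auto
        finally show ?thesis by (simp add: mult.commute)
      qed
      let ?P = "{\<omega> \<in> space M. (\<Lambda> + \<epsilon> / 2) * a < Zc b n \<omega>}"
      let ?Q = "{\<omega> \<in> space M. 3 \<le> card {i\<in>{1..n}. Xs i \<omega> \<in> {x. b < norm x}}}"
      let ?R = "{\<omega> \<in> space M. \<exists>i\<in>{1..n}. Xs i \<omega> \<in> {x. r * a < norm x}}"
      have Xev: "{\<omega> \<in> space M. Xs i \<omega> \<in> {x. c < norm x}} \<in> events" if "i \<in> {1..n}" for i c
        using measurable_sets[OF Xs_meas, of i "{x. c < norm x}"] that by (simp add: vimage_def Int_def conj_commute)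
      have Pev: "?P \<in> events" by measurable
      have Rev: "?R \<in> events" using Xev by (intro sets.sets_Collect_finite_Ex) auto
      have Qev: "?Q \<in> events"
      proof -
        have c: "real (card {i\<in>{1..n}. Xs i \<omega> \<in> {x. b < norm x}}) = (\<Sum>i\<in>{1..n}. indicator {\<omega> \<in> space M. Xs i \<omega> \<in> {x. b < norm x}} \<omega>)" 
          if "\<omega> \<in> space M" for \<omega>
        proof -
          have "real (card {i\<in>{1..n}. Xs i \<omega> \<in> {x. b < norm x}}) = (\<Sum>i\<in>{i\<in>{1..n}. Xs i \<omega> \<in> {x. b < norm x}}. 1)"
            by simp
          also have "\<dots> = (\<Sum>i\<in>{1..n}. if Xs i \<omega> \<in> {x. b < norm x} then 1 else 0)"
            by (rule sum.inter_filter) simp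
          also have "\<dots> = (\<Sum>i\<in>{1..n}. indicator {\<omega> \<in> space M. Xs i \<omega> \<in> {x. b < norm x}} \<omega>)"
            using that by (intro sum.cong) (auto simp: indicator_def)
          finally show ?thesis .
        qed
        have "?Q = {\<omega> \<in> space M. (3::real) \<le> (\<Sum>i\<in>{1..n}. indicator {\<omega> \<in> space M. Xs i \<omega> \<in> {x. b < norm x}} \<omega>)}"
        proof (rule Collect_cong, rule conj_cong[OF refl])
          fix \<omega> assume "\<omega> \<in> space M"
          from c[OF this] show "(3 \<le> card {i\<in>{1..n}. Xs i \<omega> \<in> {x. b < norm x}}) = ((3::real) \<le> (\<Sum>i\<in>{1..n}. indicator {\<omega> \<in> space M. Xs i \<omega> \<in> {x. b < norm x}} \<omega>))"
            by linarith
        qed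
        also have "\<dots> \<in> events"
        proof -
          have [measurable]: "(\<lambda>\<omega>. \<Sum>i\<in>{1..n}. indicator {\<omega> \<in> space M. Xs i \<omega> \<in> {x. b < norm x}} \<omega> :: real) \<in> borel_measurable M"
            using Xev by (intro borel_measurable_sum borel_measurable_indicator) auto
          show ?thesis by measurable
        qed
        finally show ?thesis .
      qed
      have "{\<omega> \<in> space M. (\<Lambda> + \<epsilon>) * a < norm (S n \<omega>)} \<subseteq> ?P \<union> (?Q \<union> ?R)"
      proof (rule subsetI, rule ccontr)
        fix \<omega> assume w: "\<omega> \<in> {\<omega> \<in> space M. (\<Lambda> + \<epsilon>) * a < norm (S n \<omega>)}" "\<omega> \<notin> ?P \<union> (?Q \<union> ?R)"
        have "norm (S n \<omega>) \<le> Zc b n \<omega> + real n * norm (trunc_mean b) + 2 * (r * a)"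
          unfolding S_decomp[where n=n and \<omega>=\<omega> and b=b] Zc_def
        proof (intro order_trans[OF norm_triangle_ineq] add_mono)
          show "norm (\<Sum>i\<in>{1..n}. if b < norm (Xs i \<omega>) then Xs i \<omega> else 0) \<le> 2 * (r * a)"
            using w r a by (intro norm_sum_exceed_le) auto
        qed simp_all
        also have "\<dots> \<le> (\<Lambda> + \<epsilon> / 2) * a + \<epsilon> / 4 * a + \<epsilon> / 4 * a"
        proof (intro add_mono m)
          show "Zc b n \<omega> \<le> (\<Lambda> + \<epsilon> / 2) * a" using w by auto
          show "2 * (r * a) \<le> \<epsilon> / 4 * a" using mult_right_mono[OF r(3), of a] a by simp
        qed
        also have "\<dots> = (\<Lambda> + \<epsilon>) * a" by (simp add: algebra_simps)
        finally show False using w by simp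
      qed
      then have split: "prob {\<omega> \<in> space M. (\<Lambda> + \<epsilon>) * a < norm (S n \<omega>)} \<le> prob ?P + (prob ?Q + prob ?R)"
        using Pev Qev Rev by (rule prob_subset_union3)
      have R: "prob ?R \<le> A / r ^ 4"
      proof -
        have "prob ?R \<le> real n * prob {\<omega> \<in> space M. X \<omega> \<in> {x. r * a < norm x}}"
          by (rule exceedance_union) measurable
        also have "\<dots> \<le> A / r ^ 4" using tail_prob_le_alpha[of "real n" r] n r by simp
        finally show ?thesis .
      qed
      have Q: "prob ?Q \<le> A / \<delta> ^ 12"
      proof -
        have "prob ?Q \<le> (real n * prob {\<omega> \<in> space M. X \<omega> \<in> {x. b < norm x}}) ^ 3"
          by (rule exceedance_count) measurable
        also have "\<dots> \<le> (A * l ^ 4 / \<delta> ^ 4) ^ 3"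
          using elim(1) by (intro power_mono) auto
        \<comment> \<open>As (l^4)^3 = (l^6)^2, the cube leaves one factor A beside the square of A
          l^6 <= 1.\<close>
        also have "\<dots> = A * (A * l ^ 6)\<^sup>2 / \<delta> ^ 12"
          by (simp add: power_divide power_mult_distrib power2_eq_square eval_nat_numeral mult_ac)
        also have "\<dots> \<le> A * 1 / \<delta> ^ 12"
          using A l \<delta> by (intro divide_right_mono mult_left_mono power_le_one) auto
        finally show ?thesis by simp
      qed
      have P: "prob ?P \<le> exp (- (1 + \<rho> / 2) * l)"
      proof -
        \<comment> \<open>The minimizer of u^2 V / 2 - u \<Lambda> a for V = \<Lambda>^2 a^2 / (2
          l); the minimum is - l.\<close>
        define u where "u = 2 / \<Lambda> * l / a"
        have u: "0 < u" using \<Lambda> l a by (simp add: u_def)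
        have ub: "2 * u * b = 4 * \<delta> / \<Lambda>"
        proof -
          have "b = \<delta> * a / l" using lev_def[of \<delta> "real n"] by simp
          then show ?thesis using a l by (simp add: u_def)
        qed
        define E where "E = expectation (Zc b n)"
        have E: "E \<le> \<Lambda> * \<eta> / 2 * a" using elim(2) by (simp add: E_def)
        have HH: "real n * H b \<le> (1 + \<eta>) * \<Lambda>\<^sup>2 * a\<^sup>2 / (2 * l)" using elim(1) by simp
        have "prob ?P \<le> exp ((u * E + exp (2 * u * b) * (n * H b) * u\<^sup>2 / 2) / (1 - \<eta>) - u * ((\<Lambda> + \<epsilon> / 2) * a))"
          unfolding E_def by (rule Zc_tail[OF n b u]) (use expk2 \<eta> in \<open>auto simp: ub\<close>)
        also have "\<dots> \<le> exp (- (1 + \<rho> / 2) * l)"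
        proof (subst exp_le_cancel_iff)
          have 1: "u * E \<le> \<eta> * l"
          proof -
            have "u * E \<le> u * (\<Lambda> * \<eta> / 2 * a)" using E u by (intro mult_left_mono) auto
            also have "\<dots> = \<eta> * l" using \<Lambda> a by (simp add: u_def)
            finally show ?thesis .
          qed
          have 2: "exp (2 * u * b) * (n * H b) * u\<^sup>2 / 2 \<le> (1 + \<eta>) * (1 + \<eta>) * l"
          proof -
            have "exp (2 * u * b) * (n * H b) * u\<^sup>2 / 2 \<le> (1 + \<eta>) * ((1 + \<eta>) * \<Lambda>\<^sup>2 * a\<^sup>2 / (2 * l)) * u\<^sup>2 / 2"
              using expk HH \<eta> H_nonneg[of b] unfolding ub by (intro divide_right_mono mult_right_mono mult_mono) auto
            also have "\<dots> = (1 + \<eta>) * (1 + \<eta>) * l" using \<Lambda> a l by (simp add: u_def field_simps power2_eq_square)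
            finally show ?thesis .
          qed
          have "(u * E + exp (2 * u * b) * (n * H b) * u\<^sup>2 / 2) / (1 - \<eta>) \<le> (\<eta> * l + (1 + \<eta>) * (1 + \<eta>) * l) / (1 - \<eta>)"
            using 1 2 \<eta> by (intro divide_right_mono add_mono) auto
          also have "\<dots> = (1 + 3 * \<eta> + \<eta> * \<eta>) / (1 - \<eta>) * l" by (simp add: algebra_simps)
          also have "\<dots> \<le> (1 + 8 * \<eta>) * l"
          proof (rule mult_right_mono)
            have "\<eta> * \<eta> \<le> \<eta> * (1/16)" using \<eta> by (intro mult_left_mono) auto
            then have "1 + 3 * \<eta> + \<eta> * \<eta> \<le> (1 + 8 * \<eta>) * (1 - \<eta>)" using \<eta> by (simp add: algebra_simps)
            then show "(1 + 3 * \<eta> + \<eta> * \<eta>) / (1 - \<eta>) \<le> 1 + 8 * \<eta>" using \<eta> by (simp add: pos_divide_le_eq)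
          qed (use l in simp)
          finally have 3: "(u * E + exp (2 * u * b) * (n * H b) * u\<^sup>2 / 2) / (1 - \<eta>) \<le> (1 + \<rho> / 2) * l"
            by (simp add: \<eta>_def)
          have "u * ((\<Lambda> + \<epsilon> / 2) * a) = (2 + \<epsilon> / \<Lambda>) * l" using \<Lambda> a by (simp add: u_def field_simps)
          also have "\<dots> \<ge> (2 + \<rho>) * l" using l \<rho> \<Lambda> by (intro mult_right_mono) (auto simp: field_simps)
          finally have 4: "(2 + \<rho>) * l \<le> u * ((\<Lambda> + \<epsilon> / 2) * a)" .
          show "(u * E + exp (2 * u * b) * (n * H b) * u\<^sup>2 / 2) / (1 - \<eta>) - u * ((\<Lambda> + \<epsilon> / 2) * a) \<le> - (1 + \<rho> / 2) * l"
            using 3 4 by (simp add: algebra_simps)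
        qed
        finally show ?thesis .
      qed
      have "exp (- (1 + \<rho> / 2) * l) \<le> exp (- (1 + \<rho> / 2) * LL (real n)) + A"
        using exp_ell_le[of "\<rho> / 2" "real n"] \<rho> A by simp
      then have "prob ?P + (prob ?Q + prob ?R) \<le> exp (- (1 + \<rho> / 2) * LL (real n)) + C * A"
        using P Q R by (simp add: C_def algebra_simps)
      then show ?case using split by simp
    qed
  qed (use \<rho> C in auto)
qed

end

end

section \<open>The upper bound\<close>

context banach_iid
begin

lemma S_split: "j \<le> n \<Longrightarrow> S n \<omega> = S j \<omega> + (\<Sum>i\<in>{Suc j..n}. Xs i \<omega>)"
  using sum.ub_add_nat[of 1 j "\<lambda>i. Xs i \<omega>" "n - j"] by simp

lemma partial_sum_event:
  assumes "\<And>i. i \<in> I \<Longrightarrow> K i \<subseteq> J" "finite I"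
  shows "{x \<in> space (PiM J (\<lambda>_. borel)). \<forall>i\<in>I. norm (\<Sum>k\<in>K i. x k :: 'b) \<le> c} \<in> sets (PiM J (\<lambda>_. borel))"
proof (rule sets.sets_Collect_finite_All[OF _ assms(2)])
  fix i assume i: "i \<in> I"
  have [measurable]: "(\<lambda>x. \<Sum>k\<in>K i. x k :: 'b) \<in> borel_measurable (PiM J (\<lambda>_. borel))"
    using assms(1)[OF i] by (intro borel_measurable_sum measurable_component_singleton) auto
  show "{x \<in> space (PiM J (\<lambda>_. borel)). norm (\<Sum>k\<in>K i. x k :: 'b) \<le> c} \<in> sets (PiM J (\<lambda>_. borel))"
    by measurable
qed

text \<open>Split by the first index j whose partial sum exceeds t + s. This event is independent of
  the later increment being at most s, which has probability at least 1/2, and the two together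
  force the final norm above t.\<close>

lemma ottaviani:
  assumes s: "0 \<le> s" and hyp: "\<And>j. j \<le> n \<Longrightarrow> prob {\<omega> \<in> space M. s < norm (S n \<omega> - S j \<omega>)} \<le> 1/2"
  shows "prob {\<omega> \<in> space M. \<exists>j\<in>{1..n}. t + s < norm (S j \<omega>)} \<le> 2 * prob {\<omega> \<in> space M. t < norm (S n \<omega>)}"
proof -
  define A where "A = (\<lambda>j. {\<omega> \<in> space M. t + s < norm (S j \<omega>) \<and> (\<forall>i\<in>{1..<j}. norm (S i \<omega>) \<le> t + s)})"
  define C where "C = (\<lambda>j. {\<omega> \<in> space M. norm (\<Sum>i\<in>{Suc j..n}. Xs i \<omega>) \<le> s})"
  have indep: "prob (A j \<inter> C j) = prob (A j) * prob (C j)" and ev: "A j \<in> events" "C j \<in> events" if j: "j \<in> {1..n}" for j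
  proof -
    let ?PA = "PiM {1..j} (\<lambda>_. borel :: 'b measure)" and ?PC = "PiM {Suc j..n} (\<lambda>_. borel :: 'b measure)"
    let ?fA = "\<lambda>\<omega>. restrict (\<lambda>i. Xs i \<omega>) {1..j}" and ?fC = "\<lambda>\<omega>. restrict (\<lambda>i. Xs i \<omega>) {Suc j..n}"
    have iv: "indep_var ?PA ?fA ?PC ?fC" by (rule indep_var_restrict[OF Xs_indep]) auto
    define XA where "XA = {x \<in> space ?PA. t + s < norm (\<Sum>i\<in>{1..j}. x i)} \<inter> {x \<in> space ?PA. \<forall>i\<in>{1..<j}. norm (\<Sum>k\<in>{1..i}. x k) \<le> t + s}"
    define XC where "XC = {x \<in> space ?PC. norm (\<Sum>i\<in>{Suc j..n}. x i) \<le> s}"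
    have XA: "XA \<in> sets ?PA" unfolding XA_def
    proof (rule sets.Int)
      have [measurable]: "(\<lambda>x. \<Sum>k\<in>{1..j}. x k :: 'b) \<in> borel_measurable ?PA"
        by (intro borel_measurable_sum measurable_component_singleton)
      show "{x \<in> space ?PA. t + s < norm (\<Sum>i\<in>{1..j}. x i)} \<in> sets ?PA" by measurable
    qed (rule partial_sum_event, auto)
    have XC: "XC \<in> sets ?PC"
      using partial_sum_event[of "{()}" "\<lambda>_. {Suc j..n}" "{Suc j..n}" s] by (simp add: XC_def)
    have fA: "?fA \<omega> \<in> space ?PA" and fC: "?fC \<omega> \<in> space ?PC" for \<omega> by (auto simp: space_PiM)
    have sA: "(\<Sum>k\<in>{1..i}. ?fA \<omega> k) = S i \<omega>" if "i \<le> j" for i \<omega>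
      using that by (intro sum.cong) auto
    have sC: "(\<Sum>k\<in>{Suc j..n}. ?fC \<omega> k) = (\<Sum>k\<in>{Suc j..n}. Xs k \<omega>)" for \<omega>
      by (intro sum.cong) auto
    have Aeq: "?fA -` XA \<inter> space M = A j"
    proof (rule set_eqI)
      fix \<omega>
      have "\<omega> \<in> ?fA -` XA \<inter> space M \<longleftrightarrow> t + s < norm (\<Sum>i\<in>{1..j}. ?fA \<omega> i) \<and> (\<forall>i\<in>{1..<j}. norm (\<Sum>k\<in>{1..i}. ?fA \<omega> k) \<le> t + s) \<and> \<omega> \<in> space M"
        unfolding XA_def using fA[of \<omega>] by blast
      also have "\<dots> \<longleftrightarrow> t + s < norm (S j \<omega>) \<and> (\<forall>i\<in>{1..<j}. norm (S i \<omega>) \<le> t + s) \<and> \<omega> \<in> space M"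
        using sA[of j \<omega>] sA[of _ \<omega>] by (simp only: order_refl) (metis atLeastLessThan_iff less_imp_le)
      finally show "\<omega> \<in> ?fA -` XA \<inter> space M \<longleftrightarrow> \<omega> \<in> A j" unfolding A_def by blast
    qed
    have Ceq: "?fC -` XC \<inter> space M = C j"
      unfolding XC_def C_def using fC sC by auto
    show "prob (A j \<inter> C j) = prob (A j) * prob (C j)"
    proof -
      have "(\<lambda>x. (?fA x, ?fC x)) -` (XA \<times> XC) \<inter> space M = (?fA -` XA \<inter> space M) \<inter> (?fC -` XC \<inter> space M)" by blast
      then show ?thesis using indep_varD[OF iv XA XC] unfolding Aeq Ceq by simp
    qed
    show "A j \<in> events" "C j \<in> events"
      unfolding Aeq[symmetric] Ceq[symmetric]
      by (rule measurable_sets[OF indep_var_rv1[OF iv] XA], rule measurable_sets[OF indep_var_rv2[OF iv] XC])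
  qed
  have PC: "1/2 \<le> prob (C j)" if j: "j \<in> {1..n}" for j
  proof -
    have "prob (space M - C j) = 1 - prob (C j)" by (rule prob_compl[OF ev(2)[OF j]])
    moreover have "space M - C j = {\<omega> \<in> space M. s < norm (S n \<omega> - S j \<omega>)}"
      using j S_split[of j n] by (auto simp: C_def not_le)
    ultimately show ?thesis using hyp[of j] j by simp
  qed
  have disj: "disjoint_family_on A {1..n}"
    unfolding disjoint_family_on_def
  proof (intro ballI impI)
    have "A i \<inter> A j = {}" if "i \<in> {1..n}" "i < j" for i j
    proof (rule ccontr)
      assume "A i \<inter> A j \<noteq> {}"
      then obtain \<omega> where w: "\<omega> \<in> A i" "\<omega> \<in> A j" by blast
      have "i \<in> {1..<j}" using that by simp
      then have "norm (S i \<omega>) \<le> t + s" using w(2) unfolding A_def by blast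
      then show False using w(1) unfolding A_def by simp
    qed
    then show "A i \<inter> A j = {}" if "i \<in> {1..n}" "j \<in> {1..n}" "i \<noteq> j" for i j
      using that by (metis Int_commute linorder_neqE_nat)
  qed
  have un: "{\<omega> \<in> space M. \<exists>j\<in>{1..n}. t + s < norm (S j \<omega>)} \<subseteq> (\<Union>j\<in>{1..n}. A j)"
  proof
    fix \<omega> assume "\<omega> \<in> {\<omega> \<in> space M. \<exists>j\<in>{1..n}. t + s < norm (S j \<omega>)}"
    then have w: "\<omega> \<in> space M" "\<exists>j. j \<in> {1..n} \<and> t + s < norm (S j \<omega>)" by auto
    define j where "j = (LEAST j. j \<in> {1..n} \<and> t + s < norm (S j \<omega>))"
    have j: "j \<in> {1..n}" "t + s < norm (S j \<omega>)" using LeastI_ex[OF w(2)] unfolding j_def by blast+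
    have "norm (S i \<omega>) \<le> t + s" if "i \<in> {1..<j}" for i
      using not_less_Least[of i "\<lambda>j. j \<in> {1..n} \<and> t + s < norm (S j \<omega>)"] that j(1) unfolding j_def[symmetric] by force
    then have "\<omega> \<in> A j" using w j by (simp add: A_def)
    then show "\<omega> \<in> (\<Union>j\<in>{1..n}. A j)" using j(1) by blast
  qed
  have UnE: "(\<Union>j\<in>{1..n}. A j) \<in> events" using ev by (intro sets.finite_UN) auto
  have "prob {\<omega> \<in> space M. \<exists>j\<in>{1..n}. t + s < norm (S j \<omega>)} \<le> prob (\<Union>j\<in>{1..n}. A j)"
    by (rule finite_measure_mono[OF un UnE])
  also have "\<dots> = (\<Sum>j\<in>{1..n}. prob (A j))"
    using ev by (intro finite_measure_finite_Union disj) auto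
  also have "\<dots> \<le> (\<Sum>j\<in>{1..n}. 2 * prob (A j \<inter> C j))"
  proof (rule sum_mono)
    fix j assume j: "j \<in> {1..n}"
    have "prob (A j) * (1/2) \<le> prob (A j) * prob (C j)" by (rule mult_left_mono[OF PC[OF j]]) simp
    then show "prob (A j) \<le> 2 * prob (A j \<inter> C j)" using indep[OF j] by simp
  qed
  also have "\<dots> = 2 * (\<Sum>j\<in>{1..n}. prob (A j \<inter> C j))" by (simp add: sum_distrib_left)
  also have "(\<Sum>j\<in>{1..n}. prob (A j \<inter> C j)) = prob (\<Union>j\<in>{1..n}. A j \<inter> C j)"
  proof (rule finite_measure_finite_Union[symmetric])
    show "disjoint_family_on (\<lambda>j. A j \<inter> C j) {1..n}"
      unfolding disjoint_family_on_def
    proof (intro ballI impI)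
      fix i j assume ij: "i \<in> {1..n}" "j \<in> {1..n}" "i \<noteq> j"
      then have "A i \<inter> A j = {}" by (rule disjoint_family_onD[OF disj])
      then show "(A i \<inter> C i) \<inter> (A j \<inter> C j) = {}" by blast
    qed
  qed (use ev in auto)
  also have "\<dots> \<le> prob {\<omega> \<in> space M. t < norm (S n \<omega>)}"
  proof (rule finite_measure_mono)
    show "(\<Union>j\<in>{1..n}. A j \<inter> C j) \<subseteq> {\<omega> \<in> space M. t < norm (S n \<omega>)}"
    proof
      fix \<omega> assume "\<omega> \<in> (\<Union>j\<in>{1..n}. A j \<inter> C j)"
      then obtain j where j: "j \<in> {1..n}" "\<omega> \<in> A j" "\<omega> \<in> C j" by blast
      have "norm (S j \<omega>) \<le> norm (S n \<omega>) + norm (\<Sum>i\<in>{Suc j..n}. Xs i \<omega>)"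
        using S_split[of j n \<omega>] j(1) norm_triangle_ineq4[of "S n \<omega>" "\<Sum>i\<in>{Suc j..n}. Xs i \<omega>"] by simp
      then show "\<omega> \<in> {\<omega> \<in> space M. t < norm (S n \<omega>)}" using j by (simp add: A_def C_def)
    qed
    show "{\<omega> \<in> space M. t < norm (S n \<omega>)} \<in> events" by measurable
  qed
  finally show ?thesis by simp
qed

lemma expectation_norm_S_le: "expectation (\<lambda>\<omega>. norm (S j \<omega>)) \<le> j * expectation (\<lambda>\<omega>. norm (X \<omega>))"
  and integrable_norm_S: "integrable M (\<lambda>\<omega>. norm (S j \<omega>))"
proof -
  have i: "integrable M (\<lambda>\<omega>. norm (Xs i \<omega>))" if "i \<in> {1..j}" for i
  proof -
    have i: "1 \<le> i" using that by simp
    have "integrable (distr M borel X) norm" using integrable_norm[OF X_int] by (subst integrable_distr_eq) auto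
    then have "integrable (distr M borel (Xs i)) norm" using Xs_distr[OF i] by simp
    then show ?thesis using Xs_meas[OF i] by (subst (asm) integrable_distr_eq) auto
  qed
  show int: "integrable M (\<lambda>\<omega>. norm (S j \<omega>))"
  proof (rule Bochner_Integration.integrable_bound)
    show "integrable M (\<lambda>\<omega>. \<Sum>i\<in>{1..j}. norm (Xs i \<omega>))" by (rule Bochner_Integration.integrable_sum[OF i])
    show "(\<lambda>\<omega>. norm (S j \<omega>)) \<in> borel_measurable M" by measurable
    show "AE \<omega> in M. norm (norm (S j \<omega>)) \<le> norm (\<Sum>i\<in>{1..j}. norm (Xs i \<omega>))"
      by (intro AE_I2) (simp add: sum_nonneg order_trans[OF norm_sum])
  qed
  have "expectation (\<lambda>\<omega>. norm (S j \<omega>)) \<le> expectation (\<lambda>\<omega>. \<Sum>i\<in>{1..j}. norm (Xs i \<omega>))"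
    by (intro integral_mono int Bochner_Integration.integrable_sum i norm_sum)
  also have "\<dots> = (\<Sum>i\<in>{1..j}. expectation (\<lambda>\<omega>. norm (Xs i \<omega>)))"
    by (rule Bochner_Integration.integral_sum[OF i])
  also have "\<dots> = (\<Sum>i\<in>{1..j}. expectation (\<lambda>\<omega>. norm (X \<omega>)))"
    by (intro sum.cong refl expectation_Xs) auto
  also have "\<dots> = j * expectation (\<lambda>\<omega>. norm (X \<omega>))" by simp
  finally show "expectation (\<lambda>\<omega>. norm (S j \<omega>)) \<le> j * expectation (\<lambda>\<omega>. norm (X \<omega>))" .
qed

lemma markov_norm_S:
  assumes "0 < c"
  shows "prob {\<omega> \<in> space M. c < norm (S j \<omega>)} \<le> j * expectation (\<lambda>\<omega>. norm (X \<omega>)) / c"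
proof -
  let ?A = "{\<omega> \<in> space M. c < norm (S j \<omega>)}"
  have A: "?A \<in> events" by measurable
  have "c * prob ?A = expectation (\<lambda>\<omega>. c * indicator ?A \<omega>)" using A by simp
  also have "\<dots> \<le> expectation (\<lambda>\<omega>. norm (S j \<omega>))"
  proof (rule integral_mono[OF _ integrable_norm_S])
    show "integrable M (\<lambda>\<omega>. c * indicator ?A \<omega>)"
      using A by (intro integrable_mult_right integrable_real_indicator) (auto simp: emeasure_eq_measure)
  qed (simp add: indicator_def)
  also have "\<dots> \<le> j * expectation (\<lambda>\<omega>. norm (X \<omega>))" by (rule expectation_norm_S_le)
  finally show ?thesis using assms by (simp add: le_divide_eq mult.commute)
qed

end

context banach_iid_wlln
begin

text \<open>The hypothesis of Ottaviani's inequality, uniformly in j. Beyond a fixed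
  \<open>j0\<close> convergence in probability applies to S_j, since \<Psi> j <= \<Psi> n; for the
  finitely many smaller j, Markov's inequality suffices because \<Psi> n tends to infinity.\<close>

lemma eventually_increment_small:
  assumes \<epsilon>: "0 < \<epsilon>"
  shows "eventually (\<lambda>n. \<forall>j\<le>n. prob {\<omega> \<in> space M. \<epsilon> * \<Psi> (real n) < norm (S n \<omega> - S j \<omega>)} \<le> 1/2) sequentially"
proof -
  have e2: "0 < \<epsilon> / 2" using \<epsilon> by simp
  have q: "(0::real) < 1/4" by simp
  obtain j0 where j0: "\<And>n. j0 \<le> n \<Longrightarrow> prob {\<omega> \<in> space M. \<epsilon> / 2 * \<Psi> (real n) < norm (S n \<omega>)} < 1/4"
    using wlln'[OF e2 q] by (auto simp: eventually_sequentially)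
  define m where "m = expectation (\<lambda>\<omega>. norm (X \<omega>))"
  have m: "0 \<le> m" unfolding m_def by (intro integral_nonneg_AE AE_I2) simp
  have "eventually (\<lambda>t. 8 * j0 * m / \<epsilon> \<le> \<Psi> t) at_top" using Psi_at_top by (simp add: filterlim_at_top)
  from eventually_compose_filterlim[OF this filterlim_real_sequentially] eventually_ge_at_top[of "max 1 j0"]
  show ?thesis
  proof eventually_elim
    case (elim n)
    show ?case
    proof (intro allI impI)
      fix j assume j: "j \<le> n"
      have a: "0 < \<Psi> (real n)" using elim by (intro Psi_pos) auto
      have "prob {\<omega> \<in> space M. \<epsilon> * \<Psi> (real n) < norm (S n \<omega> - S j \<omega>)}
        \<le> prob {\<omega> \<in> space M. \<epsilon> / 2 * \<Psi> (real n) < norm (S n \<omega>)} + prob {\<omega> \<in> space M. \<epsilon> / 2 * \<Psi> (real n) < norm (S j \<omega>)}"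
      proof (rule prob_subset_union)
        show "{\<omega> \<in> space M. \<epsilon> * \<Psi> (real n) < norm (S n \<omega> - S j \<omega>)}
          \<subseteq> {\<omega> \<in> space M. \<epsilon> / 2 * \<Psi> (real n) < norm (S n \<omega>)} \<union> {\<omega> \<in> space M. \<epsilon> / 2 * \<Psi> (real n) < norm (S j \<omega>)}"
        proof (rule subsetI, rule ccontr)
          fix \<omega> assume w: "\<omega> \<in> {\<omega> \<in> space M. \<epsilon> * \<Psi> (real n) < norm (S n \<omega> - S j \<omega>)}"
            "\<omega> \<notin> {\<omega> \<in> space M. \<epsilon> / 2 * \<Psi> (real n) < norm (S n \<omega>)} \<union> {\<omega> \<in> space M. \<epsilon> / 2 * \<Psi> (real n) < norm (S j \<omega>)}"
          then have "norm (S n \<omega>) \<le> \<epsilon> / 2 * \<Psi> (real n)" "norm (S j \<omega>) \<le> \<epsilon> / 2 * \<Psi> (real n)" by auto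
          then have "norm (S n \<omega> - S j \<omega>) \<le> \<epsilon> * \<Psi> (real n)"
            using norm_triangle_ineq4[of "S n \<omega>" "S j \<omega>"] by linarith
          then show False using w by auto
        qed
      qed measurable
      moreover have "prob {\<omega> \<in> space M. \<epsilon> / 2 * \<Psi> (real n) < norm (S n \<omega>)} \<le> 1/4"
        using j0[of n] elim by simp
      moreover have "prob {\<omega> \<in> space M. \<epsilon> / 2 * \<Psi> (real n) < norm (S j \<omega>)} \<le> 1/4"
      proof (cases "j0 \<le> j")
        case True
        have "prob {\<omega> \<in> space M. \<epsilon> / 2 * \<Psi> (real n) < norm (S j \<omega>)} \<le> prob {\<omega> \<in> space M. \<epsilon> / 2 * \<Psi> (real j) < norm (S j \<omega>)}"
        proof (rule finite_measure_mono)
          have "\<epsilon> / 2 * \<Psi> (real j) \<le> \<epsilon> / 2 * \<Psi> (real n)" using j \<epsilon> by (intro mult_left_mono Psi_mono) auto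
          then show "{\<omega> \<in> space M. \<epsilon> / 2 * \<Psi> (real n) < norm (S j \<omega>)} \<subseteq> {\<omega> \<in> space M. \<epsilon> / 2 * \<Psi> (real j) < norm (S j \<omega>)}"
            by (intro Collect_mono) linarith
        qed measurable
        then show ?thesis using j0[OF True] by linarith
      next
        case False
        have "prob {\<omega> \<in> space M. \<epsilon> / 2 * \<Psi> (real n) < norm (S j \<omega>)} \<le> j * m / (\<epsilon> / 2 * \<Psi> (real n))"
          unfolding m_def using \<epsilon> a by (intro markov_norm_S) simp
        also have "\<dots> \<le> j0 * m / (\<epsilon> / 2 * \<Psi> (real n))"
          using False m \<epsilon> a by (intro divide_right_mono mult_right_mono) auto
        also have "\<dots> \<le> 1/4" using elim(1) \<epsilon> a by (simp add: field_simps)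
        finally show ?thesis .
      qed
      ultimately show "prob {\<omega> \<in> space M. \<epsilon> * \<Psi> (real n) < norm (S n \<omega> - S j \<omega>)} \<le> 1/2" by linarith
    qed
  qed
qed

lemma nat_ceiling_power_bounds:
  assumes "1 < (c::real)"
  shows "1 * c ^ k \<le> real (nat \<lceil>c ^ k\<rceil>)" "real (nat \<lceil>c ^ k\<rceil>) \<le> 2 * (1 * c ^ k)" "real (nat \<lceil>c ^ k\<rceil>) \<le> c ^ k + 1"
proof -
  have 1: "1 \<le> c ^ k" using assms by (simp add: one_le_power)
  then have "real (nat \<lceil>c ^ k\<rceil>) = of_int \<lceil>c ^ k\<rceil>" by (simp add: of_nat_nat)
  then show "1 * c ^ k \<le> real (nat \<lceil>c ^ k\<rceil>)" "real (nat \<lceil>c ^ k\<rceil>) \<le> c ^ k + 1"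
    using ceiling_correct[of "c ^ k"] by linarith+
  then show "real (nat \<lceil>c ^ k\<rceil>) \<le> 2 * (1 * c ^ k)" using 1 by linarith
qed

theorem upper_bound_AE:
  assumes \<Lambda>: "0 < \<Lambda>" "\<Lambda> < \<Lambda>'"
    and H_lim: "eventually (\<lambda>x. 2 * \<Psi>i (x * LL x) / (x\<^sup>2 * LL x) * H x \<le> \<Lambda>\<^sup>2) at_top"
  shows "AE \<omega> in M. eventually (\<lambda>n. norm (S n \<omega>) \<le> \<Lambda>' * \<Psi> (real n)) sequentially"
proof -
  define \<epsilon> where "\<epsilon> = (\<Lambda>' - \<Lambda>) / 4"
  have \<epsilon>: "0 < \<epsilon>" using \<Lambda> by (simp add: \<epsilon>_def)
  define T where "T = \<Lambda> + \<epsilon> + \<epsilon>"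
  have "T = \<Lambda> / 2 + \<Lambda>' / 2" by (simp add: T_def \<epsilon>_def field_simps)
  then have T: "0 < T" "T < \<Lambda>'" using \<Lambda> by linarith+
  \<comment> \<open>The gap between T and \<Lambda>' pays for interpolation between consecutive
    times: \<Psi> grows by at most c^2 when its argument grows by c^2.\<close>
  define c where "c = sqrt (\<Lambda>' / T)"
  have c: "1 < c" "T * c\<^sup>2 = \<Lambda>'" using T by (auto simp: c_def)
  \<comment> \<open>A ratio strictly below c leaves room for rounding the powers up to
    integers.\<close>
  define c' where "c' = (1 + c) / 2"
  have c': "1 < c'" "c' < c" using c by (auto simp: c'_def)
  obtain \<eta> C where \<eta>: "0 < \<eta>" and C: "0 < C" and tail: "eventually (\<lambda>n. prob {\<omega> \<in> space M. (\<Lambda> + \<epsilon>) * \<Psi> (real n) < norm (S n \<omega>)} 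
      \<le> exp (- (1 + \<eta>) * LL (real n)) + C * \<alpha> (real n)) sequentially"
    using tail_of_norm_sum[OF \<Lambda>(1) H_lim \<epsilon>] by blast
  define N where "N = (\<lambda>k. nat \<lceil>c' ^ k\<rceil>)"
  have N: "1 * c' ^ k \<le> real (N k)" "real (N k) \<le> 2 * (1 * c' ^ k)" "real (N k) \<le> c' ^ k + 1" for k
    unfolding N_def by (rule nat_ceiling_power_bounds[OF c'(1)])+
  have pow_lim: "filterlim (\<lambda>k. c' ^ k) at_top sequentially"
    by (rule filterlim_at_infinity_imp_filterlim_at_top[OF filterlim_realpow_sequentially_gt1])
      (use c' in \<open>auto intro: always_eventually\<close>)
  have "filterlim (\<lambda>k. real (N k)) at_top sequentially"
    by (rule filterlim_at_top_mono[OF pow_lim]) (use N(1) in \<open>auto intro: always_eventually\<close>)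
  then have N_lim: "filterlim N sequentially sequentially"
    by (simp add: filterlim_sequentially_iff_filterlim_real)
  define A where "A = (\<lambda>k. {\<omega> \<in> space M. \<exists>j\<in>{1..N k}. T * \<Psi> (real (N k)) < norm (S j \<omega>)})"
  have Aev: "A k \<in> events" for k
    unfolding A_def by (intro sets.sets_Collect_finite_Ex) measurable
  have PA: "eventually (\<lambda>k. prob (A k) \<le> 2 * (exp (- (1 + \<eta>) * LL (real (N k))) + C * \<alpha> (real (N k)))) sequentially"
  proof -
    have "eventually (\<lambda>n. prob {\<omega> \<in> space M. \<exists>j\<in>{1..n}. T * \<Psi> (real n) < norm (S j \<omega>)} 
        \<le> 2 * (exp (- (1 + \<eta>) * LL (real n)) + C * \<alpha> (real n))) sequentially"
      using tail eventually_increment_small[OF \<epsilon>]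
    proof eventually_elim
      case (elim n)
      have "prob {\<omega> \<in> space M. \<exists>j\<in>{1..n}. (\<Lambda> + \<epsilon>) * \<Psi> (real n) + \<epsilon> * \<Psi> (real n) < norm (S j \<omega>)}
        \<le> 2 * prob {\<omega> \<in> space M. (\<Lambda> + \<epsilon>) * \<Psi> (real n) < norm (S n \<omega>)}"
        by (rule ottaviani) (use elim(2) \<epsilon> Psi_nonneg in auto)
      also have "(\<Lambda> + \<epsilon>) * \<Psi> (real n) + \<epsilon> * \<Psi> (real n) = T * \<Psi> (real n)" by (simp add: T_def algebra_simps)
      also have "2 * prob {\<omega> \<in> space M. (\<Lambda> + \<epsilon>) * \<Psi> (real n) < norm (S n \<omega>)} \<le> 2 * (exp (- (1 + \<eta>) * LL (real n)) + C * \<alpha> (real n))"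
        using elim(1) by simp
      finally show ?case .
    qed
    from eventually_compose_filterlim[OF this N_lim] show ?thesis by (simp add: A_def)
  qed
  have sumA: "summable (\<lambda>k. \<alpha> (real (N k)))"
  proof (rule bounded_imp_summable)
    show "0 \<le> \<alpha> (real (N k))" for k by (simp add: alpha_nonneg)
    show "(\<Sum>k\<le>n. \<alpha> (real (N k))) \<le> 4 * (1 + c') / (c' - 1) * expectation (\<lambda>\<omega>. \<Psi>i (norm (X \<omega>)))" for n
      using sum_alpha_le[OF c'(1) zero_less_one N(1,2), of "Suc n"] by (simp add: lessThan_Suc_atMost)
  qed
  \<comment> \<open>LL (N k) is eventually at least ln (k ln c'), so the terms are O(k^(-(1 +
    \<eta>))).\<close>
  have sumE: "summable (\<lambda>k. exp (- (1 + \<eta>) * LL (real (N k))))"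
  proof (rule summable_comparison_test_ev)
    define K where "K = ln c' powr (- (1 + \<eta>))"
    show "summable (\<lambda>k. K * real k powr (- (1 + \<eta>)))"
      using \<eta> by (intro summable_mult) (simp add: summable_real_powr_iff)
    have "eventually (\<lambda>k. exp (exp 1) \<le> c' ^ k) sequentially" using pow_lim by (simp add: filterlim_at_top)
    then show "eventually (\<lambda>k. norm (exp (- (1 + \<eta>) * LL (real (N k)))) \<le> K * real k powr (- (1 + \<eta>))) sequentially"
      using eventually_ge_at_top[of 1]
    proof eventually_elim
      case (elim k)
      have lc: "0 < ln c'" using c' by simp
      have "ln (ln (c' ^ k)) = LL (c' ^ k)" using elim by (simp add: LL_eq)
      also have "\<dots> \<le> LL (real (N k))" using N(1)[of k] by (intro LL_mono) simp
      finally have "ln (k * ln c') \<le> LL (real (N k))" using c' by (simp add: ln_realpow)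
      then have "(1 + \<eta>) * ln (k * ln c') \<le> (1 + \<eta>) * LL (real (N k))" using \<eta> by (intro mult_left_mono) auto
      then have "exp (- (1 + \<eta>) * LL (real (N k))) \<le> exp (- (1 + \<eta>) * ln (k * ln c'))" by (simp add: algebra_simps)
      also have "\<dots> = (k * ln c') powr (- (1 + \<eta>))" using elim lc by (simp add: powr_def)
      also have "\<dots> = K * real k powr (- (1 + \<eta>))" using lc by (simp add: K_def powr_mult)
      finally show ?case by simp
    qed
  qed
  have "summable (\<lambda>k. prob (A k))"
  proof (rule summable_comparison_test_ev)
    show "eventually (\<lambda>k. norm (prob (A k)) \<le> 2 * (exp (- (1 + \<eta>) * LL (real (N k))) + C * \<alpha> (real (N k)))) sequentially"
      using PA by simp
    show "summable (\<lambda>k. 2 * (exp (- (1 + \<eta>) * LL (real (N k))) + C * \<alpha> (real (N k))))"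
      by (intro summable_mult summable_add sumE sumA)
  qed
  then have bc: "AE \<omega> in M. eventually (\<lambda>k. \<omega> \<in> space M - A k) sequentially"
    by (intro borel_cantelli_AE1 Aev) (auto simp: emeasure_eq_measure)
  \<comment> \<open>By slow variation h (c^2 t) <= c^2 h t eventually, whence \<Psi> (c^2 t)^2 <=
    c^4 \<Psi> (t)^2.\<close>
  have ratio: "eventually (\<lambda>t. \<Psi> (c\<^sup>2 * t) \<le> c\<^sup>2 * \<Psi> t) at_top"
  proof -
    have "eventually (\<lambda>t. h (c\<^sup>2 * t) / h t < c\<^sup>2) at_top"
      using h_slow[of "c\<^sup>2"] c by (intro order_tendstoD(2)) (auto simp: one_less_power)
    then show ?thesis using eventually_gt_at_top[of 0]
    proof eventually_elim
      case (elim t)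
      have "h (c\<^sup>2 * t) \<le> c\<^sup>2 * h t" using elim h_pos[of t] by (simp add: pos_divide_less_eq)
      then have "(c\<^sup>2 * t) * h (c\<^sup>2 * t) \<le> (c\<^sup>2 * t) * (c\<^sup>2 * h t)" using elim c by (intro mult_left_mono) auto
      also have "\<dots> = (c\<^sup>2)\<^sup>2 * (t * h t)" by (simp add: power2_eq_square)
      finally have "sqrt ((c\<^sup>2 * t) * h (c\<^sup>2 * t)) \<le> sqrt ((c\<^sup>2)\<^sup>2 * (t * h t))" by (rule real_sqrt_le_mono)
      also have "\<dots> = c\<^sup>2 * sqrt (t * h t)" by (subst real_sqrt_mult) (simp only: real_sqrt_abs abs_power2)
      finally show ?case unfolding Psi_def .
    qed
  qed
  obtain n1 where n1: "\<And>n. n1 \<le> n \<Longrightarrow> \<Psi> (c\<^sup>2 * real n) \<le> c\<^sup>2 * \<Psi> (real n)"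
    using eventually_compose_filterlim[OF ratio filterlim_real_sequentially] by (auto simp: eventually_sequentially)
  have "eventually (\<lambda>k. 1 / (c'  * (c - c')) \<le> c' ^ k) sequentially" using pow_lim by (simp add: filterlim_at_top)
  then obtain k1 where k1: "\<And>k. k1 \<le> k \<Longrightarrow> 1 / (c' * (c - c')) \<le> c' ^ k" by (auto simp: eventually_sequentially)
  show ?thesis
    using bc
  proof (eventually_elim)
    case (elim \<omega>)
    then obtain k0 where k0: "\<And>k. k0 \<le> k \<Longrightarrow> \<omega> \<in> space M - A k" by (auto simp: eventually_sequentially)
    define k2 where "k2 = max k0 k1"
    have "eventually (\<lambda>n. max n1 (max 1 (N k2)) < n) sequentially" by (rule eventually_gt_at_top)
    then show ?case
    proof eventually_elim
      case (elim n)
      have ex: "\<exists>k. n \<le> N k" using N_lim by (metis eventually_ge_at_top eventually_happens' filterlim_iff sequentially_bot)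
      define k where "k = (LEAST k. n \<le> N k)"
      have nk: "n \<le> N k" unfolding k_def by (rule LeastI_ex[OF ex])
      have mono: "N i \<le> N j" if "i \<le> j" for i j
        unfolding N_def using c' that by (intro nat_mono ceiling_mono power_increasing) auto
      have "k2 < k"
      proof (rule ccontr)
        assume "\<not> k2 < k"
        then have "N k \<le> N k2" by (intro mono) simp
        then show False using nk elim by simp
      qed
      then obtain i where i: "k = Suc i" "k2 \<le> i" by (metis Suc_diff_1 gr_implies_not0 less_Suc_eq_le not_gr_zero)
      have "N i < n" using not_less_Least[of i "\<lambda>k. n \<le> N k"] i unfolding k_def[symmetric] by simp
      then have ni: "c' ^ i \<le> real n" using N(1)[of i] by simp
      have "real (N k) \<le> c' ^ k + 1" by (rule N(3))
      also have "\<dots> \<le> c' * c * c' ^ i"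
      proof -
        have "1 \<le> c' * (c - c') * c' ^ i" using k1[of i] i c' by (simp add: k2_def field_simps)
        moreover have "1 * (c' * c' ^ i) \<le> c' * (c' * c' ^ i)" using c' by (intro mult_right_mono) auto
        ultimately show ?thesis by (simp add: i algebra_simps)
      qed
      also have "\<dots> \<le> c\<^sup>2 * real n"
        using ni c c' by (intro mult_mono) (auto simp: power2_eq_square)
      finally have Nk: "real (N k) \<le> c\<^sup>2 * real n" .
      have "norm (S n \<omega>) \<le> T * \<Psi> (real (N k))"
      proof -
        have "\<omega> \<in> space M - A k" using i by (intro k0) (simp add: k2_def)
        then have "\<forall>j\<in>{1..N k}. norm (S j \<omega>) \<le> T * \<Psi> (real (N k))" unfolding A_def by (auto simp: not_less)
        then show ?thesis using nk elim by auto
      qed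
      also have "\<dots> \<le> T * \<Psi> (c\<^sup>2 * real n)" using T Nk by (intro mult_left_mono Psi_mono) auto
      also have "\<dots> \<le> T * (c\<^sup>2 * \<Psi> (real n))" using T n1[of n] elim by (intro mult_left_mono) auto
      also have "\<dots> = \<Lambda>' * \<Psi> (real n)" using c by (simp flip: mult.assoc)
      finally show ?case .
    qed
  qed
qed

end

section \<open>Lower exponential bounds\<close>

text \<open>Kolmogorov's lower exponential bound by tilting: most of \<open>E exp (u T)\<close> sits near \<open>T = u v\<close>.\<close>

lemma (in prob_space) laplace_lower_bound:
  fixes T :: "'a \<Rightarrow> real" and u v \<eta> :: real
  assumes T [measurable]: "T \<in> borel_measurable M" and G [measurable]: "G \<in> events"
    and u: "0 < u" and v: "0 < v" and \<eta>: "0 < \<eta>" "\<eta> \<le> 1"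
    and int: "\<And>s. integrable M (\<lambda>\<omega>. exp (s * T \<omega>) * indicator G \<omega>)"
    and R: "R = u\<^sup>2 * v" "4 * ln 4 \<le> \<eta>\<^sup>2 * R"
    and low: "exp (R / 2 - \<eta>\<^sup>2 * R / 8) \<le> expectation (\<lambda>\<omega>. exp (u * T \<omega>) * indicator G \<omega>)"
    and up: "\<And>s. s = (1 - \<eta>) * u \<or> s = (1 + \<eta>) * u \<Longrightarrow>
      expectation (\<lambda>\<omega>. exp (s * T \<omega>) * indicator G \<omega>) \<le> exp (s\<^sup>2 * v / 2 + \<eta>\<^sup>2 * R / 8)"
  shows "exp (- (1 + 3 * \<eta>) * R / 2) / 2 \<le> prob {\<omega> \<in> space M. (1 - \<eta>) * u * v \<le> T \<omega>}"
proof -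
  define t1 where "t1 = (1 - \<eta>) * u * v"
  define t2 where "t2 = (1 + \<eta>) * u * v"
  let ?F = "\<lambda>s. expectation (\<lambda>\<omega>. exp (s * T \<omega>) * indicator G \<omega>)"
  let ?A = "{\<omega> \<in> space M. t1 \<le> T \<omega>}"
  have Rp: "0 < R" using u v R by simp
  have A: "?A \<in> events" by measurable
  have iA: "integrable M (\<lambda>\<omega>. exp (u * t2) * indicator ?A \<omega>)"
    using A by (intro integrable_mult_right integrable_real_indicator) (auto simp: emeasure_eq_measure)
  \<comment> \<open>Below \<open>t1\<close> the transform at u is compared with the tilt (1 -
    \<eta>) u, above \<open>t2\<close> with (1 + \<eta>) u; only the window between them is charged
    to the probability.\<close>
  have pt: "exp (u * T \<omega>) * indicator G \<omega> \<le> exp (u * t2) * indicator ?A \<omega>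
      + exp (\<eta> * u * t1) * (exp ((1 - \<eta>) * u * T \<omega>) * indicator G \<omega>)
      + exp (- (\<eta> * u * t2)) * (exp ((1 + \<eta>) * u * T \<omega>) * indicator G \<omega>)" if "\<omega> \<in> space M" for \<omega>
  proof (cases "\<omega> \<in> G")
    case False
    then show ?thesis by simp
  next
    case True
    have pos: "0 < exp (u * t2)" "0 < exp (\<eta> * u * t1) * exp ((1 - \<eta>) * u * T \<omega>)" "0 < exp (- (\<eta> * u * t2)) * exp ((1 + \<eta>) * u * T \<omega>)"
      by simp_all
    have iG: "indicator G \<omega> = (1::real)" using True by simp
    consider "T \<omega> < t1" | "t1 \<le> T \<omega>" "T \<omega> \<le> t2" | "t1 \<le> T \<omega>" "t2 < T \<omega>" by linarith
    then show ?thesis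
    proof cases
      case 1
      have "\<eta> * u * T \<omega> \<le> \<eta> * u * t1" using 1 \<eta> u by (intro mult_left_mono) auto
      then have "u * T \<omega> \<le> \<eta> * u * t1 + (1 - \<eta>) * u * T \<omega>" by (simp add: algebra_simps)
      then have "exp (u * T \<omega>) \<le> exp (\<eta> * u * t1) * exp ((1 - \<eta>) * u * T \<omega>)" by (simp flip: exp_add)
      moreover have "indicator ?A \<omega> = (0::real)" using 1 by simp
      ultimately show ?thesis unfolding iG using pos by (simp only: mult_1_right mult_zero_right, linarith?)
    next
      case 2
      then have "exp (u * T \<omega>) \<le> exp (u * t2)" using u by simp
      moreover have "indicator ?A \<omega> = (1::real)" using 2 that by simp
      ultimately show ?thesis unfolding iG using pos by (simp only: mult_1_right mult_zero_right, linarith?)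
    next
      case 3
      have "\<eta> * u * t2 \<le> \<eta> * u * T \<omega>" using 3 \<eta> u by (intro mult_left_mono) auto
      then have "u * T \<omega> \<le> - (\<eta> * u * t2) + (1 + \<eta>) * u * T \<omega>" by (simp add: algebra_simps)
      then have "exp (u * T \<omega>) \<le> exp (- (\<eta> * u * t2)) * exp ((1 + \<eta>) * u * T \<omega>)" by (simp flip: exp_add)
      moreover have "indicator ?A \<omega> = (1::real)" using 3 that by simp
      ultimately show ?thesis unfolding iG using pos by (simp only: mult_1_right mult_zero_right, linarith?)
    qed
  qed
  have "?F u \<le> expectation (\<lambda>\<omega>. exp (u * t2) * indicator ?A \<omega>
      + exp (\<eta> * u * t1) * (exp ((1 - \<eta>) * u * T \<omega>) * indicator G \<omega>)
      + exp (- (\<eta> * u * t2)) * (exp ((1 + \<eta>) * u * T \<omega>) * indicator G \<omega>))"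
    by (intro integral_mono[OF int _ pt] Bochner_Integration.integrable_add iA integrable_mult_right int)
  also have "\<dots> = exp (u * t2) * prob ?A + exp (\<eta> * u * t1) * ?F ((1 - \<eta>) * u) + exp (- (\<eta> * u * t2)) * ?F ((1 + \<eta>) * u)"
    using iA int[of "(1 - \<eta>) * u"] int[of "(1 + \<eta>) * u"] A by simp
  \<comment> \<open>Each flank gains \<eta>^2 R / 2 in the exponent and returns \<eta>^2 R / 8
    through the error in \<open>up\<close>. Compared with \<open>low\<close> a loss of \<eta>^2 R /
    4 >= ln 4 remains, so both flanks together take at most half of the mass.\<close>
  also have "\<dots> \<le> exp (u * t2) * prob ?A + exp (R / 2 - 3 * \<eta>\<^sup>2 * R / 8) + exp (R / 2 - 3 * \<eta>\<^sup>2 * R / 8)"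
  proof (intro add_mono order_refl)
    have "exp (\<eta> * u * t1) * ?F ((1 - \<eta>) * u) \<le> exp (\<eta> * u * t1) * exp (((1 - \<eta>) * u)\<^sup>2 * v / 2 + \<eta>\<^sup>2 * R / 8)"
      using up[of "(1 - \<eta>) * u"] by (intro mult_left_mono) auto
    also have "\<dots> = exp (R / 2 - 3 * \<eta>\<^sup>2 * R / 8)"
      by (simp add: t1_def R power2_eq_square algebra_simps add_divide_distrib diff_divide_distrib flip: exp_add)
    finally show "exp (\<eta> * u * t1) * ?F ((1 - \<eta>) * u) \<le> exp (R / 2 - 3 * \<eta>\<^sup>2 * R / 8)" .
    have "exp (- (\<eta> * u * t2)) * ?F ((1 + \<eta>) * u) \<le> exp (- (\<eta> * u * t2)) * exp (((1 + \<eta>) * u)\<^sup>2 * v / 2 + \<eta>\<^sup>2 * R / 8)"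
      using up[of "(1 + \<eta>) * u"] by (intro mult_left_mono) auto
    also have "\<dots> = exp (R / 2 - 3 * \<eta>\<^sup>2 * R / 8)"
      by (simp add: t2_def R power2_eq_square algebra_simps add_divide_distrib diff_divide_distrib flip: exp_add)
    finally show "exp (- (\<eta> * u * t2)) * ?F ((1 + \<eta>) * u) \<le> exp (R / 2 - 3 * \<eta>\<^sup>2 * R / 8)" .
  qed
  finally have main: "?F u \<le> exp (u * t2) * prob ?A + 2 * exp (R / 2 - 3 * \<eta>\<^sup>2 * R / 8)" by simp
  have "exp (R / 2 - 3 * \<eta>\<^sup>2 * R / 8) = exp (R / 2 - \<eta>\<^sup>2 * R / 8) * exp (- (\<eta>\<^sup>2 * R / 4))"
    by (simp add: algebra_simps flip: exp_add)
  also have "\<dots> \<le> exp (R / 2 - \<eta>\<^sup>2 * R / 8) * (1/4)"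
  proof (rule mult_left_mono)
    have "exp (- (\<eta>\<^sup>2 * R / 4)) \<le> exp (- ln 4)" using R(2) by simp
    then show "exp (- (\<eta>\<^sup>2 * R / 4)) \<le> 1/4" by (simp add: exp_minus)
  qed simp
  finally have "exp (R / 2 - \<eta>\<^sup>2 * R / 8) / 2 \<le> exp (u * t2) * prob ?A" using main low by linarith
  then have "(exp (R / 2 - \<eta>\<^sup>2 * R / 8) / 2) / exp (u * t2) \<le> (exp (u * t2) * prob ?A) / exp (u * t2)"
    by (rule divide_right_mono) simp
  then have "exp (R / 2 - \<eta>\<^sup>2 * R / 8 - u * t2) / 2 \<le> prob ?A" by (subst exp_diff) simp
  moreover have "- (1 + 3 * \<eta>) * R / 2 \<le> R / 2 - \<eta>\<^sup>2 * R / 8 - u * t2"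
  proof -
    have "u * t2 = R + \<eta> * R" by (simp add: t2_def R power2_eq_square algebra_simps)
    moreover have "- (1 + 3 * \<eta>) * R / 2 = - (R / 2) - 3 / 2 * (\<eta> * R)" by (simp add: field_simps)
    moreover have "\<eta>\<^sup>2 * R \<le> \<eta> * R" using \<eta> Rp by (intro mult_right_mono) (auto simp: power2_eq_square)
    moreover have "0 < \<eta> * R" using \<eta> Rp by simp
    ultimately show ?thesis by linarith
  qed
  then have "exp (- (1 + 3 * \<eta>) * R / 2) \<le> exp (R / 2 - \<eta>\<^sup>2 * R / 8 - u * t2)" by (simp only: exp_le_cancel_iff)
  ultimately show ?thesis unfolding t1_def by linarith
qed

lemma exp_quadratic_bounds:
  fixes x k :: real
  assumes "\<bar>x\<bar> \<le> k"
  shows "exp x \<le> 1 + x + exp k * x\<^sup>2 / 2" "1 + x + exp (- k) * x\<^sup>2 / 2 \<le> exp x"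
proof -
  obtain t where t: "\<bar>t\<bar> \<le> \<bar>x\<bar>" "exp x = (\<Sum>m<2. x ^ m / fact m) + exp t / fact 2 * x ^ 2"
    using Maclaurin_exp_le[of x 2] by auto
  then have e: "exp x = 1 + x + exp t * x\<^sup>2 / 2" by (simp add: numeral_2_eq_2)
  have "exp t \<le> exp k" "exp (- k) \<le> exp t" using t(1) assms by auto
  then have "exp t * x\<^sup>2 \<le> exp k * x\<^sup>2" "exp (- k) * x\<^sup>2 \<le> exp t * x\<^sup>2" by (auto intro: mult_right_mono)
  then show "exp x \<le> 1 + x + exp k * x\<^sup>2 / 2" "1 + x + exp (- k) * x\<^sup>2 / 2 \<le> exp x" using e by linarith+
qed

lemma exp_quadratic_le_one_plus:
  fixes z :: real
  assumes "\<bar>z\<bar> \<le> 1/2"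
  shows "exp (z - 2 * z\<^sup>2) \<le> 1 + z"
proof (cases "0 \<le> z")
  case True
  have "z - z\<^sup>2 \<le> ln (1 + z)" using True assms by (intro ln_one_plus_pos_lower_bound) auto
  then have "z - 2 * z\<^sup>2 \<le> ln (1 + z)" by (smt (verit) zero_le_power2)
  then show ?thesis using True by (metis add_pos_nonneg exp_le_cancel_iff exp_ln zero_less_one)
next
  case False
  have "- (- z) - 2 * (- z)\<^sup>2 \<le> ln (1 - (- z))" using False assms by (intro ln_one_minus_pos_lower_bound) auto
  then have le: "z - 2 * z\<^sup>2 \<le> ln (1 + z)" by simp
  have "0 < 1 + z" using assms by simp
  then have "exp (ln (1 + z)) = 1 + z" by simp
  then show ?thesis using le by (metis exp_le_cancel_iff)
qed

section \<open>Truncated Laplace transforms of block sums\<close>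

context banach_iid
begin

text \<open>Large values are cut off by an indicator and not set to 0. The product over a block is
  then the transform of the original sum on the event that no summand is large, so lower bounds
  speak about the sum itself.\<close>

definition tilted :: "('b \<Rightarrow> real) \<Rightarrow> real \<Rightarrow> real \<Rightarrow> real" where
  "tilted f b s = expectation (\<lambda>\<omega>. exp (s * f (X \<omega>)) * indicator {\<omega>. norm (X \<omega>) \<le> b} \<omega>)"

definition tvar :: "('b \<Rightarrow> real) \<Rightarrow> real \<Rightarrow> real" where
  "tvar f b = expectation (\<lambda>\<omega>. (f (X \<omega>))\<^sup>2 * indicator {\<omega>. norm (X \<omega>) \<le> b} \<omega>)"

context
  fixes f :: "'b \<Rightarrow> real" and b :: real
  assumes f: "f \<in> dual_ball" and b: "0 < b"
begin

lemma tilted_integrable: "integrable M (\<lambda>\<omega>. exp (s * f (X \<omega>)) * indicator {\<omega>. norm (X \<omega>) \<le> b} \<omega>)"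
proof (rule integrable_const_bound[where B="exp (\<bar>s\<bar> * b)"], rule AE_I2)
  note [measurable] = dual_meas[OF f]
  fix \<omega>
  show "norm (exp (s * f (X \<omega>)) * indicator {\<omega>. norm (X \<omega>) \<le> b} \<omega>) \<le> exp (\<bar>s\<bar> * b)"
  proof (cases "norm (X \<omega>) \<le> b")
    case True
    have "s * f (X \<omega>) \<le> \<bar>s\<bar> * \<bar>f (X \<omega>)\<bar>" by (simp flip: abs_mult)
    also have "\<dots> \<le> \<bar>s\<bar> * b" using dual_ballD(2)[OF f, of "X \<omega>"] True by (intro mult_left_mono) auto
    finally show ?thesis using True by simp
  qed simp
  show "(\<lambda>\<omega>. exp (s * f (X \<omega>)) * indicator {\<omega>. norm (X \<omega>) \<le> b} \<omega>) \<in> borel_measurable M" by measurable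
qed

lemma truncated_linear:
  "integrable M (\<lambda>\<omega>. f (X \<omega>) * indicator {\<omega>. norm (X \<omega>) \<le> b} \<omega>)"
  "\<bar>expectation (\<lambda>\<omega>. f (X \<omega>) * indicator {\<omega>. norm (X \<omega>) \<le> b} \<omega>)\<bar> \<le> first_tail b"
proof -
  note [measurable] = dual_meas[OF f]
  have eq: "f (X \<omega>) * indicator {\<omega>. norm (X \<omega>) \<le> b} \<omega> = f (trunc b (X \<omega>))" for \<omega>
    using linear_0[OF bounded_linear.linear[OF dual_ballD(1)[OF f]]] by (simp add: trunc_def)
  show "integrable M (\<lambda>\<omega>. f (X \<omega>) * indicator {\<omega>. norm (X \<omega>) \<le> b} \<omega>)"
    unfolding eq using integrable_bounded_linear[OF dual_ballD(1)[OF f] trunc_integrable, of b] b by simp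
  have "expectation (\<lambda>\<omega>. f (X \<omega>) * indicator {\<omega>. norm (X \<omega>) \<le> b} \<omega>) = f (trunc_mean b)"
    unfolding eq trunc_mean_def using integral_bounded_linear[OF dual_ballD(1)[OF f] trunc_integrable, of b] b by simp
  then show "\<bar>expectation (\<lambda>\<omega>. f (X \<omega>) * indicator {\<omega>. norm (X \<omega>) \<le> b} \<omega>)\<bar> \<le> first_tail b"
    using dual_ballD(2)[OF f, of "trunc_mean b"] norm_trunc_mean_le[of b] b by linarith
qed

text \<open>Expansion of exp to second order on the set where the norm is at most b: the constant
  term loses the mass outside that set, and the linear term is at most \<open>first_tail\<close>
  because X has mean zero.\<close>

lemma tilted_bounds:
  assumes s: "0 \<le> s" "s * b \<le> k"
  shows "tilted f b s \<le> 1 + s * first_tail b + exp k * s\<^sup>2 * tvar f b / 2"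
    "1 - prob {\<omega> \<in> space M. b < norm (X \<omega>)} - s * first_tail b + exp (- k) * s\<^sup>2 * tvar f b / 2 \<le> tilted f b s"
proof -
  let ?I = "\<lambda>\<omega>. indicator {\<omega>. norm (X \<omega>) \<le> b} \<omega> :: real"
  have i0: "integrable M ?I"
    by (rule integrable_const_bound[where B=1]) (auto simp: indicator_def)
  have E0: "expectation ?I = 1 - prob {\<omega> \<in> space M. b < norm (X \<omega>)}"
  proof -
    have "expectation ?I = expectation (indicator {\<omega> \<in> space M. \<not> b < norm (X \<omega>)})"
      by (intro Bochner_Integration.integral_cong) (auto simp: indicator_def)
    also have "\<dots> = prob {\<omega> \<in> space M. \<not> b < norm (X \<omega>)}" by simp
    also have "\<dots> = 1 - prob {\<omega> \<in> space M. b < norm (X \<omega>)}" by (rule prob_neg) measurable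
    finally show ?thesis .
  qed
  define e where "e = expectation (\<lambda>\<omega>. f (X \<omega>) * ?I \<omega>)"
  have e: "\<bar>e\<bar> \<le> first_tail b" unfolding e_def by (rule truncated_linear)
  have se: "s * e \<le> s * first_tail b" "- (s * first_tail b) \<le> s * e"
    using e s mult_left_mono[of e "first_tail b" s] mult_left_mono[of "- first_tail b" e s] by auto
  have small: "\<bar>s * f (X \<omega>)\<bar> \<le> k" if "norm (X \<omega>) \<le> b" for \<omega>
  proof -
    have "\<bar>s * f (X \<omega>)\<bar> \<le> s * b"
      unfolding abs_mult using dual_ballD(2)[OF f, of "X \<omega>"] that s by (intro mult_mono) auto
    then show ?thesis using s by linarith
  qed
  have poly: "integrable M (\<lambda>\<omega>. ?I \<omega> + s * (f (X \<omega>) * ?I \<omega>) + c * s\<^sup>2 / 2 * ((f (X \<omega>))\<^sup>2 * ?I \<omega>))"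
    "expectation (\<lambda>\<omega>. ?I \<omega> + s * (f (X \<omega>) * ?I \<omega>) + c * s\<^sup>2 / 2 * ((f (X \<omega>))\<^sup>2 * ?I \<omega>))
      = (1 - prob {\<omega> \<in> space M. b < norm (X \<omega>)}) + s * e + c * s\<^sup>2 / 2 * tvar f b" for c
    using i0 truncated_linear(1) H_integrand(1)[OF f, of b] E0 by (auto simp: e_def tvar_def)
  have "tilted f b s \<le> expectation (\<lambda>\<omega>. ?I \<omega> + s * (f (X \<omega>) * ?I \<omega>) + exp k * s\<^sup>2 / 2 * ((f (X \<omega>))\<^sup>2 * ?I \<omega>))"
    unfolding tilted_def
  proof (rule integral_mono[OF tilted_integrable poly(1)])
    fix \<omega>
    show "exp (s * f (X \<omega>)) * ?I \<omega> \<le> ?I \<omega> + s * (f (X \<omega>) * ?I \<omega>) + exp k * s\<^sup>2 / 2 * ((f (X \<omega>))\<^sup>2 * ?I \<omega>)"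
      using exp_quadratic_bounds(1)[OF small[of \<omega>]] by (cases "norm (X \<omega>) \<le> b") (auto simp: power_mult_distrib)
  qed
  also have "\<dots> \<le> 1 + s * first_tail b + exp k * s\<^sup>2 * tvar f b / 2"
  proof -
    have "(1 - prob {\<omega> \<in> space M. b < norm (X \<omega>)}) + s * e \<le> 1 + s * first_tail b"
      using se(1) measure_nonneg[of M "{\<omega> \<in> space M. b < norm (X \<omega>)}"] by linarith
    from add_right_mono[OF this, of "exp k * s\<^sup>2 / 2 * tvar f b"] show ?thesis unfolding poly(2) by simp
  qed
  finally show "tilted f b s \<le> 1 + s * first_tail b + exp k * s\<^sup>2 * tvar f b / 2" .
  have "1 - prob {\<omega> \<in> space M. b < norm (X \<omega>)} - s * first_tail b + exp (- k) * s\<^sup>2 * tvar f b / 2 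
    \<le> expectation (\<lambda>\<omega>. ?I \<omega> + s * (f (X \<omega>) * ?I \<omega>) + exp (- k) * s\<^sup>2 / 2 * ((f (X \<omega>))\<^sup>2 * ?I \<omega>))"
    unfolding poly(2) using se by simp
  also have "\<dots> \<le> tilted f b s"
    unfolding tilted_def
  proof (rule integral_mono[OF poly(1) tilted_integrable])
    fix \<omega>
    show "?I \<omega> + s * (f (X \<omega>) * ?I \<omega>) + exp (- k) * s\<^sup>2 / 2 * ((f (X \<omega>))\<^sup>2 * ?I \<omega>) \<le> exp (s * f (X \<omega>)) * ?I \<omega>"
      using exp_quadratic_bounds(2)[OF small[of \<omega>]] by (cases "norm (X \<omega>) \<le> b") (auto simp: power_mult_distrib)
  qed
  finally show "1 - prob {\<omega> \<in> space M. b < norm (X \<omega>)} - s * first_tail b + exp (- k) * s\<^sup>2 * tvar f b / 2 \<le> tilted f b s" .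
qed

lemma tilted_block:
  fixes J :: "nat set"
  assumes J: "finite J" "J \<subseteq> {1..}"
  shows "integrable M (\<lambda>\<omega>. exp (s * f (\<Sum>i\<in>J. Xs i \<omega>)) * indicator {\<omega> \<in> space M. \<forall>i\<in>J. norm (Xs i \<omega>) \<le> b} \<omega>)"
    "expectation (\<lambda>\<omega>. exp (s * f (\<Sum>i\<in>J. Xs i \<omega>)) * indicator {\<omega> \<in> space M. \<forall>i\<in>J. norm (Xs i \<omega>) \<le> b} \<omega>) = tilted f b s ^ card J"
proof -
  define g where "g = (\<lambda>x. exp (s * f x) * indicator {x. norm x \<le> b} x)"
  have gm [measurable]: "g \<in> borel_measurable borel"
    unfolding g_def using borel_measurable_dual_ball[OF f] by measurable
  have lin: "f (\<Sum>i\<in>J. Xs i \<omega>) = (\<Sum>i\<in>J. f (Xs i \<omega>))" for \<omega>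
    by (rule linear_sum[OF bounded_linear.linear[OF dual_ballD(1)[OF f]]])
  have prod: "exp (s * f (\<Sum>i\<in>J. Xs i \<omega>)) * indicator {\<omega> \<in> space M. \<forall>i\<in>J. norm (Xs i \<omega>) \<le> b} \<omega> = (\<Prod>i\<in>J. g (Xs i \<omega>))"
    if w: "\<omega> \<in> space M" for \<omega>
  proof (cases "\<forall>i\<in>J. norm (Xs i \<omega>) \<le> b")
    case True
    then have "(\<Prod>i\<in>J. g (Xs i \<omega>)) = (\<Prod>i\<in>J. exp (s * f (Xs i \<omega>)))" by (intro prod.cong) (auto simp: g_def)
    also have "\<dots> = exp (s * (\<Sum>i\<in>J. f (Xs i \<omega>)))" using J by (simp add: exp_sum sum_distrib_left)
    finally show ?thesis using True w lin by simp
  next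
    case False
    then obtain i where "i \<in> J" "g (Xs i \<omega>) = 0" by (auto simp: g_def)
    then have "(\<Prod>i\<in>J. g (Xs i \<omega>)) = 0" by (intro prod_zero[OF J(1)] bexI[of _ i])
    then show ?thesis using False by simp
  qed
  have gi: "integrable M (\<lambda>\<omega>. g (X \<omega>))"
    using tilted_integrable[of s] by (simp add: g_def indicator_def)
  have gXs: "integrable M (\<lambda>\<omega>. g (Xs i \<omega>))" if "i \<in> J" for i
  proof -
    have i: "1 \<le> i" using J that by auto
    have "integrable (distr M borel X) g" using gi by (subst integrable_distr_eq) auto
    then have "integrable (distr M borel (Xs i)) g" using Xs_distr[OF i] by simp
    then show ?thesis using Xs_meas[OF i] by (subst (asm) integrable_distr_eq) auto
  qed
  have ind: "indep_vars (\<lambda>_. borel) (\<lambda>i \<omega>. g (Xs i \<omega>)) J"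
    by (rule indep_vars_compose2[OF indep_vars_subset[OF Xs_indep J(2)]]) simp
  have "integrable M (\<lambda>\<omega>. \<Prod>i\<in>J. g (Xs i \<omega>))" by (rule indep_vars_integrable[OF J(1) ind gXs])
  then show "integrable M (\<lambda>\<omega>. exp (s * f (\<Sum>i\<in>J. Xs i \<omega>)) * indicator {\<omega> \<in> space M. \<forall>i\<in>J. norm (Xs i \<omega>) \<le> b} \<omega>)"
    by (subst Bochner_Integration.integrable_cong[OF refl prod]) 
  have "expectation (\<lambda>\<omega>. exp (s * f (\<Sum>i\<in>J. Xs i \<omega>)) * indicator {\<omega> \<in> space M. \<forall>i\<in>J. norm (Xs i \<omega>) \<le> b} \<omega>)
    = expectation (\<lambda>\<omega>. \<Prod>i\<in>J. g (Xs i \<omega>))" by (rule Bochner_Integration.integral_cong[OF refl prod])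
  also have "\<dots> = (\<Prod>i\<in>J. expectation (\<lambda>\<omega>. g (Xs i \<omega>)))" by (rule indep_vars_lebesgue_integral[OF J(1) ind gXs])
  also have "\<dots> = (\<Prod>i\<in>J. expectation (\<lambda>\<omega>. g (X \<omega>)))"
    using J(2) by (intro prod.cong refl expectation_Xs) auto
  also have "expectation (\<lambda>\<omega>. g (X \<omega>)) = tilted f b s" by (simp add: g_def tilted_def indicator_def)
  finally show "expectation (\<lambda>\<omega>. exp (s * f (\<Sum>i\<in>J. Xs i \<omega>)) * indicator {\<omega> \<in> space M. \<forall>i\<in>J. norm (Xs i \<omega>) \<le> b} \<omega>) = tilted f b s ^ card J"
    by simp
qed

text \<open>Every perturbation of the Gaussian transform (lost mass, drift, the factors exp (2 u b)
  and exp (- 2 u b), the passage from 1 + z to exp z) is granted a small fraction of \<eta>^2 R, and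
  together they stay within the \<eta>^2 R / 8 allowed by
  \<open>laplace_lower_bound\<close>.\<close>

lemma block_lower_bound:
  fixes J :: "nat set" and u \<eta> :: real
  assumes J: "finite J" "J \<subseteq> {1..}" and u: "0 < u" and \<eta>: "0 < \<eta>" "\<eta> \<le> 1/2" and v: "0 < tvar f b"
    and R: "R = u\<^sup>2 * (card J * tvar f b)" "4 * ln 4 \<le> \<eta>\<^sup>2 * R" "512 * R \<le> \<eta>\<^sup>2 * card J"
    and k: "exp (2 * u * b) - 1 \<le> \<eta>\<^sup>2 / 64"
    and p: "card J * prob {\<omega> \<in> space M. b < norm (X \<omega>)} \<le> \<eta>\<^sup>2 * R / 64"
    and d: "card J * (u * first_tail b) \<le> \<eta>\<^sup>2 * R / 64"
  shows "exp (- (1 + 3 * \<eta>) * R / 2) / 2 \<le> prob {\<omega> \<in> space M. (1 - \<eta>) * u * (card J * tvar f b) \<le> f (\<Sum>i\<in>J. Xs i \<omega>)}"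
proof -
  define l where "l = real (card J)"
  define v where "v = l * tvar f b"
  have Jne: "0 < l"
  proof (rule ccontr)
    assume "\<not> 0 < l"
    then have "R = 0" using R(1) by (simp add: l_def)
    then show False using R(2) by simp
  qed
  have vp: "0 < v" using Jne assms(6) by (simp add: v_def)
  have Rv: "R = u\<^sup>2 * v" using R(1) by (simp add: v_def l_def)
  have Rp: "0 < R" using u vp Rv by simp
  have \<eta>2: "\<eta>\<^sup>2 \<le> 1/4" using power_mono[OF \<eta>(2), of 2] \<eta> by (simp add: power2_eq_square)
  \<comment> \<open>All tilts that occur, u and (1 - \<eta>) u and (1 + \<eta>) u, are at most 2
    u.\<close>
  define k' where "k' = 2 * u * b"
  have k': "0 < k'" using u b by (simp add: k'_def)
  show ?thesis
    unfolding l_def[symmetric] v_def[symmetric]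
  proof (rule laplace_lower_bound[where G="{\<omega> \<in> space M. \<forall>i\<in>J. norm (Xs i \<omega>) \<le> b}"])
    have fS: "(\<lambda>\<omega>. \<Sum>i\<in>J. Xs i \<omega>) \<in> borel_measurable M" using Xs_meas J by (intro borel_measurable_sum) auto
    show "(\<lambda>\<omega>. f (\<Sum>i\<in>J. Xs i \<omega>)) \<in> borel_measurable M"
      by (rule measurable_compose[OF fS borel_measurable_dual_ball[OF f]])
    show "{\<omega> \<in> space M. \<forall>i\<in>J. norm (Xs i \<omega>) \<le> b} \<in> events"
    proof (rule sets.sets_Collect_finite_All[OF _ J(1)])
      fix i assume "i \<in> J"
      then have [measurable]: "Xs i \<in> borel_measurable M" using J by (intro Xs_meas) auto
      show "{\<omega> \<in> space M. norm (Xs i \<omega>) \<le> b} \<in> events" by measurable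
    qed
    show "integrable M (\<lambda>\<omega>. exp (s * f (\<Sum>i\<in>J. Xs i \<omega>)) * indicator {\<omega> \<in> space M. \<forall>i\<in>J. norm (Xs i \<omega>) \<le> b} \<omega>)" for s
      by (rule tilted_block[OF J])
    show "R = u\<^sup>2 * v" by (rule Rv)
    show "4 * ln 4 \<le> \<eta>\<^sup>2 * R" by (rule R(2))
    show "\<eta> \<le> 1" using \<eta> by simp
    show "exp (R / 2 - \<eta>\<^sup>2 * R / 8) \<le> expectation (\<lambda>\<omega>. exp (u * f (\<Sum>i\<in>J. Xs i \<omega>)) * indicator {\<omega> \<in> space M. \<forall>i\<in>J. norm (Xs i \<omega>) \<le> b} \<omega>)"
    proof -
      define p where "p = prob {\<omega> \<in> space M. b < norm (X \<omega>)}"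
      define d where "d = u * first_tail b"
      \<comment> \<open>1 + z is the lower bound for one summand; its power is turned into an
        exponential by exp (z - 2 z^2) <= 1 + z, and 512 R <= \<eta>^2 |J| makes the total of the
        squares negligible.\<close>
      define z where "z = - p - d + exp (- k') * u\<^sup>2 * tvar f b / 2"
      have p0: "0 \<le> p" "l * p \<le> \<eta>\<^sup>2 * R / 64" using assms(11) by (auto simp: p_def l_def)
      have d0: "0 \<le> d" "l * d \<le> \<eta>\<^sup>2 * R / 64" using assms(12) u first_tail_nonneg by (auto simp: d_def l_def)
      have ek: "1 - \<eta>\<^sup>2 / 64 \<le> exp (- k')"
      proof -
        have "1 - k' \<le> exp (- k')" using exp_ge_add_one_self[of "- k'"] by simp
        moreover have "k' \<le> exp k' - 1" using exp_ge_add_one_self[of k'] by linarith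
        ultimately show ?thesis using assms(10) unfolding k'_def by linarith
      qed
      have lz: "l * z = - (l * p) - l * d + exp (- k') * (R / 2)"
        by (simp add: z_def Rv v_def algebra_simps)
      have R64: "\<eta>\<^sup>2 * R \<le> R / 4" using \<eta>2 Rp mult_right_mono[OF \<eta>2, of R] by simp
      have "(1 - \<eta>\<^sup>2 / 64) * (R / 2) \<le> exp (- k') * (R / 2)" using ek Rp by (intro mult_right_mono) auto
      then have lz1: "R / 2 - \<eta>\<^sup>2 * R / 128 - \<eta>\<^sup>2 * R / 32 \<le> l * z" unfolding lz using p0 d0 by (simp add: algebra_simps)
      have "exp (- k') * (R / 2) \<le> 1 * (R / 2)" using k' Rp by (intro mult_right_mono) auto
      moreover have "0 \<le> l * p" "0 \<le> l * d" using p0 d0 Jne by auto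
      ultimately have lz2: "l * z \<le> R" unfolding lz using Rp by linarith
      have lz3: "0 \<le> l * z" using lz1 R64 Rp by linarith
      have z0: "0 \<le> z" using lz3 Jne by (simp add: zero_le_mult_iff)
      have zR: "z \<le> R / l" using lz2 Jne by (simp add: le_divide_eq mult.commute)
      have "\<eta>\<^sup>2 * l \<le> 1 * l" using \<eta>2 Jne by (intro mult_right_mono) auto
      then have "512 * R \<le> 1 * l" using assms(9) unfolding l_def by linarith
      then have "R / l \<le> 1/512" using Jne by (simp add: divide_le_eq)
      then have "z \<le> 1/2" using zR by linarith
      then have zh: "\<bar>z\<bar> \<le> 1/2" using z0 by simp
      have "l * (2 * z\<^sup>2) = 2 * (l * z) * z" by (simp add: power2_eq_square)
      also have "\<dots> \<le> 2 * R * (R / l)" using lz2 lz3 z0 zR Rp by (intro mult_mono) auto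
      also have "\<dots> \<le> \<eta>\<^sup>2 * R / 256"
      proof -
        have "512 * R * R \<le> \<eta>\<^sup>2 * l * R" using assms(9) Rp by (intro mult_right_mono) (auto simp: l_def)
        then show ?thesis using Jne by (simp add: field_simps)
      qed
      finally have z2: "l * (2 * z\<^sup>2) \<le> \<eta>\<^sup>2 * R / 256" .
      have "0 \<le> \<eta>\<^sup>2 * R" using Rp by simp
      then have "R / 2 - \<eta>\<^sup>2 * R / 8 \<le> l * (z - 2 * z\<^sup>2)" using lz1 z2 by (simp add: algebra_simps)
      then have "exp (R / 2 - \<eta>\<^sup>2 * R / 8) \<le> exp (l * (z - 2 * z\<^sup>2))" by simp
      also have "\<dots> = exp (z - 2 * z\<^sup>2) ^ card J" by (simp add: l_def exp_of_nat_mult)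
      also have "\<dots> \<le> (1 + z) ^ card J" by (intro power_mono exp_quadratic_le_one_plus zh) simp
      also have "\<dots> \<le> tilted f b u ^ card J"
      proof (rule power_mono)
        have "u * b \<le> k'" using u b by (simp add: k'_def)
        from tilted_bounds(2)[OF _ this] u show "1 + z \<le> tilted f b u" by (simp add: z_def p_def d_def)
      qed (use z0 in simp)
      finally show ?thesis using tilted_block(2)[OF J, of u] by simp
    qed
    fix s assume s: "s = (1 - \<eta>) * u \<or> s = (1 + \<eta>) * u"
    have "(1 - \<eta>) * u \<le> 2 * u" "(1 + \<eta>) * u \<le> 2 * u" "0 \<le> (1 - \<eta>) * u" "0 \<le> (1 + \<eta>) * u"
      using \<eta> u by (auto intro: mult_right_mono)
    then have s0: "0 \<le> s" "s \<le> 2 * u" using s by auto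
    have sb: "s * b \<le> k'" using s0 b by (simp add: k'_def)
    show "expectation (\<lambda>\<omega>. exp (s * f (\<Sum>i\<in>J. Xs i \<omega>)) * indicator {\<omega> \<in> space M. \<forall>i\<in>J. norm (Xs i \<omega>) \<le> b} \<omega>) \<le> exp (s\<^sup>2 * v / 2 + \<eta>\<^sup>2 * R / 8)"
    proof -
      define y where "y = s * first_tail b + exp k' * s\<^sup>2 * tvar f b / 2"
      have "0 \<le> tilted f b s" unfolding tilted_def by (intro integral_nonneg_AE AE_I2) simp
      moreover have "tilted f b s \<le> exp y"
      proof -
        have "tilted f b s \<le> 1 + y" using tilted_bounds(1)[OF s0(1) sb] by (simp add: y_def)
        also have "\<dots> \<le> exp y" by (rule exp_ge_add_one_self)
        finally show ?thesis .
      qed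
      ultimately have "tilted f b s ^ card J \<le> exp y ^ card J" by (intro power_mono)
      also have "\<dots> = exp (l * y)" by (simp add: l_def exp_of_nat_mult)
      also have "\<dots> \<le> exp (s\<^sup>2 * v / 2 + \<eta>\<^sup>2 * R / 8)"
      proof (subst exp_le_cancel_iff)
        have ly: "l * y = l * (s * first_tail b) + s\<^sup>2 * v / 2 + (exp k' - 1) * (s\<^sup>2 * v / 2)"
          by (simp add: y_def v_def algebra_simps diff_divide_distrib)
        have "l * (s * first_tail b) \<le> l * (2 * u * first_tail b)"
          using s0 Jne first_tail_nonneg by (intro mult_left_mono mult_right_mono) auto
        also have "\<dots> \<le> \<eta>\<^sup>2 * R / 32" using assms(12) by (simp add: l_def)
        finally have 1: "l * (s * first_tail b) \<le> \<eta>\<^sup>2 * R / 32" .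
        have "s\<^sup>2 \<le> (2 * u)\<^sup>2" using s0 by (intro power_mono) auto
        then have "s\<^sup>2 * v \<le> (2 * u)\<^sup>2 * v" using vp by (intro mult_right_mono) auto
        then have s2: "s\<^sup>2 * v / 2 \<le> 2 * R" by (simp add: Rv power_mult_distrib)
        have "(exp k' - 1) * (s\<^sup>2 * v / 2) \<le> \<eta>\<^sup>2 / 64 * (2 * R)"
          using assms(10) s2 vp k' unfolding k'_def[symmetric] by (intro mult_mono) auto
        then have 2: "(exp k' - 1) * (s\<^sup>2 * v / 2) \<le> \<eta>\<^sup>2 * R / 32" by (simp add: mult_ac)
        have "0 \<le> \<eta>\<^sup>2 * R" using Rp by simp
        then show "l * y \<le> s\<^sup>2 * v / 2 + \<eta>\<^sup>2 * R / 8" unfolding ly using 1 2 by linarith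
      qed
      finally show ?thesis using tilted_block(2)[OF J, of s] by simp
    qed
  qed (use u vp \<eta> in auto)
qed

end

end

section \<open>The lower bound\<close>

context banach_iid
begin

text \<open>With R = 2 \<theta> l the block bound has exponent (1 + 3 \<eta>) \<theta> l. For v the
  variance of the block the level reached is (1 - \<eta>) sqrt (R v), and v >= (c - 1) m \<Lambda>^2
  h(n) / (2 l); comparison with \<Psi> (c m)^2 <= c m (1 + \<eta>) h(n) gives the square root in the
  statement.\<close>

lemma block_success_prob:
  fixes f :: "'b \<Rightarrow> real" and m c :: nat and n l \<delta> \<Lambda> \<eta> \<theta> :: real
  assumes f: "f \<in> dual_ball" and n: "0 < n" "n \<le> real m" and c: "2 \<le> c" and l: "1 \<le> l"
    and \<delta>: "0 < \<delta>" "\<delta> \<le> 1" and \<Lambda>: "0 < \<Lambda>" and \<eta>: "0 < \<eta>" "\<eta> \<le> 1/2" and \<theta>: "0 < \<theta>" "\<theta> \<le> 1"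
    and var: "\<Lambda>\<^sup>2 * h n / (2 * l) \<le> tvar f (\<delta> * \<Psi> m / l)"
    and flat: "h (real c * real m) \<le> (1 + \<eta>) * h n"
    and good: "\<alpha> m * l ^ 6 \<le> 1"
    and e: "exp (6 * \<delta> / \<Lambda>) - 1 \<le> \<eta>\<^sup>2 / 64"
    and p: "c / (\<delta> ^ 4 * l\<^sup>2) \<le> \<eta>\<^sup>2 * (\<theta> * l) / 32"
    and d: "3 * real c / \<Lambda> * (1 / (\<delta> ^ 3 * l ^ 3) + tail_mean m) \<le> \<eta>\<^sup>2 * \<theta> / 32"
    and big: "1024 * (\<theta> * l) \<le> \<eta>\<^sup>2 * m" "4 * ln 4 \<le> 2 * (\<eta>\<^sup>2 * (\<theta> * l))"
  shows "exp (- (1 + 3 * \<eta>) * \<theta> * l) / 2 \<le> prob {\<omega> \<in> space M.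
    (1 - \<eta>) * \<Lambda> * sqrt (\<theta> * (real c - 1) / (c * (1 + \<eta>))) * \<Psi> (real c * real m) \<le> f (\<Sum>i\<in>{Suc m..c * m}. Xs i \<omega>)}"
proof -
  define a where "a = \<Psi> m"
  define b where "b = \<delta> / l * \<Psi> m"
  define v1 where "v1 = tvar f b"
  define J where "J = {Suc m..c * m}"
  have m: "0 < real m" using n by linarith
  have a: "0 < a" using m by (simp add: a_def Psi_pos)
  have b: "0 < b" using a \<delta> l by (simp add: b_def a_def)
  have hn: "0 < h n" using n by (intro h_pos) simp
  have cr: "2 \<le> real c" using c by simp
  have cardJ: "real (card J) = (real c - 1) * m"
  proof -
    have "m \<le> c * m" using c by simp
    then show ?thesis by (simp add: J_def of_nat_diff algebra_simps)
  qed
  define L where "L = real (card J)"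
  have L: "real m \<le> L" "L \<le> c * real m" "0 < L" using m cr by (auto simp: L_def cardJ mult_le_cancel_right1)
  have v1: "\<Lambda>\<^sup>2 * h n / (2 * l) \<le> v1" using var by (simp add: v1_def b_def mult.commute mult.left_commute)
  have "0 < \<Lambda>\<^sup>2 * h n / (2 * l)" using \<Lambda> hn l by simp
  then have v1p: "0 < v1" using v1 by linarith
  define R where "R = 2 * (\<theta> * l)"
  have Rp: "0 < R" using \<theta> l by (simp add: R_def)
  \<comment> \<open>The tilt for which u^2 times the block variance equals R.\<close>
  define u where "u = sqrt (R / (L * v1))"
  have u: "0 < u" using Rp L v1p by (simp add: u_def)
  have u2: "u\<^sup>2 = R / (L * v1)" using Rp L v1p by (simp add: u_def)
  have hm: "h m \<le> (1 + \<eta>) * h n"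
    using h_mono[of "real m" "real c * real m"] m cr flat by (simp add: mult_le_cancel_right1)
  \<comment> \<open>u^2 is at most 4 l^2 / (\<Lambda>^2 m h n) and a^2 at most (3/2) m h n, as
    \<eta> <= 1/2. The product 6 is rounded up to 9, so that 2 u b is at most 6 \<delta> /
    \<Lambda>.\<close>
  have ub: "u \<le> 3 * l / (\<Lambda> * a)"
  proof (rule power2_le_imp_le)
    have "u\<^sup>2 \<le> 2 * l / (m * (\<Lambda>\<^sup>2 * h n / (2 * l)))"
      unfolding u2
    proof (rule frac_le)
      show "R \<le> 2 * l" using \<theta> l by (simp add: R_def mult_le_cancel_right1)
      show "m * (\<Lambda>\<^sup>2 * h n / (2 * l)) \<le> L * v1" using L v1 v1p m \<open>0 < \<Lambda>\<^sup>2 * h n / (2 * l)\<close> by (intro mult_mono) auto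
      show "0 < m * (\<Lambda>\<^sup>2 * h n / (2 * l))" using m \<Lambda> hn l by simp
    qed (use l in auto)
    also have "\<dots> = 4 * l\<^sup>2 / (\<Lambda>\<^sup>2 * (m * h n))" using l by (simp add: power2_eq_square)
    also have "\<dots> \<le> (3 * l / (\<Lambda> * a))\<^sup>2"
    proof -
      have "a\<^sup>2 = m * h m" using m by (simp add: a_def Psi_sq)
      also have "\<dots> \<le> m * ((1 + \<eta>) * h n)" using hm m by (intro mult_left_mono) auto
      also have "\<dots> \<le> m * (3/2 * h n)" using \<eta> hn m by (intro mult_left_mono mult_right_mono) auto
      finally have a2: "a\<^sup>2 \<le> 3/2 * (m * h n)" by simp
      have mh: "0 < m * h n" using m hn by simp
      have "4 * a\<^sup>2 \<le> 9 * (m * h n)" using a2 mh by linarith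
      then have "4 * a\<^sup>2 * (l\<^sup>2 * \<Lambda>\<^sup>2) \<le> 9 * (m * h n) * (l\<^sup>2 * \<Lambda>\<^sup>2)" by (rule mult_right_mono) simp
      then show ?thesis using mh a \<Lambda> m hn
        by (simp add: power_divide power_mult_distrib divide_le_eq le_divide_eq mult_ac)
    qed
    finally show "u\<^sup>2 \<le> (3 * l / (\<Lambda> * a))\<^sup>2" .
  qed (use l \<Lambda> a in simp)
  have k: "0 < \<delta> / l" "\<delta> / l \<le> 1" using \<delta> l by (auto simp: divide_le_eq)
  have al: "\<alpha> m * l ^ 4 \<le> 1 / l\<^sup>2" "\<alpha> m * l ^ 3 \<le> 1 / l ^ 3"
    using good l by (simp_all add: le_divide_eq mult.assoc flip: power_add)
  have "exp (- (1 + 3 * \<eta>) * R / 2) / 2 \<le> prob {\<omega> \<in> space M. (1 - \<eta>) * u * (card J * tvar f b) \<le> f (\<Sum>i\<in>J. Xs i \<omega>)}"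
  proof (rule block_lower_bound[OF f b])
    show "finite J" "J \<subseteq> {1..}" by (auto simp: J_def)
    show "0 < u" by (rule u)
    show "0 < \<eta>" "\<eta> \<le> 1/2" by fact+
    show "0 < tvar f b" using v1p by (simp add: v1_def)
    show "R = u\<^sup>2 * (card J * tvar f b)" using L v1p by (simp add: u2 L_def v1_def)
    show "4 * ln 4 \<le> \<eta>\<^sup>2 * R" using big(2) by (simp add: R_def)
    show "512 * R \<le> \<eta>\<^sup>2 * card J"
    proof -
      have "\<eta>\<^sup>2 * m \<le> \<eta>\<^sup>2 * L" using L by (intro mult_left_mono) auto
      then show ?thesis using big(1) by (simp add: R_def L_def)
    qed
    show "exp (2 * u * b) - 1 \<le> \<eta>\<^sup>2 / 64"
    proof -
      have "2 * u * b \<le> 2 * (3 * l / (\<Lambda> * a)) * b" using ub b by (intro mult_right_mono mult_left_mono) auto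
      also have "\<dots> = 6 * \<delta> / \<Lambda>" using a l by (simp add: b_def a_def[symmetric])
      finally have "exp (2 * u * b) \<le> exp (6 * \<delta> / \<Lambda>)" by simp
      then show ?thesis using e by linarith
    qed
    show "card J * prob {\<omega> \<in> space M. b < norm (X \<omega>)} \<le> \<eta>\<^sup>2 * R / 64"
    proof -
      have "L * prob {\<omega> \<in> space M. b < norm (X \<omega>)} \<le> (c * real m) * prob {\<omega> \<in> space M. b < norm (X \<omega>)}"
        using L by (intro mult_right_mono) auto
      also have "\<dots> \<le> c * (\<alpha> m / (\<delta> / l) ^ 4)"
        using tail_prob_le_alpha[OF m k] unfolding b_def mult.assoc by (intro mult_left_mono) auto
      also have "\<dots> = c * (\<alpha> m * l ^ 4) / \<delta> ^ 4" by (simp add: power_divide)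
      also have "\<dots> \<le> c * (1 / l\<^sup>2) / \<delta> ^ 4" using al \<delta> by (intro divide_right_mono mult_left_mono) auto
      also have "\<dots> \<le> \<eta>\<^sup>2 * (\<theta> * l) / 32" using p by (simp add: mult.commute)
      finally show ?thesis by (simp add: L_def R_def mult_ac)
    qed
    show "card J * (u * first_tail b) \<le> \<eta>\<^sup>2 * R / 64"
    proof -
      have "L * (u * first_tail b) \<le> (c * real m) * (u * first_tail b)"
        using L u first_tail_nonneg by (intro mult_right_mono) auto
      also have "\<dots> = c * (u * (m * first_tail b))" by simp
      also have "\<dots> \<le> c * (3 * l / (\<Lambda> * a) * (a * (1 / (\<delta> ^ 3 * l ^ 3) + tail_mean m)))"
      proof -
        have "m * first_tail b \<le> \<Psi> m * (\<alpha> m / (\<delta> / l) ^ 3 + tail_mean m)"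
          unfolding b_def by (rule first_tail_le[OF m k])
        also have "\<dots> \<le> a * (1 / (\<delta> ^ 3 * l ^ 3) + tail_mean m)"
        proof -
          have "\<alpha> m / (\<delta> / l) ^ 3 = \<alpha> m * l ^ 3 / \<delta> ^ 3" by (simp add: power_divide)
          also have "\<dots> \<le> (1 / l ^ 3) / \<delta> ^ 3" using al \<delta> by (intro divide_right_mono) auto
          finally show ?thesis using a unfolding a_def by (intro mult_left_mono) (auto simp: mult.commute)
        qed
        finally have "m * first_tail b \<le> a * (1 / (\<delta> ^ 3 * l ^ 3) + tail_mean m)" .
        from mult_mono[OF ub this] show ?thesis
          using m l \<Lambda> a first_tail_nonneg[of b] by (intro mult_left_mono) auto
      qed
      also have "\<dots> = l * (3 * real c / \<Lambda> * (1 / (\<delta> ^ 3 * l ^ 3) + tail_mean m))" using a by simp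
      also have "\<dots> \<le> l * (\<eta>\<^sup>2 * \<theta> / 32)" using d l by (intro mult_left_mono) auto
      finally show ?thesis by (simp add: L_def R_def mult_ac)
    qed
  qed
  also have "\<dots> \<le> prob {\<omega> \<in> space M.
    (1 - \<eta>) * \<Lambda> * sqrt (\<theta> * (real c - 1) / (c * (1 + \<eta>))) * \<Psi> (real c * real m) \<le> f (\<Sum>i\<in>J. Xs i \<omega>)}"
  proof (rule finite_measure_mono)
    define w where "w = \<Lambda> * sqrt (\<theta> * (real c - 1) / (c * (1 + \<eta>))) * \<Psi> (real c * real m)"
    have lv: "0 < L * v1" using L v1p by simp
    have uL: "u * (L * v1) = sqrt (R * (L * v1))"
    proof -
      have "sqrt (R * (L * v1)) = sqrt (R / (L * v1) * (L * v1)\<^sup>2)" using lv by (simp add: power2_eq_square)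
      also have "\<dots> = u * (L * v1)" using lv by (simp only: real_sqrt_mult u_def real_sqrt_abs abs_of_pos)
      finally show ?thesis by simp
    qed
    have "w \<le> sqrt (R * (L * v1))"
    proof (rule real_le_rsqrt)
      have w2: "w\<^sup>2 = \<Lambda>\<^sup>2 * (\<theta> * (real c - 1) / (c * (1 + \<eta>))) * (real c * real m * h (real c * real m))"
        using \<theta> cr \<eta> m by (simp add: w_def power_mult_distrib Psi_sq)
      also have "\<dots> \<le> \<Lambda>\<^sup>2 * (\<theta> * (real c - 1) / (c * (1 + \<eta>))) * (real c * real m * ((1 + \<eta>) * h n))"
        using flat \<theta> cr \<eta> m by (intro mult_left_mono) auto
      also have "\<dots> = \<Lambda>\<^sup>2 * \<theta> * L * h n" using cr \<eta> by (simp add: L_def cardJ)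
      also have "\<dots> = R * (L * (\<Lambda>\<^sup>2 * h n / (2 * l)))" using l by (simp add: R_def)
      also have "\<dots> \<le> R * (L * v1)" using v1 Rp L by (intro mult_left_mono) auto
      finally show "w\<^sup>2 \<le> R * (L * v1)" .
    qed
    then have "(1 - \<eta>) * w \<le> (1 - \<eta>) * (u * (L * v1))" using \<eta> uL by (intro mult_left_mono) auto
    then have le: "(1 - \<eta>) * \<Lambda> * sqrt (\<theta> * (real c - 1) / (c * (1 + \<eta>))) * \<Psi> (real c * real m) \<le> (1 - \<eta>) * u * (card J * tvar f b)"
      by (simp add: w_def L_def v1_def mult.assoc)
    show "{\<omega> \<in> space M. (1 - \<eta>) * u * (card J * tvar f b) \<le> f (\<Sum>i\<in>J. Xs i \<omega>)} \<subseteq> {\<omega> \<in> space M.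
      (1 - \<eta>) * \<Lambda> * sqrt (\<theta> * (real c - 1) / (c * (1 + \<eta>))) * \<Psi> (real c * real m) \<le> f (\<Sum>i\<in>J. Xs i \<omega>)}"
      by (intro Collect_mono) (use order_trans[OF le] in blast)
    have [measurable]: "(\<lambda>\<omega>. f (\<Sum>i\<in>J. Xs i \<omega>)) \<in> borel_measurable M"
      unfolding J_def by (rule measurable_compose[OF S_meas borel_measurable_dual_ball[OF f]]) simp
    show "{\<omega> \<in> space M. (1 - \<eta>) * \<Lambda> * sqrt (\<theta> * (real c - 1) / (c * (1 + \<eta>))) * \<Psi> (real c * real m) \<le> f (\<Sum>i\<in>J. Xs i \<omega>)} \<in> events"
      by measurable
  qed
  also have "- (1 + 3 * \<eta>) * R / 2 = - (1 + 3 * \<eta>) * \<theta> * l" by (simp add: R_def)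
  finally show ?thesis by (simp only: J_def)
qed

text \<open>Sums over disjoint blocks are independent, and (1 - p)^k <= exp (- p k).\<close>

lemma prob_all_blocks_fail:
  fixes f :: "'b \<Rightarrow> real" and K :: "nat \<Rightarrow> nat set" and G :: "nat set"
  assumes f: "f \<in> dual_ball" and K: "\<And>j. j \<in> G \<Longrightarrow> K j \<subseteq> {1..}" "disjoint_family_on K G" and G: "finite G" "G \<noteq> {}"
    and p: "\<And>j. j \<in> G \<Longrightarrow> p \<le> prob {\<omega> \<in> space M. t j \<le> f (\<Sum>i\<in>K j. Xs i \<omega>)}"
  shows "prob {\<omega> \<in> space M. \<forall>j\<in>G. f (\<Sum>i\<in>K j. Xs i \<omega>) < t j} \<le> exp (- (p * card G))"
    "{\<omega> \<in> space M. \<forall>j\<in>G. f (\<Sum>i\<in>K j. Xs i \<omega>) < t j} \<in> events"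
proof -
  let ?Y = "\<lambda>j \<omega>. restrict (\<lambda>i. Xs i \<omega>) (K j)" and ?P = "\<lambda>j. PiM (K j) (\<lambda>_. borel :: 'b measure)"
  have iv: "indep_vars ?P ?Y G" by (rule indep_vars_restrict[OF Xs_indep K])
  define A where "A = (\<lambda>j. {x \<in> space (?P j). f (\<Sum>i\<in>K j. x i) < t j})"
  have A: "A j \<in> sets (?P j)" if "j \<in> G" for j
  proof -
    have "(\<lambda>x. \<Sum>i\<in>K j. x i :: 'b) \<in> borel_measurable (?P j)" by (intro borel_measurable_sum measurable_component_singleton)
    from measurable_compose[OF this borel_measurable_dual_ball[OF f]]
    have [measurable]: "(\<lambda>x. f (\<Sum>i\<in>K j. x i)) \<in> borel_measurable (?P j)" .
    show ?thesis unfolding A_def by measurable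
  qed
  have eq: "?Y j -` A j \<inter> space M = {\<omega> \<in> space M. f (\<Sum>i\<in>K j. Xs i \<omega>) < t j}" for j
  proof -
    have "?Y j \<omega> \<in> space (?P j)" for \<omega> by (auto simp: space_PiM)
    moreover have "(\<Sum>i\<in>K j. ?Y j \<omega> i) = (\<Sum>i\<in>K j. Xs i \<omega>)" for \<omega> by (intro sum.cong) auto
    ultimately show ?thesis unfolding A_def by auto
  qed
  have Sm: "(\<lambda>\<omega>. f (\<Sum>i\<in>K j. Xs i \<omega>)) \<in> borel_measurable M" if "j \<in> G" for j
  proof -
    have "(\<lambda>\<omega>. \<Sum>i\<in>K j. Xs i \<omega>) \<in> borel_measurable M" using K(1)[OF that] Xs_meas by (intro borel_measurable_sum) auto
    from measurable_compose[OF this borel_measurable_dual_ball[OF f]] show ?thesis .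
  qed
  have ev: "{\<omega> \<in> space M. f (\<Sum>i\<in>K j. Xs i \<omega>) < t j} \<in> events" if "j \<in> G" for j
    using Sm[OF that] by measurable
  show "{\<omega> \<in> space M. \<forall>j\<in>G. f (\<Sum>i\<in>K j. Xs i \<omega>) < t j} \<in> events"
    by (rule sets.sets_Collect_finite_All[OF ev G(1)])
  have q: "prob {\<omega> \<in> space M. f (\<Sum>i\<in>K j. Xs i \<omega>) < t j} \<le> exp (- p)" if j: "j \<in> G" for j
  proof -
    have "prob {\<omega> \<in> space M. \<not> f (\<Sum>i\<in>K j. Xs i \<omega>) < t j} = 1 - prob {\<omega> \<in> space M. f (\<Sum>i\<in>K j. Xs i \<omega>) < t j}"
      by (rule prob_neg[OF ev[OF j]])
    then have "prob {\<omega> \<in> space M. f (\<Sum>i\<in>K j. Xs i \<omega>) < t j} \<le> 1 - p" using p[OF j] by (simp add: not_less)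
    also have "\<dots> \<le> exp (- p)" using exp_ge_add_one_self[of "- p"] by simp
    finally show ?thesis .
  qed
  have "{\<omega> \<in> space M. \<forall>j\<in>G. f (\<Sum>i\<in>K j. Xs i \<omega>) < t j} = (\<Inter>j\<in>G. ?Y j -` A j \<inter> space M)"
    unfolding eq using G(2) by blast
  then have "prob {\<omega> \<in> space M. \<forall>j\<in>G. f (\<Sum>i\<in>K j. Xs i \<omega>) < t j} = (\<Prod>j\<in>G. prob (?Y j -` A j \<inter> space M))"
    using indep_varsD[OF iv G(2,1) subset_refl A] by simp
  also have "\<dots> \<le> (\<Prod>j\<in>G. exp (- p))" unfolding eq using q by (intro prod_mono) auto
  also have "\<dots> = exp (- (p * card G))" by (simp add: exp_of_nat_mult[symmetric] mult.commute)
  finally show "prob {\<omega> \<in> space M. \<forall>j\<in>G. f (\<Sum>i\<in>K j. Xs i \<omega>) < t j} \<le> exp (- (p * card G))" .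
qed

text \<open>Each such index contributes more than 1 to the sum of \<alpha> (N j) l^6. The bound
  involves neither s nor J, so these indices are few compared with the length of a long
  range.\<close>

lemma card_large_alpha_le:
  fixes s c l :: real and N :: "nat \<Rightarrow> real"
  assumes c: "1 < c" and s: "0 < s" and l: "0 < l" and N: "\<And>j. N j = s * c ^ j"
  shows "card {j\<in>{..<J}. \<not> \<alpha> (N j) * l ^ 6 \<le> 1} \<le> 4 * (1 + c) / (c - 1) * expectation (\<lambda>\<omega>. \<Psi>i (norm (X \<omega>))) * l ^ 6"
proof -
  let ?B = "{j\<in>{..<J}. \<not> \<alpha> (N j) * l ^ 6 \<le> 1}"
  have Np: "0 < N j" for j using s c by (simp add: N)
  have "card ?B = (\<Sum>j\<in>?B. 1::real)" by simp
  also have "\<dots> \<le> (\<Sum>j\<in>?B. \<alpha> (N j) * l ^ 6)" by (intro sum_mono) auto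
  also have "\<dots> \<le> (\<Sum>j<J. \<alpha> (N j) * l ^ 6)"
    using alpha_nonneg[OF less_imp_le[OF Np]] l by (intro sum_mono2) auto
  also have "\<dots> = (\<Sum>j<J. \<alpha> (N j)) * l ^ 6" by (simp add: sum_distrib_right)
  also have "\<dots> \<le> 4 * (1 + c) / (c - 1) * expectation (\<lambda>\<omega>. \<Psi>i (norm (X \<omega>))) * l ^ 6"
    using l s c by (intro mult_right_mono sum_alpha_le[OF c s]) (auto simp: N)
  finally show ?thesis .
qed

text \<open>Used with z the logarithm of the index: the first part says that the discarded blocks,
  of order (ln z)^6, are outnumbered; the second that z^\<tau> trials of success probability about
  z^(-\<theta>') are enough.\<close>

lemma eventually_ln_power_le_powr:
  fixes \<tau> \<theta>' C K B :: real
  assumes \<tau>: "0 < \<tau>" "\<theta>' < \<tau>" and C: "0 < C"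
  shows "eventually (\<lambda>z::real. K * (ln z) ^ 6 + B \<le> C * z powr \<tau> \<and> B \<le> C * z powr (\<tau> - \<theta>')) at_top"
proof -
  have \<tau>2: "0 < \<tau> / 2" and d: "0 < \<tau> - \<theta>'" using \<tau> by auto
  define D where "D = \<bar>K\<bar> * (2 / \<tau>) ^ 6"
  have "eventually (\<lambda>z::real. (ln (z powr (\<tau>/2))) ^ 6 \<le> z powr (\<tau>/2)) at_top"
    by (rule eventually_compose_filterlim[OF eventually_ln_power_le powr_at_top[OF \<tau>2]])
  then show ?thesis
    using eventually_powr_ge[OF \<tau>2, of "(D + \<bar>B\<bar>) / C"] eventually_powr_ge[OF d, of "B / C"] eventually_ge_at_top[of 1]
  proof eventually_elim
    case (elim z)
    have "ln z = (2 / \<tau>) * ln (z powr (\<tau>/2))" using elim \<tau> by (simp add: ln_powr)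
    then have "(ln z) ^ 6 = (2 / \<tau>) ^ 6 * (ln (z powr (\<tau>/2))) ^ 6" by (simp only: power_mult_distrib)
    also have "\<dots> \<le> (2 / \<tau>) ^ 6 * z powr (\<tau>/2)" using elim(1) \<tau> by (intro mult_left_mono) auto
    finally have "\<bar>K\<bar> * (ln z) ^ 6 \<le> \<bar>K\<bar> * ((2 / \<tau>) ^ 6 * z powr (\<tau>/2))" by (intro mult_left_mono) auto
    moreover have "K * (ln z) ^ 6 \<le> \<bar>K\<bar> * (ln z) ^ 6" by (intro mult_right_mono) auto
    ultimately have 1: "K * (ln z) ^ 6 \<le> D * z powr (\<tau>/2)" by (simp add: D_def)
    have z1: "1 \<le> z powr (\<tau>/2)" using elim \<tau> by (intro ge_one_powr_ge_zero) auto
    have "B \<le> \<bar>B\<bar> * z powr (\<tau>/2)" using mult_left_mono[OF z1, of "\<bar>B\<bar>"] by simp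
    then have "K * (ln z) ^ 6 + B \<le> (D + \<bar>B\<bar>) * z powr (\<tau>/2)" using 1 by (simp add: algebra_simps)
    also have "\<dots> \<le> (C * z powr (\<tau>/2)) * z powr (\<tau>/2)"
      using elim(2) C by (intro mult_right_mono) (auto simp: divide_le_eq mult.commute)
    also have "\<dots> = C * z powr \<tau>" using elim by (simp add: powr_add[symmetric])
    finally show ?case using elim(3) C by (auto simp: divide_le_eq mult.commute)
  qed
qed

end

lemma f_tau_ge: "exp 1 \<le> t \<Longrightarrow> f_tau \<tau> t = exp (ln t powr \<tau>)"
  by (simp add: f_tau_def L_eq)

context banach_iid
begin

text \<open>For fixed N the event gets probability at least 1 - exp (- B) for every B, each time
  from one large n; the intersection over N is left for later. The condition on \<theta> makes room
  for the factor 1 + 3 \<eta> that tilting loses in the exponent.\<close>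

theorem lower_bound_AE:
  fixes c :: nat and \<tau> \<theta> \<eta> \<Lambda> :: real
  assumes \<tau>: "\<tau> \<le> 1" "((\<lambda>t. h (t * f_tau \<tau> t) / h t) \<longlongrightarrow> 1) at_top"
    and \<eta>: "0 < \<eta>" "\<eta> \<le> 1/2" and \<theta>: "0 < \<theta>" "\<theta> * (1 + 3 * \<eta>) < \<tau>" and c: "2 \<le> c" and \<Lambda>: "0 < \<Lambda>"
    and freq: "frequently (\<lambda>x. \<Lambda>\<^sup>2 < 2 * \<Psi>i (x * LL x) / (x\<^sup>2 * LL x) * H x) at_top"
  shows "AE \<omega> in M. \<exists>m\<ge>N. 
    (1 - \<eta>) * \<Lambda> * sqrt (\<theta> * (real c - 1) / (c * (1 + \<eta>))) * \<Psi> (real c * real m) \<le> norm (S (c * m) \<omega> - S m \<omega>)"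
proof -
  define \<kappa> where "\<kappa> = (1 - \<eta>) * \<Lambda> * sqrt (\<theta> * (real c - 1) / (c * (1 + \<eta>)))"
  define \<theta>' where "\<theta>' = \<theta> * (1 + 3 * \<eta>)"
  define E where "E = {\<omega> \<in> space M. \<exists>m\<ge>N. \<kappa> * \<Psi> (real c * real m) \<le> norm (S (c * m) \<omega> - S m \<omega>)}"
  have "{\<omega> \<in> space M. \<exists>m. N \<le> m \<and> \<kappa> * \<Psi> (real c * real m) \<le> norm (S (c * m) \<omega> - S m \<omega>)} \<in> events"
    by measurable
  then have E: "E \<in> events" by (simp add: E_def)
  have cr: "2 \<le> real c" "1 < real c" using c by auto
  have lc: "0 < ln (real c)" using cr by simp
  have th1: "\<theta> \<le> 1"
  proof -
    have "\<theta> * 1 \<le> \<theta> * (1 + 3 * \<eta>)" using \<theta> \<eta> by (intro mult_left_mono) auto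
    then show ?thesis using \<theta> \<tau> by linarith
  qed
  have th': "0 < \<theta>'" "\<theta>' < \<tau>" using \<theta> \<eta> by (auto simp: \<theta>'_def)
  have tau0: "0 < \<tau>" using th' by linarith
  define \<delta> where "\<delta> = min 1 (\<Lambda> * ln (1 + \<eta>\<^sup>2 / 64) / 6)"
  have ln0: "0 < ln (1 + \<eta>\<^sup>2 / 64)" using \<eta> by (intro ln_gt_zero) auto
  have \<delta>: "0 < \<delta>" "\<delta> \<le> 1" using \<Lambda> ln0 by (auto simp: \<delta>_def)
  have e\<delta>: "exp (6 * \<delta> / \<Lambda>) - 1 \<le> \<eta>\<^sup>2 / 64"
  proof -
    have "6 * \<delta> / \<Lambda> \<le> ln (1 + \<eta>\<^sup>2 / 64)" using \<Lambda> by (simp add: \<delta>_def divide_le_eq min_le_iff_disj mult.commute)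
    then have "exp (6 * \<delta> / \<Lambda>) \<le> exp (ln (1 + \<eta>\<^sup>2 / 64))" by (simp only: exp_le_cancel_iff)
    also have "\<dots> = 1 + \<eta>\<^sup>2 / 64" using \<eta> by (intro exp_ln add_pos_nonneg) auto
    finally show ?thesis by simp
  qed
  \<comment> \<open>From block \<open>J0\<close> on, \<Psi> (m j) >= (2 / \<delta>) \<Psi> n, so the
    truncation level of the block is at least x, where the variance of f is known. The factor 2 pays
    for l <= 2 LL x.\<close>
  obtain J0 where J0: "4 / \<delta>\<^sup>2 < real c ^ J0" using real_arch_pow[OF cr(2)] by blast
  define K where "K = 4 * (1 + real c) / (real c - 1) * expectation (\<lambda>\<omega>. \<Psi>i (norm (X \<omega>)))"
  have step: "1 - exp (- B) \<le> prob E" if B: "0 < B" for B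
  proof -
    have ev_flat: "eventually (\<lambda>t. h (t * f_tau \<tau> t) / h t < 1 + \<eta>) at_top"
      using order_tendstoD(2)[OF \<tau>(2), of "1 + \<eta>"] \<eta> by simp
    have ev_mid: "eventually (\<lambda>t. tail_mean t < \<Lambda> * \<eta>\<^sup>2 * \<theta> / (192 * real c)) at_top"
      by (rule order_tendstoD(2)[OF tail_mean_tendsto_0]) (use \<Lambda> \<eta> \<theta> c in simp)
    \<comment> \<open>The three thresholds yield, in this order, the exceedance condition, the drift
      condition and the lower bound on R in \<open>block_success_prob\<close>.\<close>
    define l0 where "l0 = max (max (32 * real c / (\<delta> ^ 4 * \<eta>\<^sup>2 * \<theta>)) (192 * real c / (\<delta> ^ 3 * \<Lambda> * \<eta>\<^sup>2 * \<theta>))) (2 * ln 4 / (\<eta>\<^sup>2 * \<theta>))"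
    have "0 < \<eta>\<^sup>2 / (1024 * \<theta>)" using \<eta> \<theta> by simp
    from eventually_LL_le_powr[OF zero_less_one this]
    have ev_lin: "eventually (\<lambda>t. LL t \<le> \<eta>\<^sup>2 / (1024 * \<theta>) * t powr 1) at_top" .
    have "0 < 1 / (8 * ln (real c))" using lc by simp
    from eventually_compose_filterlim[OF eventually_ln_power_le_powr[OF tau0 th'(2) this, of K "2 + 1 + real J0 + 2 * B"] ln_at_top]
    have ev_cnt: "eventually (\<lambda>t. K * (ln (ln t)) ^ 6 + (2 + 1 + real J0 + 2 * B) \<le> 1 / (8 * ln (real c)) * (ln t) powr \<tau>
      \<and> (2 + 1 + real J0 + 2 * B) \<le> 1 / (8 * ln (real c)) * (ln t) powr (\<tau> - \<theta>')) at_top" .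
    have ev_two: "eventually (\<lambda>t. 2 * ln 2 \<le> (ln t) powr \<tau>) at_top"
      by (rule eventually_compose_filterlim[OF eventually_powr_ge[OF tau0] ln_at_top])
    have "eventually (\<lambda>t. (h (t * f_tau \<tau> t) / h t < 1 + \<eta> \<and> tail_mean t < \<Lambda> * \<eta>\<^sup>2 * \<theta> / (192 * real c) \<and> l0 \<le> LL t)
      \<and> LL t \<le> \<eta>\<^sup>2 / (1024 * \<theta>) * t powr 1 \<and> \<Psi> t \<le> t \<and> t powr (1/4) \<le> (1/2) * \<Psi> t / LL t \<and> LL t \<le> (1 + 1) * LL (t powr (1/4))
      \<and> (K * (ln (ln t)) ^ 6 + (2 + 1 + real J0 + 2 * B) \<le> 1 / (8 * ln (real c)) * (ln t) powr \<tau>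
      \<and> (2 + 1 + real J0 + 2 * B) \<le> 1 / (8 * ln (real c)) * (ln t) powr (\<tau> - \<theta>'))
      \<and> 2 * ln 2 \<le> (ln t) powr \<tau> \<and> exp (exp 1) \<le> t \<and> real N \<le> t \<and> 4 \<le> t) at_top"
      by (intro eventually_conj ev_flat ev_mid eventually_LL_ge ev_lin eventually_Psi_le eventually_Psi_div_LL_ge
          eventually_LL_root ev_cnt ev_two eventually_ge_at_top) auto
    then obtain T0 where T0: "\<And>t. T0 \<le> t \<Longrightarrow> (h (t * f_tau \<tau> t) / h t < 1 + \<eta> \<and> tail_mean t < \<Lambda> * \<eta>\<^sup>2 * \<theta> / (192 * real c) \<and> l0 \<le> LL t)
      \<and> LL t \<le> \<eta>\<^sup>2 / (1024 * \<theta>) * t powr 1 \<and> \<Psi> t \<le> t \<and> t powr (1/4) \<le> (1/2) * \<Psi> t / LL t \<and> LL t \<le> (1 + 1) * LL (t powr (1/4))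
      \<and> (K * (ln (ln t)) ^ 6 + (2 + 1 + real J0 + 2 * B) \<le> 1 / (8 * ln (real c)) * (ln t) powr \<tau>
      \<and> (2 + 1 + real J0 + 2 * B) \<le> 1 / (8 * ln (real c)) * (ln t) powr (\<tau> - \<theta>'))
      \<and> 2 * ln 2 \<le> (ln t) powr \<tau> \<and> exp (exp 1) \<le> t \<and> real N \<le> t \<and> 4 \<le> t"
      unfolding eventually_at_top_linorder by blast
    obtain x where x: "max 1 (\<Psi> (max T0 0)) \<le> x" "\<Lambda>\<^sup>2 < 2 * \<Psi>i (x * LL x) / (x\<^sup>2 * LL x) * H x"
      using frequently_eventually_frequently[OF freq eventually_ge_at_top[of "max 1 (\<Psi> (max T0 0))"]]
      by (auto dest!: frequently_ex)
    have LLx: "1 \<le> LL x" by (rule LL_ge_1)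
    have x1: "1 \<le> x" using x(1) by simp
    have xy: "x \<le> x * LL x" using x1 LLx by (simp add: mult_le_cancel_left1)
    define n where "n = \<Psi>i (x * LL x)"
    have n0: "0 \<le> n" and \<Psi>n: "\<Psi> n = x * LL x" using Psi_inv_props[of "x * LL x"] x1 LLx by (auto simp: n_def)
    have nT: "T0 \<le> n"
    proof -
      have "\<Psi> (max T0 0) \<le> x" using x(1) by simp
      then have "\<Psi> (max T0 0) \<le> \<Psi> n" using xy unfolding \<Psi>n by linarith
      then have "max T0 0 \<le> n" using n0 by (subst (asm) Psi_le_iff) auto
      then show ?thesis by simp
    qed
    note Pn = T0[OF nT]
    have n4: "4 \<le> n" using Pn by blast
    define n1 where "n1 = nat \<lceil>n\<rceil>"
    have n1: "n \<le> real n1" "real n1 \<le> 2 * n"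
    proof -
      have "real n1 = of_int \<lceil>n\<rceil>" using n0 by (simp add: n1_def of_nat_nat)
      then show "n \<le> real n1" "real n1 \<le> 2 * n" using ceiling_correct[of n] n4 by linarith+
    qed
    have n1T: "T0 \<le> real n1" using nT n1 by linarith
    note Pn1 = T0[OF n1T]
    define l where "l = LL (real n1)"
    define z where "z = ln (real n1)"
    have l1: "1 \<le> l" unfolding l_def by (rule LL_ge_1)
    have ee: "exp (exp 1) \<le> real n1" using Pn1 by blast
    have lz: "l = ln z" unfolding l_def z_def by (rule LL_eq[OF ee])
    have z0: "1 < z"
    proof -
      have "exp 1 \<le> z" unfolding z_def using ee by (metis exp_gt_zero ln_exp ln_mono)
      moreover have "(1::real) < exp 1" by simp
      ultimately show ?thesis by linarith
    qed
    have x_le: "x \<le> n" using xy \<Psi>n Pn by linarith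
    then have LLxl: "LL x \<le> l" unfolding l_def using n1 by (intro LL_mono) linarith
    \<comment> \<open>x = \<Psi> n / LL x exceeds the fourth root of \<open>n1\<close>, and a fourth
      root at most halves LL for large arguments.\<close>
    have lLLx: "l \<le> 2 * LL x"
    proof -
      have "x = \<Psi> n / LL x" using \<Psi>n LLx by simp
      also have "\<Psi> n / LL x \<ge> \<Psi> n / LL n" using LL_mono[OF x_le] LLx Psi_nonneg[OF n0] by (intro divide_left_mono) auto
      finally have "\<Psi> n / LL n \<le> x" .
      moreover have "n powr (1/4) \<le> (1/2) * \<Psi> n / LL n" using Pn by blast
      ultimately have "2 * n powr (1/4) \<le> x" by simp
      moreover have "(2 * n) powr (1/4) \<le> 2 * n powr (1/4)"
      proof -
        have "(2::real) powr (1/4) \<le> 2 powr 1" by (intro powr_mono) auto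
        then have "2 powr (1/4) * n powr (1/4) \<le> 2 * n powr (1/4)" by (intro mult_right_mono) auto
        then show ?thesis using n0 by (simp add: powr_mult)
      qed
      moreover have "(real n1) powr (1/4) \<le> (2 * n) powr (1/4)" using n1 by (intro powr_mono2) auto
      ultimately have "(real n1) powr (1/4) \<le> x" by linarith
      then have "LL ((real n1) powr (1/4)) \<le> LL x" by (rule LL_mono)
      moreover have "LL (real n1) \<le> (1 + 1) * LL ((real n1) powr (1/4))" using Pn1 by blast
      ultimately show ?thesis unfolding l_def by simp
    qed
    have npos: "0 < n" using n4 by linarith
    have hn: "0 < h n" by (rule h_pos[OF n0])
    have "\<Lambda>\<^sup>2 * h n / (2 * l) < H x"
    proof -
      have sq: "n * h n = (x * LL x)\<^sup>2" using Psi_sq[OF n0] \<Psi>n by simp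
      have "\<Lambda>\<^sup>2 * (x\<^sup>2 * LL x) < 2 * n * H x" using x(2) x1 LLx unfolding n_def[symmetric] by (simp add: field_simps)
      then have "\<Lambda>\<^sup>2 * (x\<^sup>2 * LL x) * LL x < 2 * n * H x * LL x" using LLx by (intro mult_strict_right_mono) auto
      then have "\<Lambda>\<^sup>2 * (n * h n) < 2 * n * H x * LL x" unfolding sq by (simp add: power2_eq_square mult_ac)
      then have "n * (\<Lambda>\<^sup>2 * h n) < n * (2 * H x * LL x)" by (simp add: mult_ac)
      then have "\<Lambda>\<^sup>2 * h n < 2 * H x * LL x" using npos by simp
      also have "\<dots> \<le> 2 * H x * l" using LLxl H_nonneg[of x] by (intro mult_left_mono) auto
      finally show ?thesis using l1 by (simp add: divide_less_eq mult_ac)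
    qed
    then obtain f where f: "f \<in> dual_ball" and fvar: "\<Lambda>\<^sup>2 * h n / (2 * l) < tvar f x"
      unfolding tvar_def by (rule H_attained)
    define m where "m = (\<lambda>j. n1 * c ^ j)"
    define Kb where "Kb = (\<lambda>j. {Suc (m j)..c * m j})"
    \<comment> \<open>Half of the logarithmic length of the flat range goes to the c^J; the other
      half absorbs the factor 2 from rounding n up to \<open>n1\<close>. Together 2 c^J <=
      f_\<tau>(n).\<close>
    define J where "J = nat \<lfloor>(ln n) powr \<tau> / (2 * ln (real c))\<rfloor>"
    define G where "G = {j\<in>{J0..<J}. \<alpha> (real (m j)) * l ^ 6 \<le> 1}"
    have m_ge: "n1 \<le> m j" for j using c by (simp add: m_def)
    have mr: "real (m j) = real n1 * real c ^ j" for j by (simp add: m_def)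
    have lnn: "0 < ln n" "z / 2 \<le> ln n"
    proof -
      show "0 < ln n" using n4 by simp
      have "ln 2 \<le> ln n / 1" using n4 by (simp)
      moreover have "z \<le> ln (2 * n)" unfolding z_def using n1 npos by (intro ln_mono) auto
      moreover have "ln (2 * n) = ln 2 + ln n" using npos by (simp add: ln_mult)
      ultimately show "z / 2 \<le> ln n" by linarith
    qed
    have Jr: "real J \<le> (ln n) powr \<tau> / (2 * ln (real c))" "(ln n) powr \<tau> / (2 * ln (real c)) < real J + 1"
    proof -
      have "0 \<le> (ln n) powr \<tau> / (2 * ln (real c))" using lc by simp
      then show "real J \<le> (ln n) powr \<tau> / (2 * ln (real c))" "(ln n) powr \<tau> / (2 * ln (real c)) < real J + 1"
        by (auto simp: J_def)
    qed
    have block: "exp (- (1 + 3 * \<eta>) * \<theta> * l) / 2 \<le> prob {\<omega> \<in> space M. \<kappa> * \<Psi> (real c * real (m j)) \<le> f (\<Sum>i\<in>Kb j. Xs i \<omega>)}"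
      if j: "j \<in> G" for j
      unfolding \<kappa>_def Kb_def
    proof (rule block_success_prob[OF f npos _ c l1 \<delta> \<Lambda> \<eta> \<theta>(1) th1])
      have jJ: "J0 \<le> j" "j < J" using j by (auto simp: G_def)
      have mn1: "real n1 \<le> real (m j)" using m_ge[of j] by simp
      show "n \<le> real (m j)" using mn1 n1 by linarith
      have mT: "T0 \<le> real (m j)" using mn1 n1T by linarith
      note Pm = T0[OF mT]
      show "\<Lambda>\<^sup>2 * h n / (2 * l) \<le> tvar f (\<delta> * \<Psi> (real (m j)) / l)"
      proof -
        have "(2 / \<delta>)\<^sup>2 * n \<le> real c ^ J0 * real n1"
          using J0 n1 npos by (intro mult_mono) (auto simp: power_divide)
        also have "\<dots> \<le> real c ^ j * real n1" using jJ cr by (intro mult_right_mono power_increasing) auto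
        finally have "(2 / \<delta>)\<^sup>2 * n \<le> real (m j)" by (simp add: mr mult.commute)
        then have "\<Psi> ((2 / \<delta>)\<^sup>2 * n) \<le> \<Psi> (real (m j))" using npos by (intro Psi_mono) auto
        moreover have "2 / \<delta> * \<Psi> n \<le> \<Psi> ((2 / \<delta>)\<^sup>2 * n)" using \<delta> n0 by (intro Psi_scale_ge(1)) (auto simp: le_divide_eq)
        ultimately have "2 / \<delta> * \<Psi> n \<le> \<Psi> (real (m j))" by linarith
        then have "2 * \<Psi> n \<le> \<delta> * \<Psi> (real (m j))" using \<delta> by (simp add: divide_le_eq mult.commute)
        then have le: "2 * \<Psi> n / l \<le> \<delta> * \<Psi> (real (m j)) / l" using l1 by (intro divide_right_mono) auto
        have "x * l \<le> x * (2 * LL x)" using lLLx x1 by (intro mult_left_mono) auto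
        then have "x * l \<le> 2 * \<Psi> n" using \<Psi>n by simp
        then have "x \<le> 2 * \<Psi> n / l" using l1 by (simp add: le_divide_eq)
        then have "x \<le> \<delta> * \<Psi> (real (m j)) / l" using le by linarith
        then have "tvar f x \<le> tvar f (\<delta> * \<Psi> (real (m j)) / l)" unfolding tvar_def by (rule truncated_square_mono[OF f])
        then show ?thesis using fvar by linarith
      qed
      show "h (real c * real (m j)) \<le> (1 + \<eta>) * h n"
      proof -
        have "real c * real (m j) = real n1 * real c ^ Suc j" by (simp add: mr)
        also have "\<dots> \<le> (2 * n) * real c ^ J" using jJ n1 cr npos by (intro mult_mono power_increasing) auto
        also have "\<dots> = n * (2 * real c ^ J)" by simp
        also have "\<dots> \<le> n * f_tau \<tau> n"
        proof (rule mult_left_mono)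
          have e: "exp (ln n powr \<tau> / 2) * exp (ln n powr \<tau> / 2) = f_tau \<tau> n"
          proof -
            have "exp 1 \<le> n"
            proof -
              have "exp 1 \<le> (3::real)" by (rule exp_le)
              then show ?thesis using n4 by linarith
            qed
            then show ?thesis by (simp add: f_tau_ge flip: exp_add)
          qed
          have "2 = exp (ln 2 :: real)" by simp
          also have "\<dots> \<le> exp (ln n powr \<tau> / 2)" using Pn by (subst exp_le_cancel_iff) linarith
          finally have two: "2 \<le> exp (ln n powr \<tau> / 2)" .
          have "real c ^ J = exp (J * ln (real c))" using cr by (simp add: exp_of_nat_mult)
          also have "\<dots> \<le> exp (ln n powr \<tau> / 2)"
            using Jr(1) lc by (subst exp_le_cancel_iff) (simp add: le_divide_eq)
          finally have "2 * real c ^ J \<le> exp (ln n powr \<tau> / 2) * exp (ln n powr \<tau> / 2)"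
            using two cr by (intro mult_mono) auto
          then show "2 * real c ^ J \<le> f_tau \<tau> n" using e by simp
        qed (use n0 in simp)
        finally have "h (real c * real (m j)) \<le> h (n * f_tau \<tau> n)" by (intro h_mono) auto
        also have "\<dots> \<le> (1 + \<eta>) * h n" 
        proof -
          have "h (n * f_tau \<tau> n) / h n < 1 + \<eta>" using Pn by blast
          then show ?thesis using hn by (simp only: pos_divide_less_eq less_imp_le)
        qed
        finally show ?thesis .
      qed
      show "\<alpha> (real (m j)) * l ^ 6 \<le> 1" using j by (simp add: G_def)
      show "exp (6 * \<delta> / \<Lambda>) - 1 \<le> \<eta>\<^sup>2 / 64" by (rule e\<delta>)
      have l0: "32 * real c / (\<delta> ^ 4 * \<eta>\<^sup>2 * \<theta>) \<le> l" "192 * real c / (\<delta> ^ 3 * \<Lambda> * \<eta>\<^sup>2 * \<theta>) \<le> l" "2 * ln 4 / (\<eta>\<^sup>2 * \<theta>) \<le> l"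
        using Pn1 unfolding l0_def l_def by auto
      have l23: "l \<le> l\<^sup>2" "l \<le> l ^ 3" using power_increasing[of 1 2 l] power_increasing[of 1 3 l] l1 by auto
      show "real c / (\<delta> ^ 4 * l\<^sup>2) \<le> \<eta>\<^sup>2 * (\<theta> * l) / 32"
      proof -
        have "32 * real c \<le> l * (\<delta> ^ 4 * \<eta>\<^sup>2 * \<theta>)" using l0(1) \<delta> \<eta> \<theta> by (simp add: divide_le_eq)
        also have "\<dots> \<le> l ^ 3 * (\<delta> ^ 4 * \<eta>\<^sup>2 * \<theta>)" using l23 \<theta> by (intro mult_right_mono) auto
        finally have "32 * real c \<le> l ^ 3 * (\<delta> ^ 4 * \<eta>\<^sup>2 * \<theta>)" .
        also have "\<dots> = \<eta>\<^sup>2 * (\<theta> * l) * (\<delta> ^ 4 * l\<^sup>2)" by (simp add: power2_eq_square power3_eq_cube)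
        finally show ?thesis using \<delta> l1 by (simp add: divide_le_eq)
      qed
      show "3 * real c / \<Lambda> * (1 / (\<delta> ^ 3 * l ^ 3) + tail_mean (real (m j))) \<le> \<eta>\<^sup>2 * \<theta> / 32"
      proof -
        have "192 * real c \<le> l * (\<delta> ^ 3 * \<Lambda> * \<eta>\<^sup>2 * \<theta>)" using l0(2) \<delta> \<eta> \<theta> \<Lambda> by (simp add: divide_le_eq)
        also have "\<dots> \<le> l ^ 3 * (\<delta> ^ 3 * \<Lambda> * \<eta>\<^sup>2 * \<theta>)" using l23 \<theta> \<Lambda> \<delta> by (intro mult_right_mono) auto
        finally have "192 * real c \<le> \<Lambda> * \<eta>\<^sup>2 * \<theta> * (\<delta> ^ 3 * l ^ 3)" by (simp add: mult_ac)
        then have "1 / (\<delta> ^ 3 * l ^ 3) \<le> \<Lambda> * \<eta>\<^sup>2 * \<theta> / (192 * real c)" using \<delta> l1 cr by (simp add: divide_le_eq le_divide_eq mult_ac)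
        moreover have "tail_mean (real (m j)) < \<Lambda> * \<eta>\<^sup>2 * \<theta> / (192 * real c)" using Pm by blast
        ultimately have "1 / (\<delta> ^ 3 * l ^ 3) + tail_mean (real (m j)) \<le> \<Lambda> * \<eta>\<^sup>2 * \<theta> / (192 * real c) + \<Lambda> * \<eta>\<^sup>2 * \<theta> / (192 * real c)"
          by (intro add_mono) auto
        then have "3 * real c / \<Lambda> * (1 / (\<delta> ^ 3 * l ^ 3) + tail_mean (real (m j))) \<le> 3 * real c / \<Lambda> * (\<Lambda> * \<eta>\<^sup>2 * \<theta> / (192 * real c) + \<Lambda> * \<eta>\<^sup>2 * \<theta> / (192 * real c))"
          using \<Lambda> by (intro mult_left_mono) auto
        also have "\<dots> = \<eta>\<^sup>2 * \<theta> / 32" using \<Lambda> cr by (simp add: field_simps)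
        finally show ?thesis .
      qed
      show "1024 * (\<theta> * l) \<le> \<eta>\<^sup>2 * real (m j)"
      proof -
        have "l \<le> \<eta>\<^sup>2 / (1024 * \<theta>) * real n1 powr 1" using Pn1 unfolding l_def by blast
        then have "l \<le> \<eta>\<^sup>2 * real n1 / (1024 * \<theta>)" by simp
        then have "1024 * (\<theta> * l) \<le> \<eta>\<^sup>2 * real n1" using \<theta> by (simp add: le_divide_eq mult_ac)
        also have "\<dots> \<le> \<eta>\<^sup>2 * real (m j)" using mn1 by (intro mult_left_mono) auto
        finally show ?thesis .
      qed
      show "4 * ln 4 \<le> 2 * (\<eta>\<^sup>2 * (\<theta> * l))" using l0(3) \<eta> \<theta> by (simp add: divide_le_eq mult_ac)
    qed
    \<comment> \<open>J + 1 exceeds z^\<tau> / (4 ln c), and at most half of this is lost to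
      rounding, to the first \<open>J0\<close> blocks and to those with large \<alpha>.\<close>
    have cardG: "1 / (8 * ln (real c)) * z powr \<tau> \<le> real (card G)"
    proof -
      let ?bad = "{j\<in>{..<J}. \<not> \<alpha> (real (m j)) * l ^ 6 \<le> 1}"
      have n1p: "0 < real n1" using n1 npos by linarith
      have bad: "real (card ?bad) \<le> K * l ^ 6"
        unfolding K_def by (rule card_large_alpha_le[OF cr(2) n1p]) (use l1 mr in auto)
      have "{..<J} \<subseteq> {..<J0} \<union> (?bad \<union> G)" by (auto simp: G_def)
      then have "card {..<J} \<le> card ({..<J0} \<union> (?bad \<union> G))" by (intro card_mono) (auto simp: G_def)
      also have "\<dots> \<le> card {..<J0} + (card ?bad + card G)"
        by (intro order_trans[OF card_Un_le] add_left_mono card_Un_le)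
      finally have "real J \<le> real J0 + real (card ?bad) + real (card G)" by simp
      then have g: "real J - real J0 - K * l ^ 6 \<le> real (card G)" using bad by linarith
      have "z powr \<tau> / 2 \<le> (z / 2) powr \<tau>"
      proof -
        have "2 powr \<tau> \<le> 2 powr (1::real)" using \<tau> by (intro powr_mono) auto
        then have "z powr \<tau> / 2 \<le> z powr \<tau> / 2 powr \<tau>" by (intro divide_left_mono) auto
        then show ?thesis using z0 by (simp add: powr_divide)
      qed
      also have "\<dots> \<le> (ln n) powr \<tau>" using lnn z0 tau0 by (intro powr_mono2) auto
      finally have "z powr \<tau> / 2 / (2 * ln (real c)) \<le> (ln n) powr \<tau> / (2 * ln (real c))"
        using lc by (intro divide_right_mono) auto
      then have "z powr \<tau> / (4 * ln (real c)) < real J + 1" using Jr(2) by simp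
      moreover have "K * l ^ 6 + (2 + 1 + real J0 + 2 * B) \<le> 1 / (8 * ln (real c)) * z powr \<tau>"
        using Pn1 unfolding lz z_def by blast
      moreover have "z powr \<tau> / (4 * ln (real c)) = 2 * (1 / (8 * ln (real c)) * z powr \<tau>)" by simp
      ultimately show ?thesis using g B by linarith
    qed
    have G_ne: "G \<noteq> {}"
    proof
      assume "G = {}"
      then have "1 / (8 * ln (real c)) * z powr \<tau> \<le> 0" using cardG by simp
      moreover have "0 < 1 / (8 * ln (real c)) * z powr \<tau>" using lc z0 by simp
      ultimately show False by linarith
    qed
    have finG: "finite G" by (simp add: G_def)
    \<comment> \<open>As l = ln z, this success probability is z^(-\<theta>') / 2, a power of the
      logarithm of \<open>n1\<close>.\<close>
    define p where "p = exp (- (1 + 3 * \<eta>) * \<theta> * l) / 2"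
    have pz: "p = z powr (- \<theta>') / 2"
      using z0 by (simp add: p_def powr_def lz \<theta>'_def algebra_simps)
    have pB: "B \<le> p * card G"
    proof -
      have "2 + 1 + real J0 + 2 * B \<le> 1 / (8 * ln (real c)) * z powr (\<tau> - \<theta>')"
        using Pn1 unfolding z_def by blast
      then have "2 * B \<le> 1 / (8 * ln (real c)) * z powr (\<tau> - \<theta>')" by linarith
      also have "\<dots> = z powr (- \<theta>') * (1 / (8 * ln (real c)) * z powr \<tau>)"
        by (simp add: powr_diff powr_minus field_simps)
      also have "\<dots> \<le> z powr (- \<theta>') * real (card G)" by (intro mult_left_mono cardG) simp
      finally show ?thesis by (simp add: pz)
    qed
    let ?F = "{\<omega> \<in> space M. \<forall>j\<in>G. f (\<Sum>i\<in>Kb j. Xs i \<omega>) < \<kappa> * \<Psi> (real c * real (m j))}"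
    have disj: "disjoint_family_on Kb G"
    proof -
      have "Kb i \<inter> Kb j = {}" if "i < j" for i j
      proof -
        have "c * m i = n1 * c ^ Suc i" by (simp add: m_def)
        also have "\<dots> \<le> n1 * c ^ j" using that c by (intro mult_le_mono2 power_increasing) auto
        finally have "c * m i \<le> m j" by (simp add: m_def)
        then show ?thesis by (auto simp: Kb_def)
      qed
      then show ?thesis unfolding disjoint_family_on_def by (metis Int_commute linorder_neqE_nat)
    qed
    have Kb1: "Kb j \<subseteq> {1..}" for j by (auto simp: Kb_def)
    note fail = prob_all_blocks_fail[OF f Kb1 disj finG G_ne block]
    have "space M - ?F \<subseteq> E"
    proof
      fix \<omega> assume w: "\<omega> \<in> space M - ?F"
      then obtain j where j: "j \<in> G" "\<kappa> * \<Psi> (real c * real (m j)) \<le> f (\<Sum>i\<in>Kb j. Xs i \<omega>)" by (auto simp: not_less)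
      have "m j \<le> c * m j" using c by simp
      then have "S (c * m j) \<omega> - S (m j) \<omega> = (\<Sum>i\<in>Kb j. Xs i \<omega>)" using S_split[of "m j" "c * m j" \<omega>] by (simp add: Kb_def)
      then have "\<kappa> * \<Psi> (real c * real (m j)) \<le> norm (S (c * m j) \<omega> - S (m j) \<omega>)"
        using j(2) dual_ballD(2)[OF f, of "\<Sum>i\<in>Kb j. Xs i \<omega>"] by simp
      moreover have "N \<le> m j"
      proof -
        have "real N \<le> real n1" using Pn1 by blast
        then show ?thesis using m_ge[of j] by simp
      qed
      ultimately show "\<omega> \<in> E" using w by (auto simp: E_def)
    qed
    then have "prob (space M - ?F) \<le> prob E" by (rule finite_measure_mono[OF _ E])
    moreover have "prob (space M - ?F) = 1 - prob ?F" by (rule prob_compl[OF fail(2)])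
    moreover have "prob ?F \<le> exp (- B)"
    proof -
      have "prob ?F \<le> exp (- (p * card G))" unfolding p_def by (rule fail(1))
      also have "\<dots> \<le> exp (- B)" using pB by simp
      finally show ?thesis .
    qed
    ultimately show ?thesis by linarith
  qed
  have "1 - prob E \<le> \<epsilon>" if "0 < \<epsilon>" for \<epsilon>
  proof -
    define B where "B = max 1 (- ln \<epsilon>)"
    have "exp (- B) \<le> exp (ln \<epsilon>)" unfolding B_def by (subst exp_le_cancel_iff) linarith
    then have "exp (- B) \<le> \<epsilon>" using that by simp
    moreover have "0 < B" by (simp add: B_def)
    ultimately show ?thesis using step[of B] by linarith
  qed
  then have "1 - prob E \<le> 0" by (rule field_le_epsilon[of _ 0, simplified])
  then have "prob E = 1" using prob_le_1[of E] by linarith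
  then have "AE \<omega> in M. \<omega> \<in> E" using E by (simp add: prob_eq_1)
  then show ?thesis by eventually_elim (auto simp: E_def \<kappa>_def)
qed

end

section \<open>From block increments to the limit superior\<close>

context banach_iid
begin

lemma limsup_nonneg: "0 \<le> limsup (\<lambda>n. ereal (norm (S n \<omega>) / \<Psi> (real n)))"
  by (rule le_Limsup) (auto intro!: always_eventually divide_nonneg_nonneg Psi_nonneg)

text \<open>If the norms stayed below \<kappa> \<Psi>, an increment from m to c m would be at most
  \<kappa> (1 + c^(-1/2)) \<Psi> (c m). For a large ratio c this contradicts the increments found
  above, whose constant tends to (1 - q)^(1/2) \<Lambda>.\<close>

lemma limsup_lower_AE:
  assumes q: "0 \<le> q" "q < 1" and flat: "\<And>\<tau>. 0 < \<tau> \<Longrightarrow> \<tau> < 1 - q \<Longrightarrow> ((\<lambda>t. h (t * f_tau \<tau> t) / h t) \<longlongrightarrow> 1) at_top"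
    and \<Lambda>: "0 < \<Lambda>" and freq: "frequently (\<lambda>x. \<Lambda>\<^sup>2 < 2 * \<Psi>i (x * LL x) / (x\<^sup>2 * LL x) * H x) at_top"
    and \<kappa>: "0 \<le> \<kappa>" "\<kappa> < sqrt (1 - q) * \<Lambda>"
  shows "AE \<omega> in M. ereal \<kappa> \<le> limsup (\<lambda>n. ereal (norm (S n \<omega>) / \<Psi> (real n)))"
proof -
  \<comment> \<open>One parameter drives all limits: the block ratio is c = k and the tolerance is
    \<eta> = 1 / k.\<close>
  define e where "e = (\<lambda>k::nat. 1 / real k)"
  have e0: "e \<longlonglongrightarrow> 0" unfolding e_def by (rule lim_1_over_n)
  have 1: "(\<lambda>k. \<kappa> * (1 + sqrt (e k))) \<longlonglongrightarrow> \<kappa> * (1 + sqrt 0)"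
    by (intro tendsto_intros e0)
  have 2: "(\<lambda>k. (1 - e k) * \<Lambda> * sqrt ((1 - q) * (1 - e k) / (1 + 3 * e k) * ((1 - e k) / (1 + e k))))
      \<longlonglongrightarrow> (1 - 0) * \<Lambda> * sqrt ((1 - q) * (1 - 0) / (1 + 3 * 0) * ((1 - 0) / (1 + 0)))"
    by (intro tendsto_intros e0) auto
  have "(\<lambda>k. (1 - e k) * \<Lambda> * sqrt ((1 - q) * (1 - e k) / (1 + 3 * e k) * ((1 - e k) / (1 + e k))) - \<kappa> * (1 + sqrt (e k)))
      \<longlonglongrightarrow> \<Lambda> * sqrt (1 - q) - \<kappa>"
    using tendsto_diff[OF 2 1] by simp
  then have "eventually (\<lambda>k. 0 < (1 - e k) * \<Lambda> * sqrt ((1 - q) * (1 - e k) / (1 + 3 * e k) * ((1 - e k) / (1 + e k))) - \<kappa> * (1 + sqrt (e k))) sequentially"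
    by (rule order_tendstoD) (use \<kappa> in \<open>simp add: mult.commute\<close>)
  then have "eventually (\<lambda>k. 2 \<le> k \<and> 0 < (1 - e k) * \<Lambda> * sqrt ((1 - q) * (1 - e k) / (1 + 3 * e k) * ((1 - e k) / (1 + e k))) - \<kappa> * (1 + sqrt (e k))) sequentially"
    by (intro eventually_conj eventually_ge_at_top)
  then obtain c where c: "2 \<le> c" and big: "\<kappa> * (1 + sqrt (e c)) < (1 - e c) * \<Lambda> * sqrt ((1 - q) * (1 - e c) / (1 + 3 * e c) * ((1 - e c) / (1 + e c)))"
    by (auto dest!: eventually_happens)
  define \<eta> where "\<eta> = e c"
  define \<theta> where "\<theta> = (1 - q) * (1 - \<eta>) / (1 + 3 * \<eta>)"
  \<comment> \<open>A value strictly between \<theta> (1 + 3 \<eta>) = (1 - q)(1 - \<eta>) and 1 -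
    q.\<close>
  define \<tau> where "\<tau> = (1 - q) * (1 - \<eta> / 2)"
  have \<eta>: "0 < \<eta>" "\<eta> \<le> 1/2" using c by (auto simp: \<eta>_def e_def field_simps)
  have \<theta>: "0 < \<theta>" "\<theta> * (1 + 3 * \<eta>) < \<tau>" using \<eta> q by (auto simp: \<theta>_def \<tau>_def)
  have \<tau>1: "\<tau> < 1 - q" using \<eta> q by (simp add: \<tau>_def mult_less_cancel_left1)
  have \<tau>0: "0 < \<tau>" using \<eta> q by (simp add: \<tau>_def)
  define \<kappa>' where "\<kappa>' = (1 - \<eta>) * \<Lambda> * sqrt (\<theta> * (real c - 1) / (c * (1 + \<eta>)))"
  have "\<theta> * (real c - 1) / (c * (1 + \<eta>)) = \<theta> * ((1 - \<eta>) / (1 + \<eta>))"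
    using c by (simp add: \<eta>_def e_def field_simps)
  then have \<kappa>': "\<kappa> * (1 + sqrt \<eta>) < \<kappa>'" using big by (simp add: \<kappa>'_def \<theta>_def \<eta>_def)
  have "AE \<omega> in M. \<exists>m\<ge>N. \<kappa>' * \<Psi> (real c * real m) \<le> norm (S (c * m) \<omega> - S m \<omega>)" for N
    unfolding \<kappa>'_def
    by (rule lower_bound_AE[OF _ flat[OF \<tau>0 \<tau>1] \<eta> \<theta> c \<Lambda> freq]) (use \<tau>1 q in simp)
  then have "AE \<omega> in M. \<forall>N. \<exists>m\<ge>N. \<kappa>' * \<Psi> (real c * real m) \<le> norm (S (c * m) \<omega> - S m \<omega>)"
    by (simp add: AE_all_countable)
  then show ?thesis
  proof eventually_elim
    case (elim \<omega>)
    show ?case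
    proof (rule ccontr)
      assume "\<not> ?case"
      then have "limsup (\<lambda>n. ereal (norm (S n \<omega>) / \<Psi> (real n))) < ereal \<kappa>" by (simp only: not_le)
      then have "eventually (\<lambda>n. ereal (norm (S n \<omega>) / \<Psi> (real n)) < ereal \<kappa>) sequentially" by (rule Limsup_lessD)
      then obtain n1 where n1: "\<And>n. n1 \<le> n \<Longrightarrow> norm (S n \<omega>) / \<Psi> (real n) < \<kappa>" by (auto simp: eventually_sequentially)
      obtain m where m: "max n1 1 \<le> m" "\<kappa>' * \<Psi> (real c * real m) \<le> norm (S (c * m) \<omega> - S m \<omega>)"
        using elim by blast
      have small: "norm (S n \<omega>) \<le> \<kappa> * \<Psi> (real n)" if "max n1 1 \<le> n" for n
        using n1[of n] Psi_pos[of "real n"] that by (simp add: divide_less_eq)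
      have cm: "max n1 1 \<le> c * m" using m c by (simp add: le_trans[of _ m])
      have P: "\<Psi> (real m) \<le> sqrt \<eta> * \<Psi> (real c * real m)"
      proof -
        have "sqrt (real c) * \<Psi> (real m) \<le> \<Psi> (real c * real m)" using c by (intro Psi_scale_ge(2)) auto
        then have "sqrt \<eta> * (sqrt (real c) * \<Psi> (real m)) \<le> sqrt \<eta> * \<Psi> (real c * real m)"
          using \<eta> by (intro mult_left_mono) auto
        moreover have "sqrt \<eta> * sqrt (real c) = 1" using c by (simp add: \<eta>_def e_def flip: real_sqrt_mult)
        ultimately show ?thesis by (simp flip: mult.assoc)
      qed
      have pos: "0 < \<Psi> (real c * real m)" using m c by (intro Psi_pos) auto
      have "\<kappa>' * \<Psi> (real c * real m) \<le> norm (S (c * m) \<omega>) + norm (S m \<omega>)"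
        using m(2) norm_triangle_ineq4[of "S (c * m) \<omega>" "S m \<omega>"] by linarith
      also have "\<dots> \<le> \<kappa> * \<Psi> (real c * real m) + \<kappa> * (sqrt \<eta> * \<Psi> (real c * real m))"
      proof (rule add_mono)
        show "norm (S (c * m) \<omega>) \<le> \<kappa> * \<Psi> (real c * real m)" using small[OF cm] by simp
        show "norm (S m \<omega>) \<le> \<kappa> * (sqrt \<eta> * \<Psi> (real c * real m))"
          using small[OF m(1)] mult_left_mono[OF P \<kappa>(1)] by linarith
      qed
      also have "\<dots> = \<kappa> * (1 + sqrt \<eta>) * \<Psi> (real c * real m)" by (simp add: algebra_simps)
      also have "\<dots> < \<kappa>' * \<Psi> (real c * real m)" using \<kappa>' pos by (rule mult_strict_right_mono)
      finally show False by simp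
    qed
  qed
qed

end

lemma (in banach_iid_wlln) limsup_upper_AE:
  assumes \<Lambda>: "0 < \<Lambda>" "\<Lambda> < \<Lambda>'"
    and H_lim: "eventually (\<lambda>x. 2 * \<Psi>i (x * LL x) / (x\<^sup>2 * LL x) * H x \<le> \<Lambda>\<^sup>2) at_top"
  shows "AE \<omega> in M. limsup (\<lambda>n. ereal (norm (S n \<omega>) / \<Psi> (real n))) \<le> ereal \<Lambda>'"
  using upper_bound_AE[OF assms]
proof eventually_elim
  case (elim \<omega>)
  show ?case
  proof (rule Limsup_bounded)
    show "eventually (\<lambda>n. ereal (norm (S n \<omega>) / \<Psi> (real n)) \<le> ereal \<Lambda>') sequentially"
      using elim eventually_gt_at_top[of 0]
    proof eventually_elim
      case (elim n)
      then show ?case using Psi_pos[of "real n"] by (simp add: divide_le_eq)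
    qed
  qed
qed

theorem theorem3:
  fixes M :: "'a measure"
    and X :: "'a \<Rightarrow> 'b::{banach, second_countable_topology}"
    and Xs :: "nat \<Rightarrow> 'a \<Rightarrow> 'b"
    and q :: real and h :: "real \<Rightarrow> real" and lam :: ereal
  assumes "prob_space M"
    and "X \<in> borel_measurable M"
    and "\<And>i. i \<ge> 1 \<Longrightarrow> Xs i \<in> borel_measurable M"
    and "prob_space.indep_vars M (\<lambda>_. borel) Xs {1..}"
    and "\<And>i. i \<ge> 1 \<Longrightarrow> distr M borel (Xs i) = distr M borel X"
    and "0 \<le> q" and "q \<le> 1" and "h \<in> class_Hq q"
    and "integrable M X" and "integral\<^sup>L M X = 0"
    and "integrable M (\<lambda>\<omega>. Psi_inv h (norm (X \<omega>)))"
    and "\<And>\<epsilon>. \<epsilon> > 0 \<Longrightarrow>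
          ((\<lambda>n. measure M {\<omega> \<in> space M.
              norm ((\<Sum>i\<in>{1..n}. Xs i \<omega>) /\<^sub>R Psi h (real n)) > \<epsilon>}) \<longlongrightarrow> 0) sequentially"
    and "lam \<ge> 0"
    and "lam * lam = Limsup at_top (\<lambda>x::real.
            ereal (2 * Psi_inv h (x * LL x) / (x\<^sup>2 * LL x) * H_fun M X x))"
  shows "AE \<omega> in M.
           ereal (sqrt (1 - q)) * lam \<le> limsup (\<lambda>n. ereal (norm (\<Sum>i\<in>{1..n}. Xs i \<omega>) / Psi h (real n)))
         \<and> limsup (\<lambda>n. ereal (norm (\<Sum>i\<in>{1..n}. Xs i \<omega>) / Psi h (real n))) \<le> lam"
proof -
  interpret prob_space M by fact
  have hH: "h \<in> class_H" using assms(8) by (auto simp: class_Hq_def split: if_splits)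
  interpret banach_iid_wlln M h X Xs
    by unfold_locales (use assms hH in auto)
  let ?V = "\<lambda>x. 2 * Psi_inv h (x * LL x) / (x\<^sup>2 * LL x) * H_fun M X x"
  let ?L = "\<lambda>\<omega>. limsup (\<lambda>n. ereal (norm (\<Sum>i\<in>{1..n}. Xs i \<omega>) / Psi h (real n)))"
  have lim: "lam * lam = Limsup at_top (\<lambda>x. ereal (?V x))" by fact
  have upper: "AE \<omega> in M. ?L \<omega> \<le> lam"
  proof (cases lam)
    case (real r)
    then have r: "0 \<le> r" using assms(13) by simp
    \<comment> \<open>Approaching lambda strictly from above keeps the auxiliary bound positive, so
      lambda = 0 is included.\<close>
    have "AE \<omega> in M. ?L \<omega> \<le> ereal (r + 2 / real (Suc k))" for k
    proof (rule limsup_upper_AE)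
      let ?\<Lambda> = "r + 1 / real (Suc k)"
      show "0 < ?\<Lambda>" using r by (simp add: add_nonneg_pos)
      show "?\<Lambda> < r + 2 / real (Suc k)" by (simp add: divide_strict_right_mono)
      have "r * r < ?\<Lambda> * ?\<Lambda>" using r by (intro mult_strict_mono') auto
      then have "Limsup at_top (\<lambda>x. ereal (?V x)) < ereal (?\<Lambda>\<^sup>2)"
        unfolding lim[symmetric] real by (simp add: power2_eq_square)
      then have "eventually (\<lambda>x. ereal (?V x) < ereal (?\<Lambda>\<^sup>2)) at_top" by (rule Limsup_lessD)
      then show "eventually (\<lambda>x. ?V x \<le> ?\<Lambda>\<^sup>2) at_top" by eventually_elim simp
    qed
    then have "AE \<omega> in M. \<forall>k. ?L \<omega> \<le> ereal (r + 2 / real (Suc k))" by (simp only: AE_all_countable) blast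
    then show ?thesis
    proof eventually_elim
      case (elim \<omega>)
      have "(\<lambda>k. r + 2 * (1 / real (Suc k))) \<longlonglongrightarrow> r + 2 * 0"
        by (intro tendsto_intros LIMSEQ_Suc[OF lim_1_over_n])
      then have "(\<lambda>k. ereal (r + 2 / real (Suc k))) \<longlonglongrightarrow> ereal r" by simp
      then show ?case unfolding real by (rule LIMSEQ_le_const) (use elim in auto)
    qed
  qed (use assms(13) in auto)
  have lower: "AE \<omega> in M. ereal (sqrt (1 - q)) * lam \<le> ?L \<omega>"
  proof (cases "q = 1")
    \<comment> \<open>The factor is 0, and 0 times infinity is 0 in \<open>ereal\<close>, so
      nonnegativity of the limit superior suffices.\<close>
    case True
    then show ?thesis using limsup_nonneg by (simp add: zero_ereal_def[symmetric])
  next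
    case False
    then have q: "q < 1" using assms(7) by simp
    define s where "s = sqrt (1 - q)"
    have s: "0 < s" using q by (simp add: s_def)
    have flat: "((\<lambda>t. h (t * f_tau \<tau> t) / h t) \<longlongrightarrow> 1) at_top" if "0 < \<tau>" "\<tau> < 1 - q" for \<tau>
      using assms(8) False that by (auto simp: class_Hq_def)
    have one: "AE \<omega> in M. ereal \<kappa> \<le> ?L \<omega>" if \<kappa>: "0 \<le> \<kappa>" "ereal \<kappa> < ereal s * lam" for \<kappa>
    proof -
      \<comment> \<open>For infinite lambda any finite \<Lambda> is admissible, and (\<kappa> + 1) /
        s is large enough.\<close>
      have "\<exists>\<Lambda>>0. \<kappa> < s * \<Lambda> \<and> ereal \<Lambda> < lam"
      proof (cases lam)
        case (real r)
        then have "\<kappa> / s < r" using \<kappa> s by (simp add: divide_less_eq mult.commute)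
        then obtain \<Lambda> where \<Lambda>: "\<kappa> / s < \<Lambda>" "\<Lambda> < r" using dense by blast
        have "0 \<le> \<kappa> / s" using \<kappa> s by simp
        then have "0 < \<Lambda>" using \<Lambda> by linarith
        then show ?thesis using s real \<Lambda> by (intro exI[of _ \<Lambda>]) (auto simp: divide_less_eq mult.commute)
      next
        case PInf
        have "\<kappa> < s * ((\<kappa> + 1) / s)" using s by simp
        then show ?thesis using s \<kappa> PInf by (intro exI[of _ "(\<kappa> + 1) / s"]) auto
      qed (use assms(13) in auto)
      then obtain \<Lambda> where \<Lambda>: "0 < \<Lambda>" "\<kappa> < s * \<Lambda>" "ereal \<Lambda> < lam" by blast
      have lt: "ereal (\<Lambda>\<^sup>2) < lam * lam"
        using \<Lambda> by (cases lam) (auto simp: power2_eq_square intro!: mult_strict_mono)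
      have freq: "frequently (\<lambda>x. \<Lambda>\<^sup>2 < ?V x) at_top"
        unfolding frequently_def
      proof
        assume "eventually (\<lambda>x. \<not> \<Lambda>\<^sup>2 < ?V x) at_top"
        then have "eventually (\<lambda>x. ereal (?V x) \<le> ereal (\<Lambda>\<^sup>2)) at_top" by eventually_elim simp
        then have "Limsup at_top (\<lambda>x. ereal (?V x)) \<le> ereal (\<Lambda>\<^sup>2)" by (rule Limsup_bounded)
        then show False using lt lim by simp
      qed
      show ?thesis
        by (rule limsup_lower_AE[OF assms(6) q flat \<Lambda>(1) freq \<kappa>(1) \<Lambda>(2)[unfolded s_def]])
    qed
    \<comment> \<open>Rational levels leave only countably many null sets, and density recovers the
      exact bound.\<close>
    have "AE \<omega> in M. \<forall>r::rat. 0 \<le> real_of_rat r \<and> ereal (real_of_rat r) < ereal s * lam \<longrightarrow> ereal (real_of_rat r) \<le> ?L \<omega>"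
      unfolding AE_all_countable using one by (auto intro!: AE_impI)
    then show ?thesis
    proof eventually_elim
      case (elim \<omega>)
      show ?case unfolding s_def[symmetric]
      proof (rule ccontr)
        assume "\<not> ereal s * lam \<le> ?L \<omega>"
        then have "?L \<omega> < ereal s * lam" by simp
        then obtain r :: rat where r: "?L \<omega> < ereal (real_of_rat r)" "ereal (real_of_rat r) < ereal s * lam"
          using ereal_dense3 by blast
        have "0 \<le> ?L \<omega>" by (rule limsup_nonneg)
        then have "0 \<le> ereal (real_of_rat r)" using r(1) by (meson less_imp_le order_trans)
        then have "ereal (real_of_rat r) \<le> ?L \<omega>" using elim r(2) by simp
        then show False using r(1) by simp
      qed
    qed
  qed
  show ?thesis using lower upper by eventually_elim simp
qed

end
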